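(* Let $G$ be a finitely generated group and $A$ a finite alphabet not containing the blank symbol $\sqcup$. A subshift $X\subset A^G$ is $G$-effectively closed if and only if there exists a $G$-recursively enumerable set of patterns $\mathcal F\subset A_G^*$ such that $X=X_{\mathcal F}$.
   Context: Let $S\subset G$ be a finite generating set closed under inverses and containing $1_G$. Words in $S^*$ represent elements of $G$; write $u=_G v$ if they represent the same element. $\mathtt{WP}(G)=\{w\in S^*: w=_G 1_G\}$. $A^G$ has the product topology and left shift action $(\sigma_g x)_h=x_{g^{-1}h}$; a subshift is a closed shift-invariant subset. Put $[a]_g=\{x\in A^G:x_g=a\}$. A pattern is an element $p\in A^F$ with $F\subset G$ finite, $[p]_g=\bigcap_{h\in F}[p_h]_{gh}$, $A_G^*$ is the set of all patterns, and for $\mathcal F\subset A_G^*$, $X_{\mathcal F}=\bigcap_{p\in\mathcal F,\,g\in G}A^G\setminus[p]_g$. A pattern coding over $A$ is a finite set $c$ of pairs $(w,a)$ with $w\in S^*$, $a\in A$. For a set $\mathcal C$ of pattern codings, $X_{\mathcal C}=\bigcap_{g\in G,\,c\in\mathcal C}\big(A^G\setminus\bigcap_{(w,a)\in c}[a]_{gw}\big)$. $X\subset A^G$ is $G$-effectively closed if $X=X_{\mathcal C}$ for some set $\mathcal C$ of pattern codings that is recursively enumerable by a Turing machine with oracle $\mathtt{WP}(G)$. A $G$-machine is a tuple $(Q,\Sigma,\sqcup,q_0,Q_F,\delta)$ with $Q$ a finite set of states, $\Sigma$ a finite tape alphabet, $\sqcup\in\Sigma$ the blank symbol, $q_0\in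 Q$ the initial state, $Q_F\subset Q$ the accepting states, and $\delta:\Sigma\times Q\to\Sigma\times Q\times S$. It acts on $\Sigma^G\times Q$ by: if $\delta(x_{1_G},q)=(a,q',s)$ then $T(x,q)=(\sigma_{s^{-1}}(\widetilde x),q')$, where $\widetilde x_{1_G}=a$ and $\widetilde x$ equals $x$ elsewhere. For a pattern $p\in\Sigma^F$, $x^p\in\Sigma^G$ equals $p$ on $F$ and $\sqcup$ off $F$; $T$ accepts $p$ if $T^n(x^p,q_0)\in\Sigma^G\times Q_F$ for some $n\in\mathbb N$. A set $L\subset A_G^*$ is $G$-recursively enumerable if there is a $G$-machine whose tape alphabet $\Sigma$ contains $A$ and which, for every $p\in A_G^*$, accepts $p$ if and only if $p\in L$. *)

theory Defs
  imports
    "HOL-Algebra.Generated_Groups"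
    "HOL-Analysis.Function_Topology"
begin

section \<open>Words, configurations and subshifts\<close>

definition word_value :: "('g, 'm) monoid_scheme \<Rightarrow> 'g list \<Rightarrow> 'g" where
  "word_value G w = foldr (mult G) w (one G)"

definition word_problem :: "('g, 'm) monoid_scheme \<Rightarrow> 'g set \<Rightarrow> 'g list set" where
  "word_problem G S = {w \<in> lists S. word_value G w = \<one>\<^bsub>G\<^esub>}"

definition configurations :: "('g, 'm) monoid_scheme \<Rightarrow> 'a set \<Rightarrow> ('g \<Rightarrow> 'a) set" where
  "configurations G A = carrier G \<rightarrow>\<^sub>E A"

definition shift :: "('g, 'm) monoid_scheme \<Rightarrow> 'g \<Rightarrow> ('g \<Rightarrow> 'a) \<Rightarrow> 'g \<Rightarrow> 'a" where
  "shift G g x = (\<lambda>h\<in>carrier G. x (inv\<^bsub>G\<^esub> g \<otimes>\<^bsub>G\<^esub> h))"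

definition subshift :: "('g, 'm) monoid_scheme \<Rightarrow> 'a set \<Rightarrow> ('g \<Rightarrow> 'a) set \<Rightarrow> bool" where
  "subshift G A X \<longleftrightarrow>
     closedin (product_topology (\<lambda>_. discrete_topology A) (carrier G)) X \<and>
     (\<forall>g\<in>carrier G. shift G g ` X \<subseteq> X)"

definition symbol_cylinder :: "('g, 'm) monoid_scheme \<Rightarrow> 'a set \<Rightarrow> 'a \<Rightarrow> 'g \<Rightarrow> ('g \<Rightarrow> 'a) set" where
  "symbol_cylinder G A a g = {x \<in> configurations G A. x g = a}"

text \<open>A pattern with support \<open>F\<close> is a partial function with domain \<open>F\<close>.\<close>

definition patterns :: "('g, 'm) monoid_scheme \<Rightarrow> 'a set \<Rightarrow> ('g \<rightharpoonup> 'a) set" where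
  "patterns G A = {p. finite (dom p) \<and> dom p \<subseteq> carrier G \<and> ran p \<subseteq> A}"

text \<open>Intersecting with the full shift only matters for empty families, where the
  intersection is taken inside the full shift.\<close>

definition pattern_cylinder ::
    "('g, 'm) monoid_scheme \<Rightarrow> 'a set \<Rightarrow> ('g \<rightharpoonup> 'a) \<Rightarrow> 'g \<Rightarrow> ('g \<Rightarrow> 'a) set" where
  "pattern_cylinder G A p g =
     configurations G A \<inter> (\<Inter>h\<in>dom p. symbol_cylinder G A (the (p h)) (g \<otimes>\<^bsub>G\<^esub> h))"

definition forbidding_patterns ::
    "('g, 'm) monoid_scheme \<Rightarrow> 'a set \<Rightarrow> ('g \<rightharpoonup> 'a) set \<Rightarrow> ('g \<Rightarrow> 'a) set" where
  "forbidding_patterns G A F =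
     configurations G A \<inter>
     (\<Inter>p\<in>F. \<Inter>g\<in>carrier G. configurations G A - pattern_cylinder G A p g)"

definition pattern_codings :: "'g set \<Rightarrow> 'a set \<Rightarrow> ('g list \<times> 'a) set set" where
  "pattern_codings S A = {c. finite c \<and> c \<subseteq> lists S \<times> A}"

definition coding_cylinder ::
    "('g, 'm) monoid_scheme \<Rightarrow> 'a set \<Rightarrow> ('g list \<times> 'a) set \<Rightarrow> 'g \<Rightarrow> ('g \<Rightarrow> 'a) set" where
  "coding_cylinder G A c g =
     configurations G A \<inter>
     (\<Inter>(w, a)\<in>c. symbol_cylinder G A a (g \<otimes>\<^bsub>G\<^esub> word_value G w))"

definition forbidding_codings ::
    "('g, 'm) monoid_scheme \<Rightarrow> 'a set \<Rightarrow> ('g list \<times> 'a) set set \<Rightarrow> ('g \<Rightarrow> 'a) set" where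
  "forbidding_codings G A C =
     configurations G A \<inter>
     (\<Inter>g\<in>carrier G. \<Inter>c\<in>C. configurations G A - coding_cylinder G A c g)"

section \<open>Turing machines with an oracle\<close>

text \<open>Machines are described up to renaming of states and auxiliary symbols: states are natural
  numbers, and a tape alphabet extending an alphabet \<open>I\<close> is a finite set of symbols
  containing \<open>Letter ` I\<close> and the blank, which is not a letter.\<close>

datatype 'i tape_symbol = Letter 'i | Blank | Aux nat

datatype head_move = Go_Left | Stay | Go_Right

fun head_shift :: "head_move \<Rightarrow> int" where
  "head_shift Go_Left = -1"
| "head_shift Stay = 0"
| "head_shift Go_Right = 1"

text \<open>The machine has a two-sided infinite work tape, initially holding the input, and a
  write-only query tape. An ordinary transition may append one letter to the query tape. In the
  query state the machine consults the oracle on the word written on the query tape, moves to the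
  state \<open>otm_yes\<close> or \<open>otm_no\<close> accordingly, and the query tape is erased.\<close>

record ('i, 'o) oracle_tm =
  otm_states :: "nat set"
  otm_symbols :: "'i tape_symbol set"
  otm_init :: nat
  otm_accepting :: "nat set"
  otm_query :: nat
  otm_yes :: nat
  otm_no :: nat
  otm_delta :: "'i tape_symbol \<times> nat \<Rightarrow> 'i tape_symbol \<times> nat \<times> head_move \<times> 'o option"

record ('i, 'o) otm_config =
  otm_state :: nat
  otm_tape :: "int \<Rightarrow> 'i tape_symbol"
  otm_head :: int
  otm_query_word :: "'o list"

definition is_oracle_tm :: "'i set \<Rightarrow> 'o set \<Rightarrow> ('i, 'o) oracle_tm \<Rightarrow> bool" where
  "is_oracle_tm I B M \<longleftrightarrow>
     finite (otm_states M) \<and> finite (otm_symbols M) \<and>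
     Blank \<in> otm_symbols M \<and> Letter ` I \<subseteq> otm_symbols M \<and>
     {otm_init M, otm_query M, otm_yes M, otm_no M} \<subseteq> otm_states M \<and>
     otm_accepting M \<subseteq> otm_states M \<and>
     otm_delta M \<in> otm_symbols M \<times> otm_states M \<rightarrow>
       otm_symbols M \<times> otm_states M \<times> UNIV \<times> insert None (Some ` B)"

definition otm_step ::
    "'o list set \<Rightarrow> ('i, 'o) oracle_tm \<Rightarrow> ('i, 'o) otm_config \<Rightarrow> ('i, 'o) otm_config" where
  "otm_step L M c =
     (if otm_state c = otm_query M then
        c\<lparr>otm_state := (if otm_query_word c \<in> L then otm_yes M else otm_no M),
          otm_query_word := []\<rparr>
      else
        (case otm_delta M (otm_tape c (otm_head c), otm_state c) of (a, q, m, e) \<Rightarrow>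
          \<lparr>otm_state = q,
           otm_tape = (otm_tape c)(otm_head c := a),
           otm_head = otm_head c + head_shift m,
           otm_query_word =
             (case e of None \<Rightarrow> otm_query_word c | Some b \<Rightarrow> otm_query_word c @ [b])\<rparr>))"

definition otm_start :: "('i, 'o) oracle_tm \<Rightarrow> 'i list \<Rightarrow> ('i, 'o) otm_config" where
  "otm_start M w =
     \<lparr>otm_state = otm_init M,
      otm_tape = (\<lambda>i. if 0 \<le> i \<and> i < int (length w) then Letter (w ! nat i) else Blank),
      otm_head = 0,
      otm_query_word = []\<rparr>"

definition otm_accepts :: "'o list set \<Rightarrow> ('i, 'o) oracle_tm \<Rightarrow> 'i list \<Rightarrow> bool" where
  "otm_accepts L M w \<longleftrightarrow>
     (\<exists>n. otm_state ((otm_step L M ^^ n) (otm_start M w)) \<in> otm_accepting M)"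

text \<open>\<open>K\<close> is a language over \<open>I\<close>, the oracle \<open>L\<close> is a language over \<open>B\<close>.\<close>

definition oracle_re :: "'o set \<Rightarrow> 'o list set \<Rightarrow> 'i set \<Rightarrow> 'i list set \<Rightarrow> bool" where
  "oracle_re B L I K \<longleftrightarrow>
     K \<subseteq> lists I \<and>
     (\<exists>M. is_oracle_tm I B M \<and> (\<forall>w\<in>lists I. otm_accepts L M w \<longleftrightarrow> w \<in> K))"

text \<open>The list \<open>(w\<^sub>1, a\<^sub>1), \<dots>, (w\<^sub>n, a\<^sub>n)\<close> is written as the word
  \<open>w\<^sub>1 a\<^sub>1 \<dots> w\<^sub>n a\<^sub>n\<close> over the disjoint union of the two alphabets; a set of pattern codings is
  presented to a machine as the language of all such listings of its members.\<close>

definition encode_listing :: "('g list \<times> 'a) list \<Rightarrow> ('g + 'a) list" where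
  "encode_listing l = concat (map (\<lambda>(w, a). map Inl w @ [Inr a]) l)"

definition oracle_re_codings ::
    "('g, 'm) monoid_scheme \<Rightarrow> 'g set \<Rightarrow> 'a set \<Rightarrow> ('g list \<times> 'a) set set \<Rightarrow> bool" where
  "oracle_re_codings G S A C \<longleftrightarrow>
     C \<subseteq> pattern_codings S A \<and>
     oracle_re S (word_problem G S) (S <+> A) {encode_listing l | l. set l \<in> C}"

definition effectively_closed ::
    "('g, 'm) monoid_scheme \<Rightarrow> 'g set \<Rightarrow> 'a set \<Rightarrow> ('g \<Rightarrow> 'a) set \<Rightarrow> bool" where
  "effectively_closed G S A X \<longleftrightarrow>
     (\<exists>C. oracle_re_codings G S A C \<and> X = forbidding_codings G A C)"

section \<open>G-machines\<close>

record ('g, 's) G_machine =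
  gm_states :: "nat set"
  gm_symbols :: "'s set"
  gm_blank :: 's
  gm_init :: nat
  gm_accepting :: "nat set"
  gm_delta :: "'s \<times> nat \<Rightarrow> 's \<times> nat \<times> 'g"

definition is_G_machine :: "'g set \<Rightarrow> ('g, 's) G_machine \<Rightarrow> bool" where
  "is_G_machine S M \<longleftrightarrow>
     finite (gm_states M) \<and> finite (gm_symbols M) \<and>
     gm_blank M \<in> gm_symbols M \<and> gm_init M \<in> gm_states M \<and>
     gm_accepting M \<subseteq> gm_states M \<and>
     gm_delta M \<in> gm_symbols M \<times> gm_states M \<rightarrow> gm_symbols M \<times> gm_states M \<times> S"

definition gm_step ::
    "('g, 'm) monoid_scheme \<Rightarrow> ('g, 's) G_machine \<Rightarrow> ('g \<Rightarrow> 's) \<times> nat \<Rightarrow> ('g \<Rightarrow> 's) \<times> nat" where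
  "gm_step G M = (\<lambda>(x, q).
     case gm_delta M (x \<one>\<^bsub>G\<^esub>, q) of (a, q', s) \<Rightarrow>
       (shift G (inv\<^bsub>G\<^esub> s) (x(\<one>\<^bsub>G\<^esub> := a)), q'))"

definition pattern_config ::
    "('g, 'm) monoid_scheme \<Rightarrow> 's \<Rightarrow> ('g \<rightharpoonup> 's) \<Rightarrow> 'g \<Rightarrow> 's" where
  "pattern_config G b p = (\<lambda>h\<in>carrier G. case p h of None \<Rightarrow> b | Some a \<Rightarrow> a)"

definition gm_accepts ::
    "('g, 'm) monoid_scheme \<Rightarrow> ('g, 's) G_machine \<Rightarrow> ('g \<rightharpoonup> 's) \<Rightarrow> bool" where
  "gm_accepts G M p \<longleftrightarrow>
     (\<exists>n. snd ((gm_step G M ^^ n) (pattern_config G (gm_blank M) p, gm_init M)) \<in> gm_accepting M)"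

definition G_recursively_enumerable ::
    "('g, 'm) monoid_scheme \<Rightarrow> 'g set \<Rightarrow> 'a set \<Rightarrow> ('g \<rightharpoonup> 'a) set \<Rightarrow> bool" where
  "G_recursively_enumerable G S A L \<longleftrightarrow>
     L \<subseteq> patterns G A \<and>
     (\<exists>M :: ('g, 'a tape_symbol) G_machine.
        is_G_machine S M \<and> gm_blank M = Blank \<and> Letter ` A \<subseteq> gm_symbols M \<and>
        (\<forall>p\<in>patterns G A. gm_accepts G M (map_option Letter \<circ> p) \<longleftrightarrow> p \<in> L))"

end

theory Submission imports Defs begin

text \<open>Each direction turns one kind of machine into the other. The set of codings, or of patterns, is then
\<^emph>\<open>defined\<close> as what the constructed machine accepts, so that enumerability is immediate and only the
equality of the two forbidden subshifts remains to be checked.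

\<^bold>\<open>From patterns to codings.\<close> Let \<open>N\<close> be a \<open>G\<close>-machine. A Turing machine that is given a listing
of a coding simulates \<open>N\<close> on the pattern which the coding describes, without ever computing a position in
\<open>G\<close>: in front of the listing it keeps a trail, newest entry first, of the symbols that \<open>N\<close> has written
and of the inverses of the steps that \<open>N\<close> has made. The position of the head is the inverse of the
product of these inverted steps. Hence an earlier write, or a listed letter, sits under the head if and only
if a word that can be read off the tape from left to right is trivial in \<open>G\<close>, and the symbol under the
head is found by one oracle query per candidate (\<open>search_trail\<close>). A listing that puts two different
letters under the head makes the simulation hang. Thus acceptance depends only on the listed set, as it must,
and inconsistent codings do no harm since their cylinders are empty. The resulting set of codings is
enumerable (\<open>re_accepted_codings\<close>) and a consistent coding is accepted if and only if its pattern is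
(\<open>accepted_coding_pattern\<close>).

\<^bold>\<open>From codings to patterns, \<open>G\<close> finite.\<close> A \<open>G\<close>-machine can read its whole tape into its
finite control, so every set of patterns is \<open>G\<close>-recursively enumerable (\<open>G_re_of_finite_group\<close>), and a
subshift is defined by the total patterns outside of it.

\<^bold>\<open>From codings to patterns, \<open>G\<close> infinite.\<close> Let \<open>M\<close> be an oracle machine for a set \<open>C\<close> of
codings. The \<open>G\<close>-machine to be built accepts a pattern \<open>p\<close> if and only if \<open>M\<close> accepts a listing all
of whose entries agree with \<open>p\<close>. Its memory is a ball of the Cayley graph, in which it maintains a spanning
tree by storing at each element the index of the generator that leads to it from its parent. A depth-first
traversal (\<open>moves_sweep\<close>) turns the ball into a linear tape, and since \<open>G\<close> is infinite there are balls of
every size. On each ball the machine runs through all words \<open>z\<close> that fit on the tape and tries each for a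
bounded time: first it walks through \<open>G\<close> along the words of \<open>z\<close> and compares the letters of \<open>z\<close>
with those of \<open>p\<close>, and then it simulates \<open>M\<close> on \<open>z\<close>. The query tape of \<open>M\<close> is never stored. A single
mark, the walker, stands on the value of the query word, so that the oracle answers yes if and only if the walker
is at the identity. Lack of time or space ends a trial, and after the last word the ball grows. Every
successful trial fits into some ball, and every trial ends, so nothing is missed (\<open>search_finds_iff\<close>).\<close>

section \<open>Deterministic runs\<close>

definition accepts :: "('c \<Rightarrow> 'c) \<Rightarrow> ('c \<Rightarrow> bool) \<Rightarrow> 'c \<Rightarrow> bool" where
  "accepts f acc c \<longleftrightarrow> (\<exists>n. acc ((f ^^ n) c))"

definition move :: "('c \<Rightarrow> 'c) \<Rightarrow> ('c \<Rightarrow> bool) \<Rightarrow> 'c \<Rightarrow> 'c \<Rightarrow> bool" where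
  "move f acc c c' \<longleftrightarrow> \<not> acc c \<and> c' = f c"

lemma accepts_now: "acc c \<Longrightarrow> accepts f acc c"
  unfolding accepts_def by (rule exI[of _ 0]) simp

lemma accepts_step: "\<not> acc c \<Longrightarrow> accepts f acc (f c) \<longleftrightarrow> accepts f acc c"
proof -
  assume na: "\<not> acc c"
  have "accepts f acc c \<Longrightarrow> accepts f acc (f c)"
    unfolding accepts_def
  proof (elim exE)
    fix n assume "acc ((f ^^ n) c)"
    then show "\<exists>n. acc ((f ^^ n) (f c))"
      using na by (cases n) (auto simp: funpow_swap1)
  qed
  moreover have "accepts f acc (f c) \<Longrightarrow> accepts f acc c"
    unfolding accepts_def
  proof (elim exE)
    fix n assume "acc ((f ^^ n) (f c))"
    then have "acc ((f ^^ Suc n) c)" by (simp add: funpow_swap1)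
    then show "\<exists>n. acc ((f ^^ n) c)" ..
  qed
  ultimately show ?thesis by blast
qed

lemma accepts_move: "move f acc c c' \<Longrightarrow> accepts f acc c' \<longleftrightarrow> accepts f acc c"
  using accepts_step[of acc c f] by (simp add: move_def)

lemma accepts_moves: "(move f acc)\<^sup>*\<^sup>* c c' \<Longrightarrow> accepts f acc c' \<longleftrightarrow> accepts f acc c"
proof (induction rule: rtranclp_induct)
  case (step c' c'')
  then show ?case using accepts_move[OF step.hyps(2)] by blast
qed simp

lemma accepts_invariant_False:
  assumes "P c" and "\<And>c. P c \<Longrightarrow> P (f c)" and "\<And>c. P c \<Longrightarrow> \<not> acc c"
  shows "\<not> accepts f acc c"
proof -
  have "P ((f ^^ n) c)" for n by (induction n) (auto simp: assms)
  then show ?thesis unfolding accepts_def using assms(3) by blast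
qed

text \<open>An accepting run cannot end before \<open>c'\<close> is reached. As at least one step is needed to reach
\<open>c'\<close>, the remaining run is strictly shorter, which makes induction on its length possible.\<close>

lemma moves_countdown:
  assumes "(move f acc)\<^sup>+\<^sup>+ c c'" and "acc ((f ^^ n) c)"
  shows "\<exists>n'<n. acc ((f ^^ n') c')"
  using assms
proof (induction arbitrary: rule: tranclp_induct)
  case (base c')
  then show ?case by (cases n) (auto simp: move_def funpow_swap1)
next
  case (step c' c'')
  then obtain n' where n': "n' < n" "acc ((f ^^ n') c')" by blast
  then show ?case using step.hyps(2)
    by (cases n') (auto simp: move_def funpow_swap1 intro!: exI[of _ "n' - 1"])
qed

text \<open>Every simulation below has this form: one step of \<open>F\<close> is matched by at least one step of
\<open>f\<close>, and no accepting state of \<open>f\<close> is passed on the way. The last point is built into \<open>move\<close>,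
and it is what excludes that \<open>f\<close> accepts although \<open>F\<close> does not.\<close>

lemma accepts_simulation:
  assumes start: "R c a"
    and step: "\<And>c a. R c a \<Longrightarrow> \<not> Acc a \<Longrightarrow> \<exists>c'. (move f acc)\<^sup>+\<^sup>+ c c' \<and> R c' (F a)"
    and stop: "\<And>c a. R c a \<Longrightarrow> Acc a \<Longrightarrow> accepts f acc c"
  shows "accepts f acc c \<longleftrightarrow> accepts F Acc a"
proof
  assume "accepts f acc c"
  then obtain n where "acc ((f ^^ n) c)" unfolding accepts_def by blast
  with start show "accepts F Acc a"
  proof (induction n arbitrary: c a rule: less_induct)
    case (less n)
    show ?case
    proof (cases "Acc a")
      case True then show ?thesis by (rule accepts_now)
    next
      case False
      with step[OF less.prems(1)] obtain c' where c': "(move f acc)\<^sup>+\<^sup>+ c c'" "R c' (F a)" by blast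
      with less moves_countdown[OF c'(1) less.prems(2)] have "accepts F Acc (F a)" by blast
      then show ?thesis using False by (simp add: accepts_step)
    qed
  qed
next
  assume "accepts F Acc a"
  then obtain n where "Acc ((F ^^ n) a)" unfolding accepts_def by blast
  with start show "accepts f acc c"
  proof (induction n arbitrary: c a)
    case 0 then show ?case using stop by simp
  next
    case (Suc n)
    show ?case
    proof (cases "Acc a")
      case True then show ?thesis using stop Suc.prems by blast
    next
      case False
      with step[OF Suc.prems(1)] obtain c' where c': "(move f acc)\<^sup>+\<^sup>+ c c'" "R c' (F a)" by blast
      have "Acc ((F ^^ n) (F a))" using Suc.prems(2) by (simp add: funpow_swap1)
      with Suc.IH[OF c'(2)] have "accepts f acc c'" .
      then show ?thesis using accepts_moves[OF tranclp_into_rtranclp[OF c'(1)]] by blast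
    qed
  qed
qed

lemma accepts_lockstep:
  assumes "R c a"
    and "\<And>c a. R c a \<Longrightarrow> R (f c) (F a)"
    and "\<And>c a. R c a \<Longrightarrow> acc c \<longleftrightarrow> Acc a"
  shows "accepts f acc c \<longleftrightarrow> accepts F Acc a"
proof -
  have "R ((f ^^ n) c) ((F ^^ n) a)" for n
    by (induction n) (auto simp: assms)
  then show ?thesis unfolding accepts_def using assms(3) by blast
qed

section \<open>Machines over arbitrary finite alphabets\<close>

text \<open>Both machine models fix the type of tape symbols to letters, a blank and numbered auxiliary symbols. Any finite
alphabet embeds into it, so that machines can be described with alphabets and states of arbitrary types.\<close>

lemma ex_symbol_encoding:
  fixes \<Gamma> :: "'x set" and b :: 'x and \<iota> :: "'i \<Rightarrow> 'x"
  assumes "finite \<Gamma>" and "b \<in> \<Gamma>" and "\<iota> ` I \<subseteq> \<Gamma>" and "inj_on \<iota> I" and "b \<notin> \<iota> ` I"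
  shows "\<exists>e :: 'x \<Rightarrow> 'i tape_symbol. inj_on e \<Gamma> \<and> e b = Blank \<and> (\<forall>i\<in>I. e (\<iota> i) = Letter i)"
proof -
  obtain n :: "'x \<Rightarrow> nat" where n: "inj_on n \<Gamma>"
    using finite_imp_inj_to_nat_seg[OF assms(1)] by blast
  define e where "e x = (if x = b then Blank else if x \<in> \<iota> ` I then Letter (inv_into I \<iota> x)
    else Aux (n x))" for x
  have "inj_on e \<Gamma>"
  proof (rule inj_onI)
    fix x y assume xy: "x \<in> \<Gamma>" "y \<in> \<Gamma>" "e x = e y"
    then show "x = y"
      using n inj_onD[OF n] inj_on_inv_into[of _ \<iota> I] assms
      by (auto simp: e_def split: if_splits)
  qed
  moreover have "e b = Blank" by (simp add: e_def)
  moreover have "\<forall>i\<in>I. e (\<iota> i) = Letter i" using assms by (auto simp: e_def)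
  ultimately show ?thesis by blast
qed

text \<open>The step function of an oracle machine in which symbols, states and the four distinguished
states are arbitrary; \<open>qa\<close> is the query state and \<open>qy\<close>, \<open>qn\<close> are the states for its answers.\<close>

definition tm_step :: "'o list set \<Rightarrow> 'q \<Rightarrow> 'q \<Rightarrow> 'q \<Rightarrow> ('x \<Rightarrow> 'q \<Rightarrow> 'x \<times> 'q \<times> head_move \<times> 'o option) \<Rightarrow>
    'q \<times> (int \<Rightarrow> 'x) \<times> int \<times> 'o list \<Rightarrow> 'q \<times> (int \<Rightarrow> 'x) \<times> int \<times> 'o list" where
  "tm_step L qa qy qn \<delta> = (\<lambda>(q, t, h, u).
     if q = qa then (if u \<in> L then qy else qn, t, h, [])
     else (case \<delta> (t h) q of (x, q', m, e) \<Rightarrow>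
       (q', t(h := x), h + head_shift m, (case e of None \<Rightarrow> u | Some o' \<Rightarrow> u @ [o']))))"

definition tm_input :: "'x \<Rightarrow> ('i \<Rightarrow> 'x) \<Rightarrow> 'i list \<Rightarrow> int \<Rightarrow> 'x" where
  "tm_input b \<iota> w = (\<lambda>i. if 0 \<le> i \<and> i < int (length w) then \<iota> (w ! nat i) else b)"

lemma oracle_tm_of_abstract:
  fixes \<Gamma> :: "'x set" and \<iota> :: "'i \<Rightarrow> 'x" and Q :: "'q set" and B :: "'o set"
  assumes fin: "finite \<Gamma>" "finite Q"
    and syms: "b \<in> \<Gamma>" "\<iota> ` I \<subseteq> \<Gamma>" "inj_on \<iota> I" "b \<notin> \<iota> ` I"
    and sts: "{qi, qa, qy, qn} \<subseteq> Q"
    and \<delta>: "\<And>x q x' q' m e. x \<in> \<Gamma> \<Longrightarrow> q \<in> Q \<Longrightarrow> \<delta> x q = (x', q', m, e) \<Longrightarrow>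
       x' \<in> \<Gamma> \<and> q' \<in> Q \<and> e \<in> insert None (Some ` B)"
  shows "\<exists>M. is_oracle_tm I B M \<and> (\<forall>w\<in>lists I. otm_accepts L M w \<longleftrightarrow>
    accepts (tm_step L qa qy qn \<delta>) (\<lambda>(q, _). acc q) (qi, tm_input b \<iota> w, 0, []))"
proof -
  obtain e :: "'x \<Rightarrow> 'i tape_symbol" where
    e: "inj_on e \<Gamma>" "e b = Blank" "\<And>i. i \<in> I \<Longrightarrow> e (\<iota> i) = Letter i"
    using ex_symbol_encoding[OF fin(1) syms] by blast
  obtain n :: "'q \<Rightarrow> nat" where n: "inj_on n Q"
    using finite_imp_inj_to_nat_seg[OF fin(2)] by blast
  define M :: "('i, 'o) oracle_tm" where "M = \<lparr>otm_states = n ` Q, otm_symbols = e ` \<Gamma>,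
    otm_init = n qi, otm_accepting = n ` {q\<in>Q. acc q}, otm_query = n qa, otm_yes = n qy, otm_no = n qn,
    otm_delta = (\<lambda>(s, k). case \<delta> (inv_into \<Gamma> e s) (inv_into Q n k) of (x, q, m, o') \<Rightarrow>
       (e x, n q, m, o'))\<rparr>"
  have "is_oracle_tm I B M"
    unfolding is_oracle_tm_def
  proof (intro conjI)
    show "Letter ` I \<subseteq> otm_symbols M" using e syms by (force simp: M_def)
    show "Blank \<in> otm_symbols M" using e syms by (force simp: M_def)
    show "otm_delta M \<in> otm_symbols M \<times> otm_states M \<rightarrow>
       otm_symbols M \<times> otm_states M \<times> UNIV \<times> insert None (Some ` B)"
    proof
      fix p assume "p \<in> otm_symbols M \<times> otm_states M"
      then obtain x q where p: "p = (e x, n q)" and xq: "x \<in> \<Gamma>" "q \<in> Q" by (auto simp: M_def)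
      obtain x' q' m o' where d: "\<delta> x q = (x', q', m, o')" by (metis prod_cases4)
      then have "otm_delta M p = (e x', n q', m, o')" unfolding M_def p using inv_into_f_f[OF e(1) xq(1)] inv_into_f_f[OF n xq(2)] by simp
      with \<delta>[OF xq d] show "otm_delta M p \<in> otm_symbols M \<times> otm_states M \<times> UNIV \<times> insert None (Some ` B)"
        by (auto simp: M_def)
    qed
  qed (use fin sts in \<open>auto simp: M_def\<close>)
  moreover have "otm_accepts L M w \<longleftrightarrow>
    accepts (tm_step L qa qy qn \<delta>) (\<lambda>(q, _). acc q) (qi, tm_input b \<iota> w, 0, [])" if w: "w \<in> lists I" for w
  proof -
    define R where "R c a \<longleftrightarrow> (case a of (q, t, h, u) \<Rightarrow> q \<in> Q \<and> range t \<subseteq> \<Gamma> \<and>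
       c = \<lparr>otm_state = n q, otm_tape = e \<circ> t, otm_head = h, otm_query_word = u\<rparr>)" for c :: "('i, 'o) otm_config" and a
    have "otm_accepts L M w \<longleftrightarrow> accepts (otm_step L M) (\<lambda>c. otm_state c \<in> otm_accepting M) (otm_start M w)"
      by (simp add: otm_accepts_def accepts_def)
    also have "\<dots> \<longleftrightarrow> accepts (tm_step L qa qy qn \<delta>) (\<lambda>(q, _). acc q) (qi, tm_input b \<iota> w, 0, [])"
    proof (rule accepts_lockstep[where R = R])
      have nth: "nat i < length w \<Longrightarrow> w ! nat i \<in> I" for i using w by (auto simp: in_lists_conv_set)
      show "R (otm_start M w) (qi, tm_input b \<iota> w, 0, [])"
        using sts syms e nth by (auto simp: R_def otm_start_def M_def tm_input_def fun_eq_iff)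
    next
      fix c :: "('i, 'o) otm_config" and a assume R: "R c a"
      obtain q t h u where a: "a = (q, t, h, u)" by (metis prod_cases4)
      have q: "q \<in> Q" and t: "range t \<subseteq> \<Gamma>" and th: "t h \<in> \<Gamma>"
        and c: "c = \<lparr>otm_state = n q, otm_tape = e \<circ> t, otm_head = h, otm_query_word = u\<rparr>"
        using R by (auto simp: R_def a)
      show "(otm_state c \<in> otm_accepting M) = (case a of (q, _) \<Rightarrow> acc q)"
        using q n by (auto simp: M_def a c inj_on_def)
      have qa: "n q = n qa \<longleftrightarrow> q = qa" using n q sts by (auto simp: inj_on_def)
      obtain x' q' m o' where d: "\<delta> (t h) q = (x', q', m, o')" by (metis prod_cases4)
      have d': "otm_delta M (e (t h), n q) = (e x', n q', m, o')"
        unfolding M_def using inv_into_f_f[OF e(1) th] inv_into_f_f[OF n q] d by simp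
      show "R (otm_step L M c) (tm_step L qa qy qn \<delta> a)"
      proof (cases "q = qa")
        case True
        then show ?thesis using sts t by (auto simp: R_def a c otm_step_def tm_step_def M_def)
      next
        case False
        have "e \<circ> t(h := x') = (e \<circ> t)(h := e x')" by (auto simp: fun_eq_iff)
        with False \<delta>[OF th q d] d d' qa t show ?thesis
          by (auto simp: R_def a c otm_step_def tm_step_def M_def split: option.splits)
      qed
    qed
    finally show ?thesis .
  qed
  ultimately show ?thesis by blast
qed

text \<open>A \<open>G\<close>-machine in a fixed frame of reference: the tape stays and the head position
\<open>h\<close> moves, whereas \<^const>\<open>gm_step\<close> shifts the tape below a head at the identity.\<close>

definition walk_step :: "('g, 'm) monoid_scheme \<Rightarrow> ('l \<Rightarrow> 'q \<Rightarrow> 'l \<times> 'q \<times> 'g) \<Rightarrow>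
    ('g \<Rightarrow> 'l) \<times> 'g \<times> 'q \<Rightarrow> ('g \<Rightarrow> 'l) \<times> 'g \<times> 'q" where
  "walk_step G \<delta> = (\<lambda>(y, h, q). case \<delta> (y h) q of (l, q', s) \<Rightarrow> (y(h := l), h \<otimes>\<^bsub>G\<^esub> s, q'))"

lemma gm_step_absolute:
  fixes G :: "('g, 'm) monoid_scheme"
  assumes G: "group G" and h: "h \<in> carrier G" and d: "gm_delta N (y h, q) = (a, q', s)"
    and s: "s \<in> carrier G"
  shows "gm_step G N (\<lambda>k\<in>carrier G. y (h \<otimes>\<^bsub>G\<^esub> k), q) =
    (\<lambda>k\<in>carrier G. (y(h := a)) ((h \<otimes>\<^bsub>G\<^esub> s) \<otimes>\<^bsub>G\<^esub> k), q')"
proof -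
  interpret group G by (rule G)
  have eq: "h \<otimes>\<^bsub>G\<^esub> (s \<otimes>\<^bsub>G\<^esub> k) = h \<longleftrightarrow> s \<otimes>\<^bsub>G\<^esub> k = \<one>\<^bsub>G\<^esub>" if "k \<in> carrier G" for k
    using h s that by (metis l_cancel_one' m_closed)
  show ?thesis using h s d
    by (auto simp: gm_step_def shift_def fun_eq_iff restrict_def m_assoc eq)
qed

lemma G_machine_of_abstract:
  fixes G :: "('g, 'm) monoid_scheme" (structure) and \<iota> :: "'a \<Rightarrow> 'l" and Q :: "'q set" and \<Lambda> :: "'l set"
  assumes G: "group G" and S: "S \<subseteq> carrier G"
    and fin: "finite \<Lambda>" "finite Q"
    and syms: "b \<in> \<Lambda>" "\<iota> ` A \<subseteq> \<Lambda>" "inj_on \<iota> A" "b \<notin> \<iota> ` A"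
    and sts: "qi \<in> Q"
    and \<delta>: "\<And>l q l' q' s. l \<in> \<Lambda> \<Longrightarrow> q \<in> Q \<Longrightarrow> \<delta> l q = (l', q', s) \<Longrightarrow> l' \<in> \<Lambda> \<and> q' \<in> Q \<and> s \<in> S"
  shows "\<exists>M :: ('g, 'a tape_symbol) G_machine. is_G_machine S M \<and> gm_blank M = Blank \<and>
     Letter ` A \<subseteq> gm_symbols M \<and> (\<forall>p\<in>patterns G A. gm_accepts G M (map_option Letter \<circ> p) \<longleftrightarrow>
       accepts (walk_step G \<delta>) (\<lambda>(_, _, q). acc q)
         (\<lambda>g. case p g of None \<Rightarrow> b | Some a \<Rightarrow> \<iota> a, \<one>\<^bsub>G\<^esub>, qi))"
proof -
  interpret group G by (rule G)
  obtain e :: "'l \<Rightarrow> 'a tape_symbol" where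
    e: "inj_on e \<Lambda>" "e b = Blank" "\<And>i. i \<in> A \<Longrightarrow> e (\<iota> i) = Letter i"
    using ex_symbol_encoding[OF fin(1) syms] by blast
  obtain n :: "'q \<Rightarrow> nat" where n: "inj_on n Q"
    using finite_imp_inj_to_nat_seg[OF fin(2)] by blast
  define M :: "('g, 'a tape_symbol) G_machine" where "M = \<lparr>gm_states = n ` Q, gm_symbols = e ` \<Lambda>,
    gm_blank = Blank, gm_init = n qi, gm_accepting = n ` {q\<in>Q. acc q},
    gm_delta = (\<lambda>(s, k). case \<delta> (inv_into \<Lambda> e s) (inv_into Q n k) of (x, q, m) \<Rightarrow>
       (e x, n q, m))\<rparr>"
  have d: "gm_delta M (e l, n q) = (e l', n q', s)" if "\<delta> l q = (l', q', s)" "l \<in> \<Lambda>" "q \<in> Q" for l q l' q' s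
    unfolding M_def using inv_into_f_f[OF e(1) that(2)] inv_into_f_f[OF n that(3)] that(1) by simp
  have "is_G_machine S M"
    unfolding is_G_machine_def
  proof (intro conjI)
    show "gm_blank M \<in> gm_symbols M" using e syms by (force simp: M_def)
    show "gm_delta M \<in> gm_symbols M \<times> gm_states M \<rightarrow> gm_symbols M \<times> gm_states M \<times> S"
    proof
      fix p assume "p \<in> gm_symbols M \<times> gm_states M"
      then obtain x q where p: "p = (e x, n q)" and xq: "x \<in> \<Lambda>" "q \<in> Q" by (auto simp: M_def)
      obtain x' q' s where dd: "\<delta> x q = (x', q', s)" by (metis prod_cases3)
      with d[OF dd xq] \<delta>[OF xq dd] show "gm_delta M p \<in> gm_symbols M \<times> gm_states M \<times> S"
        by (auto simp: M_def p)
    qed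
  qed (use fin sts in \<open>auto simp: M_def\<close>)
  moreover have "gm_blank M = Blank" by (simp add: M_def)
  moreover have "Letter ` A \<subseteq> gm_symbols M" using e syms by (force simp: M_def)
  moreover have "gm_accepts G M (map_option Letter \<circ> p) \<longleftrightarrow>
       accepts (walk_step G \<delta>) (\<lambda>(_, _, q). acc q)
         (\<lambda>g. case p g of None \<Rightarrow> b | Some a \<Rightarrow> \<iota> a, \<one>\<^bsub>G\<^esub>, qi)" if p: "p \<in> patterns G A" for p
  proof -
    define R where "R c a \<longleftrightarrow> (case a of (y, h, q) \<Rightarrow> q \<in> Q \<and> range y \<subseteq> \<Lambda> \<and> h \<in> carrier G \<and>
       c = (\<lambda>k\<in>carrier G. e (y (h \<otimes> k)), n q))" for c :: "('g \<Rightarrow> 'a tape_symbol) \<times> nat" and a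
    let ?y0 = "\<lambda>g. case p g of None \<Rightarrow> b | Some a \<Rightarrow> \<iota> a"
    have "gm_accepts G M (map_option Letter \<circ> p) \<longleftrightarrow> accepts (gm_step G M) (\<lambda>c. snd c \<in> gm_accepting M)
      (pattern_config G (gm_blank M) (map_option Letter \<circ> p), gm_init M)"
      by (simp add: gm_accepts_def accepts_def)
    also have "\<dots> \<longleftrightarrow> accepts (walk_step G \<delta>) (\<lambda>(_, _, q). acc q) (?y0, \<one>, qi)"
    proof (rule accepts_lockstep[where R = R])
      have pa: "p g = Some a \<Longrightarrow> a \<in> A" for g a using p by (auto simp: patterns_def ran_def)
      have y0: "range ?y0 \<subseteq> \<Lambda>"
      proof clarify
        fix g show "?y0 g \<in> \<Lambda>" using syms(1,2) pa[of g] by (cases "p g") auto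
      qed
      have e0: "e (?y0 g) = (case (map_option Letter \<circ> p) g of None \<Rightarrow> Blank | Some a \<Rightarrow> a)" for g
        using e pa[of g] by (cases "p g") auto
      have "pattern_config G Blank (map_option Letter \<circ> p) = (\<lambda>k\<in>carrier G. e (?y0 (\<one> \<otimes> k)))"
        unfolding pattern_config_def using e0 by (intro restrict_ext) simp
      with y0 show "R (pattern_config G (gm_blank M) (map_option Letter \<circ> p), gm_init M) (?y0, \<one>, qi)"
        using sts by (simp add: R_def M_def)
    next
      fix c a assume R: "R c a"
      obtain y h q where a: "a = (y, h, q)" by (metis prod_cases3)
      have q: "q \<in> Q" and y: "range y \<subseteq> \<Lambda>" and yh: "y h \<in> \<Lambda>" and h: "h \<in> carrier G"
        and c: "c = (\<lambda>k\<in>carrier G. (e \<circ> y) (h \<otimes> k), n q)"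
        using R by (auto simp: R_def a)
      show "(snd c \<in> gm_accepting M) = (case a of (_, _, q) \<Rightarrow> acc q)"
        using q n by (auto simp: M_def a c inj_on_def)
      obtain x' q' s where dd: "\<delta> (y h) q = (x', q', s)" by (metis prod_cases3)
      have s: "s \<in> carrier G" using \<delta>[OF yh q dd] S by blast
      have gd: "gm_delta M ((e \<circ> y) h, n q) = (e x', n q', s)" using d[OF dd yh q] by simp
      have "(e \<circ> y)(h := e x') = e \<circ> y(h := x')" by (auto simp: fun_eq_iff)
      then show "R (gm_step G M c) (walk_step G \<delta> a)"
        using \<delta>[OF yh q dd] y h s gm_step_absolute[where y="e \<circ> y", OF G h gd s] dd
        by (auto simp: R_def a c walk_step_def)
    qed
    finally show ?thesis .
  qed
  ultimately show ?thesis by blast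
qed

section \<open>Words in a finitely generated group\<close>

locale fg_group = group G for G :: "('g, 'm) monoid_scheme" (structure) +
  fixes S :: "'g set"
  assumes finite_S: "finite S" and S_carrier: "S \<subseteq> carrier G"
    and generates: "generate G S = carrier G"
    and S_inv: "s \<in> S \<Longrightarrow> inv s \<in> S" and S_one: "\<one> \<in> S"
begin

abbreviation val :: "'g list \<Rightarrow> 'g" where "val \<equiv> word_value G"

lemma val_simps [simp]: "val [] = \<one>" "val (s # w) = s \<otimes> val w"
  by (simp_all add: word_value_def)

lemma S_closed [simp]: "s \<in> S \<Longrightarrow> s \<in> carrier G" using S_carrier by blast

lemma val_closed [simp]: "w \<in> lists S \<Longrightarrow> val w \<in> carrier G"
  by (induction w) auto

lemma val_append: "u \<in> lists S \<Longrightarrow> v \<in> lists S \<Longrightarrow> val (u @ v) = val u \<otimes> val v"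
  by (induction u) (auto simp: m_assoc)

lemma ex_word:
  assumes "g \<in> carrier G" obtains w where "w \<in> lists S" "val w = g"
proof -
  have "g \<in> generate G S" using assms generates by simp
  then have "\<exists>w\<in>lists S. val w = g"
  proof (induction rule: generate.induct)
    case one then show ?case by (intro bexI[of _ "[]"]) auto
  next
    case (incl h) then show ?case by (intro bexI[of _ "[h]"]) auto
  next
    case (inv h) then show ?case using S_inv by (intro bexI[of _ "[inv h]"]) auto
  next
    case (eng h1 h2)
    then obtain u v where "u \<in> lists S" "val u = h1" "v \<in> lists S" "val v = h2" by blast
    then show ?case by (intro bexI[of _ "u @ v"]) (auto simp: val_append)
  qed
  then show ?thesis using that by blast
qed

lemma word_problem_iff: "w \<in> word_problem G S \<longleftrightarrow> w \<in> lists S \<and> val w = \<one>"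
  by (simp add: word_problem_def)

end

section \<open>Sweeping Turing machines\<close>

datatype ('r, 'c) sweep_state = Fwd 'r | Ask | Yes | No | Ret 'r "'c option" | Halt

datatype ('c, 'r) sweep_symbol = Cell 'c | Note 'r | Gap

fun sweep :: "('r \<Rightarrow> 'c \<Rightarrow> 'r \<times> 'c \<times> 'o option) \<Rightarrow> 'r \<Rightarrow> 'c list \<Rightarrow> 'r \<times> 'c list \<times> 'o list" where
  "sweep \<tau> r [] = (r, [], [])"
| "sweep \<tau> r (c # cs) = (case \<tau> r c of (r', c', e) \<Rightarrow> case sweep \<tau> r' cs of (r'', cs', u) \<Rightarrow>
     (r'', c' # cs', (case e of None \<Rightarrow> u | Some x \<Rightarrow> x # u)))"

text \<open>A machine that works in rounds. Each round is a pass over the tape from left to right, in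
which a finite transducer \<open>\<tau>\<close> rewrites the cells and emits a query word. The oracle is consulted
once at the end of the pass, and depending on its answer \<open>fin\<close> selects the next state of the control and
possibly a new cell, which is placed at the left end.\<close>

definition round_step :: "('r \<Rightarrow> 'c \<Rightarrow> 'r \<times> 'c \<times> 'o option) \<Rightarrow> ('r \<Rightarrow> bool \<Rightarrow> 'r \<times> 'c option) \<Rightarrow>
    'o list set \<Rightarrow> 'r \<times> 'c list \<Rightarrow> 'r \<times> 'c list" where
  "round_step \<tau> fin L = (\<lambda>(r, cs). case sweep \<tau> r cs of (r1, cs', u) \<Rightarrow>
     case fin r1 (u \<in> L) of (r2, p) \<Rightarrow> (r2, (case p of None \<Rightarrow> cs' | Some c \<Rightarrow> c # cs')))"

text \<open>A query replaces the state of the machine, which would lose the state of the control.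
Before a query, the latter is therefore saved in the first free cell as a \<open>Note\<close>, where the head
still is when the answer arrives.\<close>

definition sweep_delta :: "('r \<Rightarrow> 'c \<Rightarrow> 'r \<times> 'c \<times> 'o option) \<Rightarrow> ('r \<Rightarrow> bool \<Rightarrow> 'r \<times> 'c option) \<Rightarrow>
    ('r \<Rightarrow> bool) \<Rightarrow> ('c, 'r) sweep_symbol \<Rightarrow> ('r, 'c) sweep_state \<Rightarrow>
    ('c, 'r) sweep_symbol \<times> ('r, 'c) sweep_state \<times> head_move \<times> 'o option" where
  "sweep_delta \<tau> fin acc x q =
    (let answer = (\<lambda>b. case x of
           Note r \<Rightarrow> (case fin r b of (r', p) \<Rightarrow> (Gap, Ret r' p, Go_Left, None))
         | _ \<Rightarrow> (x, q, Stay, None))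
     in case q of
       Fwd r \<Rightarrow> (case x of
           Cell c \<Rightarrow> (case \<tau> r c of (r', c', e) \<Rightarrow> (Cell c', Fwd r', Go_Right, e))
         | _ \<Rightarrow> (Note r, Ask, Stay, None))
     | Yes \<Rightarrow> answer True
     | No \<Rightarrow> answer False
     | Ret r p \<Rightarrow> (let q' = (if acc r then Halt else Fwd r) in case x of
           Cell c \<Rightarrow> (x, Ret r p, Go_Left, None)
         | _ \<Rightarrow> (case p of Some c \<Rightarrow> (Cell c, q', Stay, None) | None \<Rightarrow> (x, q', Go_Right, None)))
     | _ \<Rightarrow> (x, q, Stay, None))"

definition layout :: "int \<Rightarrow> 'c list \<Rightarrow> int \<Rightarrow> ('c, 'r) sweep_symbol" where
  "layout a cs = (\<lambda>i. if a \<le> i \<and> i < a + int (length cs) then Cell (cs ! nat (i - a)) else Gap)"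

lemma layout_at: "layout a (xs @ c # ys) (a + int (length xs)) = Cell c"
  by (simp add: layout_def)

lemma layout_upd: "(layout a (xs @ c # ys))(a + int (length xs) := Cell c') = layout a (xs @ c' # ys)"
proof
  fix i
  show "((layout a (xs @ c # ys))(a + int (length xs) := Cell c')) i = layout a (xs @ c' # ys) i"
  proof (cases "i = a + int (length xs)")
    case False
    then have "nat (i - a) \<noteq> length xs \<or> i < a" by auto
    then show ?thesis using False
      by (auto simp: layout_def nth_append nth_Cons split: nat.splits)
  qed (simp add: layout_def)
qed

lemma layout_push: "(layout a cs)(a - 1 := Cell c) = layout (a - 1) (c # cs)"
proof
  fix i
  have "nat (i - (a - 1)) = Suc (nat (i - a))" if "i \<ge> a" using that by simp
  then show "((layout a cs)(a - 1 := Cell c)) i = layout (a - 1) (c # cs) i"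
    by (auto simp: layout_def)
qed

lemma layout_end: "layout a cs (a + int (length cs)) = Gap" "layout a cs (a - 1) = Gap"
  by (simp_all add: layout_def)

lemma layout_gap: "(layout a cs)(a - 1 := Gap) = layout a cs"
  by (auto simp: layout_def fun_eq_iff)

context
  fixes \<tau> :: "'r \<Rightarrow> 'c \<Rightarrow> 'r \<times> 'c \<times> 'o option" and fin :: "'r \<Rightarrow> bool \<Rightarrow> 'r \<times> 'c option"
    and L :: "'o list set" and acc :: "'r \<Rightarrow> bool"
begin

abbreviation "sstep \<equiv> tm_step L Ask Yes No (sweep_delta \<tau> fin acc)"
abbreviation "smove \<equiv> move sstep (\<lambda>(q, _). q = Halt)"

lemma moves_forward:
  "sweep \<tau> r ys = (r', ys', u') \<Longrightarrow>
   smove\<^sup>*\<^sup>* (Fwd r, layout a (xs @ ys), a + int (length xs), u)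
     (Fwd r', layout a (xs @ ys'), a + int (length xs) + int (length ys), u @ u') \<and> length ys' = length ys"
proof (induction ys arbitrary: r r' ys' u' xs u)
  case (Cons y ys)
  obtain r1 y1 e where \<tau>: "\<tau> r y = (r1, y1, e)" by (metis prod_cases3)
  obtain r2 ys2 u2 where s: "sweep \<tau> r1 ys = (r2, ys2, u2)" by (metis prod_cases3)
  let ?u = "u @ (case e of None \<Rightarrow> [] | Some x \<Rightarrow> [x])"
  have eq: "r' = r2" "ys' = y1 # ys2" "u' = (case e of None \<Rightarrow> [] | Some x \<Rightarrow> [x]) @ u2"
    using Cons.prems \<tau> s by (auto split: option.splits)
  have "smove (Fwd r, layout a (xs @ y # ys), a + int (length xs), u)
     (Fwd r1, layout a (xs @ y1 # ys), a + int (length xs) + 1, ?u)"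
    using \<tau> by (auto simp: move_def tm_step_def sweep_delta_def layout_at layout_upd split: option.splits)
  also have "smove\<^sup>*\<^sup>* (Fwd r1, layout a (xs @ y1 # ys), a + int (length xs) + 1, ?u)
     (Fwd r2, layout a (xs @ y1 # ys2), a + int (length xs) + 1 + int (length ys), ?u @ u2)"
    using Cons.IH[OF s, of "xs @ [y1]" ?u] by (simp add: add_ac)
  finally (converse_rtranclp_into_rtranclp) show ?case using Cons.IH[OF s, of "xs @ [y1]" ?u] by (simp add: eq add_ac)
qed simp

lemma moves_back:
  "smove\<^sup>*\<^sup>* (Ret r p, layout a (xs @ ys), a + int (length xs) - 1, u) (Ret r p, layout a (xs @ ys), a - 1, u)"
proof (induction xs arbitrary: ys rule: rev_induct)
  case (snoc x xs)
  have "smove (Ret r p, layout a (xs @ x # ys), a + int (length xs), u)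
     (Ret r p, layout a (xs @ x # ys), a + int (length xs) - 1, u)"
    by (auto simp: move_def tm_step_def sweep_delta_def layout_at layout_upd)
  also note snoc[of "x # ys"]
  finally (converse_rtranclp_into_rtranclp) show ?case by simp
qed simp

lemma layout_note: "(layout a cs)(a + int (length cs) := Note r, a + int (length cs) := Gap) = layout a cs"
  by (auto simp: layout_def fun_eq_iff)

lemma moves_round:
  assumes F: "round_step \<tau> fin L (r, cs) = (r2, cs2)"
  shows "\<exists>a'. smove\<^sup>+\<^sup>+ (Fwd r, layout a cs, a, []) (if acc r2 then Halt else Fwd r2, layout a' cs2, a', [])"
proof -
  obtain r1 cs1 u where s: "sweep \<tau> r cs = (r1, cs1, u)" by (metis prod_cases3)
  obtain p where p: "fin r1 (u \<in> L) = (r2, p)" "cs2 = (case p of None \<Rightarrow> cs1 | Some c \<Rightarrow> c # cs1)"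
    using F s by (auto simp: round_step_def split: prod.splits)
  let ?h = "a + int (length cs1)"
  have len: "length cs1 = length cs" and
    1: "smove\<^sup>*\<^sup>* (Fwd r, layout a cs, a, []) (Fwd r1, layout a cs1, ?h, u)"
    using moves_forward[OF s, of a "[]" "[]"] by auto
  let ?t = "(layout a cs1)(?h := Note r1)"
  have 2: "smove (Fwd r1, layout a cs1, ?h, u) (Ask, ?t, ?h, u)"
    by (simp add: move_def tm_step_def sweep_delta_def layout_end)
  have 3: "smove (Ask, ?t, ?h, u) (if u \<in> L then Yes else No, ?t, ?h, [])"
    by (simp add: move_def tm_step_def)
  have 4: "smove (if u \<in> L then Yes else No, ?t, ?h, []) (Ret r2 p, layout a cs1, ?h - 1, [])"
    using p(1) layout_note[of a cs1 r1]
    by (auto simp: move_def tm_step_def sweep_delta_def simp del: fun_upd_upd)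
  have 5: "smove\<^sup>*\<^sup>* (Ret r2 p, layout a cs1, ?h - 1, []) (Ret r2 p, layout a cs1, a - 1, [])"
    using moves_back[of r2 p a cs1 "[]" "[]"] by simp
  let ?a = "case p of None \<Rightarrow> a | Some _ \<Rightarrow> a - 1"
  have 6: "smove (Ret r2 p, layout a cs1, a - 1, [])
      (if acc r2 then Halt else Fwd r2, layout ?a cs2, ?a, [])"
    using p(2)
    by (auto simp: move_def tm_step_def sweep_delta_def layout_end layout_push layout_gap Let_def split: option.splits)
  from 1 2 have "smove\<^sup>+\<^sup>+ (Fwd r, layout a cs, a, []) (Ask, ?t, ?h, u)"
    by (rule rtranclp_into_tranclp1)
  then have "smove\<^sup>+\<^sup>+ (Fwd r, layout a cs, a, []) (Ret r2 p, layout a cs1, ?h - 1, [])"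
    using 3 4 by (meson tranclp.trancl_into_trancl)
  then have "smove\<^sup>+\<^sup>+ (Fwd r, layout a cs, a, []) (Ret r2 p, layout a cs1, a - 1, [])"
    using 5 by (rule tranclp_rtranclp_tranclp)
  then show ?thesis using 6 by (meson tranclp.trancl_into_trancl)
qed

lemma sweeping_tm:
  fixes I :: "'i set" and B :: "'o set"
  assumes fin: "finite C" "finite R"
    and inp: "inp ` I \<subseteq> C" "inj_on inp I" and r0: "r0 \<in> R" "\<not> acc r0"
    and \<tau>: "\<And>r c r' c' e. r \<in> R \<Longrightarrow> c \<in> C \<Longrightarrow> \<tau> r c = (r', c', e) \<Longrightarrow>
       r' \<in> R \<and> c' \<in> C \<and> e \<in> insert None (Some ` B)"
    and fin': "\<And>r b r' p. r \<in> R \<Longrightarrow> fin r b = (r', p) \<Longrightarrow> r' \<in> R \<and> p \<in> insert None (Some ` C)"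
  shows "\<exists>M. is_oracle_tm I B M \<and> (\<forall>w\<in>lists I. otm_accepts L M w \<longleftrightarrow>
    accepts (round_step \<tau> fin L) (\<lambda>(r, _). acc r) (r0, map inp w))"
proof -
  let ?\<Gamma> = "Cell ` C \<union> Note ` R \<union> {Gap}"
  let ?Q = "Fwd ` R \<union> {Ask, Yes, No, Halt} \<union> (\<lambda>(r, p). Ret r p) ` (R \<times> insert None (Some ` C))"
  have "\<exists>M. is_oracle_tm I B M \<and> (\<forall>w\<in>lists I. otm_accepts L M w \<longleftrightarrow>
    accepts sstep (\<lambda>(q, _). q = Halt) (Fwd r0, tm_input Gap (Cell \<circ> inp) w, 0, []))"
  proof (rule oracle_tm_of_abstract[where \<Gamma>="?\<Gamma>" and Q="?Q" and acc="\<lambda>q. q = Halt"])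
    show "inj_on (Cell \<circ> inp) I" using inp by (auto simp: inj_on_def)
    fix x q x' q' m e
    assume x: "x \<in> ?\<Gamma>" and q: "q \<in> ?Q" and d: "sweep_delta \<tau> fin acc x q = (x', q', m, e)"
    show "x' \<in> ?\<Gamma> \<and> q' \<in> ?Q \<and> e \<in> insert None (Some ` B)"
    proof (cases q)
      case (Fwd r)
      then have r: "r \<in> R" using q by auto
      show ?thesis
      proof (cases x)
        case (Cell c)
        then have c: "c \<in> C" using x by auto
        obtain r1 c1 e1 where t: "\<tau> r c = (r1, c1, e1)" by (metis prod_cases3)
        show ?thesis using \<tau>[OF r c t] d t Fwd Cell by (auto simp: sweep_delta_def)
      qed (use d r Fwd in \<open>auto simp: sweep_delta_def\<close>)
    next
      case (Ret r p)
      then have "r \<in> R" "p \<in> insert None (Some ` C)" using q by auto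
      then show ?thesis using d x Ret
        by (auto simp: sweep_delta_def Let_def split: sweep_symbol.splits)
    next
      case Yes
      show ?thesis
      proof (cases x)
        case (Note r)
        then have r: "r \<in> R" using x by auto
        obtain r1 p1 where f: "fin r True = (r1, p1)" by fastforce
        show ?thesis using fin'[OF r f] d f Yes Note by (auto simp: sweep_delta_def)
      qed (use d x Yes in \<open>auto simp: sweep_delta_def\<close>)
    next
      case No
      show ?thesis
      proof (cases x)
        case (Note r)
        then have r: "r \<in> R" using x by auto
        obtain r1 p1 where f: "fin r False = (r1, p1)" by fastforce
        show ?thesis using fin'[OF r f] d f No Note by (auto simp: sweep_delta_def)
      qed (use d x No in \<open>auto simp: sweep_delta_def\<close>)
    qed (use d x q in \<open>auto simp: sweep_delta_def\<close>)
  qed (use fin inp r0 in auto)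
  moreover have "accepts sstep (\<lambda>(q, _). q = Halt) (Fwd r0, tm_input Gap (Cell \<circ> inp) w, 0, []) \<longleftrightarrow>
    accepts (round_step \<tau> fin L) (\<lambda>(r, _). acc r) (r0, map inp w)" for w
  proof (rule accepts_simulation[where R="\<lambda>c (r, cs). \<exists>a. c = (if acc r then Halt else Fwd r, layout a cs, a, [])"])
    have "tm_input Gap (Cell \<circ> inp) w = layout 0 (map inp w)"
      by (auto simp: tm_input_def layout_def fun_eq_iff)
    then show "case (r0, map inp w) of (r, cs) \<Rightarrow> \<exists>a. (Fwd r0, tm_input Gap (Cell \<circ> inp) w, 0, []) =
        (if acc r then Halt else Fwd r, layout a cs, a, [])"
      using r0 by auto
  next
    fix c :: "('r, 'c) sweep_state \<times> (int \<Rightarrow> ('c, 'r) sweep_symbol) \<times> int \<times> 'o list"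
      and b :: "'r \<times> 'c list"
    assume R: "case b of (r, cs) \<Rightarrow> \<exists>a. c = (if acc r then Halt else Fwd r, layout a cs, a, [])"
      and na: "\<not> (case b of (r, _) \<Rightarrow> acc r)"
    obtain r cs where b: "b = (r, cs)" by fastforce
    obtain r2 cs2 where F: "round_step \<tau> fin L (r, cs) = (r2, cs2)" by fastforce
    show "\<exists>c'. smove\<^sup>+\<^sup>+ c c' \<and> (case round_step \<tau> fin L b of (r, cs) \<Rightarrow> \<exists>a. c' = (if acc r then Halt else Fwd r, layout a cs, a, []))"
      using R na moves_round[OF F] by (auto simp: b F)
  next
    fix c :: "('r, 'c) sweep_state \<times> (int \<Rightarrow> ('c, 'r) sweep_symbol) \<times> int \<times> 'o list"
      and b :: "'r \<times> 'c list"
    assume "case b of (r, cs) \<Rightarrow> \<exists>a. c = (if acc r then Halt else Fwd r, layout a cs, a, [])"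
      and "case b of (r, _) \<Rightarrow> acc r"
    then show "accepts sstep (\<lambda>(q, _). q = Halt) c" by (auto intro!: accepts_now)
  qed
  ultimately show ?thesis by simp
qed

end

section \<open>Simulating a G-machine by a sweeping machine\<close>

text \<open>Cells of the simulating tape: input symbols, and trail entries that consist of a written symbol and
the inverse of the step made after it. The flag is the mark that selects the candidate to be tested.\<close>

datatype ('g, 'a) trail_cell = In "'g + 'a" bool | Tr "'a tape_symbol" 'g bool

text \<open>Where a symbol under the head comes from: it has been written by the simulated machine, or it
is given by the listing. Only two conflicting given letters are an error, as a write overrides all older
entries.\<close>

datatype 'a source = Written "'a tape_symbol" | Given 'a

datatype 'a stage = Before | Inside | Marking "'a source" | After "'a source"

datatype 'a lookup_reg = Check_Start | Check bool | Look nat "'a source option" "'a stage" | Dead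

text \<open>One round of a lookup tests the marked segment, that is, a trail entry or an entry
\<open>w a\<close> of the listing with its mark on the first cell. Up to the mark, the steps in the trail are emitted, and
then the word of the marked segment; the mark moves on to the next segment. The first round instead checks
that the input is a listing and puts the mark on its first cell.\<close>

fun lk_tr :: "'a lookup_reg \<Rightarrow> ('g, 'a) trail_cell \<Rightarrow> 'a lookup_reg \<times> ('g, 'a) trail_cell \<times> 'g option" where
  "lk_tr Check_Start (In x m) = (Check (\<not> isl x), In x True, None)"
| "lk_tr (Check _) (In x m) = (Check (\<not> isl x), In x m, None)"
| "lk_tr (Look q f Before) (Tr b t m) = (Look q f (if m then Marking (Written b) else Before), Tr b t False, Some t)"
| "lk_tr (Look q f Before) (In (Inl s) m) =
     (if m then (Look q f Inside, In (Inl s) False, Some s) else (Look q f Before, In (Inl s) False, None))"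
| "lk_tr (Look q f Before) (In (Inr a) m) = (Look q f (if m then Marking (Given a) else Before), In (Inr a) False, None)"
| "lk_tr (Look q f Inside) (In (Inl s) m) = (Look q f Inside, In (Inl s) m, Some s)"
| "lk_tr (Look q f Inside) (In (Inr a) m) = (Look q f (Marking (Given a)), In (Inr a) m, None)"
| "lk_tr (Look q f (Marking c)) (In x m) = (Look q f (After c), In x True, None)"
| "lk_tr (Look q f (Marking c)) (Tr b t m) = (Look q f (After c), Tr b t True, None)"
| "lk_tr r x = (r, x, None)"

fun judge :: "'a source option \<Rightarrow> 'a source \<Rightarrow> bool \<Rightarrow> 'a source option option" where
  "judge f c False = Some f"
| "judge None c True = Some (Some c)"
| "judge (Some (Written b)) c True = Some (Some (Written b))"
| "judge (Some (Given a)) c True = (if c = Given a then Some (Some (Given a)) else None)"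

fun found_symbol :: "'a source option \<Rightarrow> 'a tape_symbol" where
  "found_symbol None = Blank"
| "found_symbol (Some (Written b)) = b"
| "found_symbol (Some (Given a)) = Letter a"

fun trail_segment :: "bool \<Rightarrow> ('a tape_symbol \<times> 'g) + ('g list \<times> 'a) \<Rightarrow> ('g, 'a) trail_cell list" where
  "trail_segment m (Inl (b, t)) = [Tr b t m]"
| "trail_segment m (Inr ([], a)) = [In (Inr a) m]"
| "trail_segment m (Inr (s # w, a)) = In (Inl s) m # map (\<lambda>s. In (Inl s) False) w @ [In (Inr a) False]"

fun seg_source :: "('a tape_symbol \<times> 'g) + ('g list \<times> 'a) \<Rightarrow> 'a source" where
  "seg_source (Inl (b, t)) = Written b"
| "seg_source (Inr (w, a)) = Given a"

fun seg_word :: "('a tape_symbol \<times> 'g) + ('g list \<times> 'a) \<Rightarrow> 'g list" where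
  "seg_word (Inl (b, t)) = [t]"
| "seg_word (Inr (w, a)) = w"

fun seg_prefix :: "('a tape_symbol \<times> 'g) + ('g list \<times> 'a) \<Rightarrow> 'g list" where
  "seg_prefix (Inl (b, t)) = [t]"
| "seg_prefix (Inr (w, a)) = []"

abbreviation "plain ds \<equiv> concat (map (trail_segment False) ds)"
abbreviation "prefix_word ds \<equiv> concat (map seg_prefix ds)"

fun marked :: "(('a tape_symbol \<times> 'g) + ('g list \<times> 'a)) list \<Rightarrow> ('g, 'a) trail_cell list" where
  "marked [] = []"
| "marked (c # rs) = trail_segment True c @ plain rs"

lemma sweep_plain_segment:
  "sweep lk_tr (Look q f Before) (trail_segment False d @ cs) =
    (case sweep lk_tr (Look q f Before) cs of (r, cs', u) \<Rightarrow> (r, trail_segment False d @ cs', seg_prefix d @ u))"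
proof -
  have 1: "sweep lk_tr (Look q f Before) (map (\<lambda>s. In (Inl s) False) w @ In (Inr a) False # cs) =
    (case sweep lk_tr (Look q f Before) cs of (r, cs', u) \<Rightarrow> (r, map (\<lambda>s. In (Inl s) False) w @ In (Inr a) False # cs', u))" for w a
    by (induction w) (auto split: prod.splits)
  show ?thesis
  proof (cases d)
    case (Inr x)
    obtain w a where x: "x = (w, a)" by fastforce
    show ?thesis using 1[of w a] Inr x by (cases w) (auto split: prod.splits)
  qed (auto split: prod.splits)
qed

lemma sweep_plain:
  "sweep lk_tr (Look q f Before) (plain ds @ cs) =
    (case sweep lk_tr (Look q f Before) cs of (r, cs', u) \<Rightarrow> (r, plain ds @ cs', prefix_word ds @ u))"
proof (induction ds)
  case (Cons d ds)
  then show ?case by (auto simp: sweep_plain_segment split: prod.splits)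
qed (auto split: prod.splits)

lemma sweep_marked_segment:
  "sweep lk_tr (Look q f Before) (trail_segment True c @ cs) =
    (case sweep lk_tr (Look q f (Marking (seg_source c))) cs of (r, cs', u) \<Rightarrow>
      (r, trail_segment False c @ cs', seg_word c @ u))"
proof -
  have 1: "sweep lk_tr (Look q f Inside) (map (\<lambda>s. In (Inl s) False) w @ In (Inr a) False # cs) =
    (case sweep lk_tr (Look q f (Marking (Given a))) cs of (r, cs', u) \<Rightarrow>
      (r, map (\<lambda>s. In (Inl s) False) w @ In (Inr a) False # cs', w @ u))" for w a
    by (induction w) (auto split: prod.splits)
  show ?thesis
  proof (cases c)
    case (Inr x)
    obtain w a where x: "x = (w, a)" by fastforce
    show ?thesis
    proof (cases w)
      case (Cons s w')
      then show ?thesis using 1[of w' a] Inr x by (auto split: prod.splits)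
    qed (use Inr x in \<open>auto split: prod.splits\<close>)
  qed (auto split: prod.splits)
qed

lemma sweep_after: "sweep lk_tr (Look q f (After c)) cs = (Look q f (After c), cs, [])"
proof (induction cs)
  case (Cons x cs) then show ?case by (cases x) auto
qed simp

lemma sweep_marking:
  "sweep lk_tr (Look q f (Marking c)) (plain rs) =
    (if rs = [] then Look q f (Marking c) else Look q f (After c), marked rs, [])"
proof (cases rs)
  case (Cons d ds)
  then show ?thesis
    by (cases "(True, d)" rule: trail_segment.cases) (auto simp: sweep_after)
qed simp

lemma sweep_lookup:
  "sweep lk_tr (Look q f Before) (plain ds @ marked (c # rs)) =
    (Look q f (if rs = [] then Marking (seg_source c) else After (seg_source c)),
     plain (ds @ [c]) @ marked rs, prefix_word ds @ seg_word c)"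
  by (simp add: sweep_plain sweep_marked_segment sweep_marking)

lemma plain_encode:
  fixes l :: "('g list \<times> 'a) list"
  shows "plain (map Inr l) = map (\<lambda>x. In x False) (encode_listing l)"
proof -
  have "trail_segment False (Inr (w, a)) = map (\<lambda>x. In x False) (map Inl w @ [Inr a])" for w :: "'g list" and a :: 'a
    by (cases w) auto
  then show ?thesis unfolding encode_listing_def
    by (induction l) (auto simp del: trail_segment.simps)
qed

lemma sweep_check:
  "sweep lk_tr (Check b) (map (\<lambda>x. In x False) z) =
    (Check (if z = [] then b else \<not> isl (last z)), map (\<lambda>x. In x False) z, [])"
  by (induction z arbitrary: b) auto

lemma sweep_check_start:
  "sweep lk_tr Check_Start (map (\<lambda>x. In x False) z) =
    (case z of [] \<Rightarrow> (Check_Start, [], [])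
     | x # z' \<Rightarrow> (Check (\<not> isl (last z)), In x True # map (\<lambda>x. In x False) z', []))"
  by (cases z) (auto simp: sweep_check)

lemma marked_encode:
  fixes l :: "('g list \<times> 'a) list"
  shows "marked (map Inr l) = (case encode_listing l of [] \<Rightarrow> [] | x # z \<Rightarrow> In x True # map (\<lambda>x. In x False) z)"
proof (cases l)
  case (Cons wa l')
  then show ?thesis
    using plain_encode[of l'] by (cases "(True, Inr wa :: ('a tape_symbol \<times> 'g) + _)" rule: trail_segment.cases) (auto simp: encode_listing_def)
qed (simp add: encode_listing_def)

lemma encode_listing_iff:
  "(\<exists>l. z = encode_listing l) \<longleftrightarrow> z = [] \<or> \<not> isl (last z)"
proof
  assume "\<exists>l. z = encode_listing l"
  then obtain l where z: "z = encode_listing l" by blast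
  then show "z = [] \<or> \<not> isl (last z)"
    by (cases l rule: rev_cases) (auto simp: encode_listing_def)
next
  have split: "\<exists>l w. y = encode_listing l @ map Inl w" for y :: "('a + 'b) list"
  proof (induction y rule: rev_induct)
    case Nil then show ?case by (intro exI[of _ "[]"]) (simp add: encode_listing_def)
  next
    case (snoc x y)
    then obtain l w where y: "y = encode_listing l @ map Inl w" by blast
    show ?case
    proof (cases x)
      case (Inl s)
      then show ?thesis using y by (intro exI[of _ l] exI[of _ "w @ [s]"]) simp
    next
      case (Inr a)
      then show ?thesis using y
        by (intro exI[of _ "l @ [(w, a)]"] exI[of _ "[]"]) (simp add: encode_listing_def)
    qed
  qed
  assume "z = [] \<or> \<not> isl (last z)"
  moreover obtain l w where "z = encode_listing l @ map Inl w" using split by blast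
  ultimately show "\<exists>l. z = encode_listing l" by (cases w rule: rev_cases) auto
qed

lemma set_encode_listing:
  "set (encode_listing l) \<subseteq> P <+> Q \<longleftrightarrow> set l \<subseteq> lists P \<times> Q"
proof (induction l)
  case (Cons x l)
  then show ?case by (cases x) (auto simp: encode_listing_def Plus_def lists_eq_set image_subset_iff)
qed (simp add: encode_listing_def)

text \<open>The tape content that a set of codings prescribes at a position, undefined if it prescribes two
different letters. It depends on the set only, not on the order in which it is listed.\<close>

definition letter_at :: "('g, 'm) monoid_scheme \<Rightarrow> ('g list \<times> 'a) set \<Rightarrow> 'g \<Rightarrow> 'a tape_symbol option" where
  "letter_at G c g = (let B = {a. \<exists>w. (w, a) \<in> c \<and> word_value G w = g}
     in if B = {} then Some Blank else if \<exists>a. B = {a} then Some (Letter (the_elem B)) else None)"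

text \<open>The simulated \<open>G\<close>-machine on a partially defined tape; it is stuck forever once it reads an
undefined symbol.\<close>

fun partial_step :: "('g, 'm) monoid_scheme \<Rightarrow> ('g, 'a tape_symbol) G_machine \<Rightarrow>
    (('g \<Rightarrow> 'a tape_symbol option) \<times> 'g \<times> nat) option \<Rightarrow> (('g \<Rightarrow> 'a tape_symbol option) \<times> 'g \<times> nat) option" where
  "partial_step G N None = None"
| "partial_step G N (Some (y, h, q)) = (case y h of None \<Rightarrow> None | Some \<sigma> \<Rightarrow>
     (case gm_delta N (\<sigma>, q) of (b, q', s) \<Rightarrow> Some (y(h := Some b), h \<otimes>\<^bsub>G\<^esub> s, q')))"

definition partial_acc :: "('g, 's) G_machine \<Rightarrow> ('y \<times> 'g \<times> nat) option \<Rightarrow> bool" where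
  "partial_acc N c \<longleftrightarrow> (case c of None \<Rightarrow> False | Some (_, _, q) \<Rightarrow> q \<in> gm_accepting N)"

definition accepted_coding :: "('g, 'm) monoid_scheme \<Rightarrow> ('g, 'a tape_symbol) G_machine \<Rightarrow> ('g list \<times> 'a) set \<Rightarrow> bool" where
  "accepted_coding G N c \<longleftrightarrow>
     accepts (partial_step G N) (partial_acc N) (Some (letter_at G c, \<one>\<^bsub>G\<^esub>, gm_init N))"

context fg_group
begin

context
  fixes N :: "('g, 'a tape_symbol) G_machine"
begin

definition finish :: "nat \<Rightarrow> 'a source option option \<Rightarrow> 'a lookup_reg \<times> ('g, 'a) trail_cell option" where
  "finish q f = (case f of None \<Rightarrow> (Dead, None) | Some f' \<Rightarrow>
     (case gm_delta N (found_symbol f', q) of (b, q', s) \<Rightarrow> (Look q' None Before, Some (Tr b (inv s) True))))"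

fun lk_fin :: "'a lookup_reg \<Rightarrow> bool \<Rightarrow> 'a lookup_reg \<times> ('g, 'a) trail_cell option" where
  "lk_fin Check_Start b = (Look (gm_init N) None Before, None)"
| "lk_fin (Check v) b = (if v then Look (gm_init N) None Before else Dead, None)"
| "lk_fin (Look q f Before) b = finish q (Some f)"
| "lk_fin (Look q f Inside) b = (Dead, None)"
| "lk_fin (Look q f (Marking c)) b = finish q (judge f c b)"
| "lk_fin (Look q f (After c)) b = (case judge f c b of None \<Rightarrow> Dead | Some f' \<Rightarrow> Look q f' Before, None)"
| "lk_fin Dead b = (Dead, None)"

fun lk_acc :: "'a lookup_reg \<Rightarrow> bool" where
  "lk_acc (Look q f st) \<longleftrightarrow> q \<in> gm_accepting N"
| "lk_acc _ \<longleftrightarrow> False"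

abbreviation "lk_round \<equiv> round_step lk_tr lk_fin (word_problem G S)"
abbreviation "lk_move \<equiv> move lk_round (\<lambda>(r, _). lk_acc r)"

definition hit where "hit ds c \<longleftrightarrow> prefix_word ds @ seg_word c \<in> word_problem G S"

text \<open>The outcome of the rounds of one lookup, for the segments \<open>rs\<close> still to be tested.\<close>

fun search where
  "search f ds [] = Some f"
| "search f ds (c # rs) = (case judge f (seg_source c) (hit ds c) of None \<Rightarrow> None | Some f' \<Rightarrow> search f' (ds @ [c]) rs)"

text \<open>A lookup of the symbol under the head takes one round per segment. Its last round also performs the
simulated step, by pushing a new trail entry that carries the mark for the next lookup.\<close>

lemma moves_lookup:
  assumes "q \<notin> gm_accepting N"
  shows "\<exists>cs. lk_move\<^sup>+\<^sup>+ (Look q f Before, plain ds @ marked rs)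
    (fst (finish q (search f ds rs)), cs) \<and>
    (search f ds rs \<noteq> None \<longrightarrow> cs = the (snd (finish q (search f ds rs))) # plain (ds @ rs))"
proof (induction rs arbitrary: f ds)
  case Nil
  have "sweep lk_tr (Look q f Before) (plain ds) = (Look q f Before, plain ds, prefix_word ds)"
    using sweep_plain[of q f ds "[]"] by simp
  then have "lk_move (Look q f Before, plain ds)
     (fst (finish q (Some f)), the (snd (finish q (Some f))) # plain ds)"
    using assms by (auto simp: move_def round_step_def finish_def split: prod.splits)
  then show ?case by auto
next
  case (Cons c rs)
  let ?j = "judge f (seg_source c) (hit ds c)"
  show ?case
  proof (cases "rs = []")
    case True
    have s: "search f ds (c # rs) = ?j" by (simp add: True split: option.splits)
    have "lk_move (Look q f Before, plain ds @ marked (c # rs))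
     (fst (finish q ?j), (case snd (finish q ?j) of None \<Rightarrow> [] | Some x \<Rightarrow> [x]) @ plain (ds @ [c]))"
      using assms sweep_lookup[of q f ds c rs] True
      by (auto simp: move_def round_step_def hit_def split: prod.splits option.splits)
    then show ?thesis unfolding s using True
      by (intro exI conjI) (erule tranclp.r_into_trancl, auto simp: finish_def split: prod.splits)
  next
    case False
    have 1: "lk_move (Look q f Before, plain ds @ marked (c # rs))
     (case ?j of None \<Rightarrow> Dead | Some f' \<Rightarrow> Look q f' Before, plain (ds @ [c]) @ marked rs)"
      using assms sweep_lookup[of q f ds c rs] False
      by (auto simp: move_def round_step_def hit_def split: prod.splits option.splits)
    show ?thesis
    proof (cases ?j)
      case None
      then have "search f ds (c # rs) = None" by simp
      then show ?thesis using 1 None by (auto simp: finish_def)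
    next
      case (Some f')
      then have s: "search f ds (c # rs) = search f' (ds @ [c]) rs" by simp
      show ?thesis unfolding s using Cons.IH[of f' "ds @ [c]"] 1 Some
        by (auto intro: tranclp_into_tranclp2)
    qed
  qed
qed

end
end

section \<open>Acceptance of a pattern coding\<close>

lemma sweep_dead: "fst (sweep lk_tr Dead cs) = Dead"
proof (induction cs)
  case (Cons x cs) then show ?case by (auto split: prod.splits)
qed simp

context fg_group
begin

text \<open>The tape after the writes recorded in a trail. An entry was written at the position determined by
the steps of the older entries, since its own step was made after the write.\<close>

fun written :: "('g \<Rightarrow> 'a tape_symbol option) \<Rightarrow> ('a tape_symbol \<times> 'g) list \<Rightarrow> 'g \<Rightarrow> 'a tape_symbol option" where
  "written base [] = base"
| "written base ((b, t) # tr) = (written base tr)(inv (val (map snd tr)) := Some b)"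

lemma prefix_word_trail: "prefix_word (map Inl tr @ map Inr l) = map snd tr"
proof -
  have "prefix_word (map Inl tr) = map snd tr" by (induction tr) auto
  moreover have "prefix_word (map Inr l) = []" by (induction l) auto
  ultimately show ?thesis by (simp del: map_map)
qed

lemma search_written: "search (Some (Written b)) ds rs = Some (Some (Written b))"
proof (induction rs arbitrary: ds)
  case (Cons c rs)
  then show ?case by (cases "hit ds c") auto
qed simp

lemma hit_given:
  assumes "snd ` set tr \<subseteq> S" and "w \<in> lists S"
  shows "hit (map Inl tr @ map Inr l) (Inr (w, a)) \<longleftrightarrow> val w = inv (val (map snd tr))"
proof -
  have tr: "map snd tr \<in> lists S" using assms(1) by auto
  have "hit (map Inl tr @ map Inr l) (Inr (w, a)) \<longleftrightarrow> val (map snd tr) \<otimes> val w = \<one>"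
    using tr assms(2) unfolding hit_def prefix_word_trail by (simp add: word_problem_iff val_append)
  also have "\<dots> \<longleftrightarrow> val w = inv (val (map snd tr))"
    using tr assms(2) by (metis inv_equality inv_inv l_inv r_inv val_closed inv_closed)
  finally show ?thesis .
qed

text \<open>With the newest entries first, the emitted prefix spells the inverse of the steps made since the entry
was written. It is trivial if and only if the head is back at the same position.\<close>

lemma hit_written:
  assumes "snd ` set (tr1 @ (b, t) # tr2) \<subseteq> S"
  shows "hit (map Inl tr1) (Inl (b, t)) \<longleftrightarrow>
     inv (val (map snd (tr1 @ (b, t) # tr2))) = inv (val (map snd tr2))"
proof -
  have w: "map snd tr1 @ [t] \<in> lists S" "map snd tr2 \<in> lists S"
    using assms unfolding image_subset_iff by (auto dest: bspec)
  have v: "val (map snd (tr1 @ (b, t) # tr2)) = val (map snd tr1 @ [t]) \<otimes> val (map snd tr2)"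
    using val_append[OF w] by simp
  have "hit (map Inl tr1) (Inl (b, t)) \<longleftrightarrow> val (map snd tr1 @ [t]) = \<one>"
    using w prefix_word_trail[of tr1 "[]"] by (auto simp: hit_def word_problem_iff)
  moreover have "inv (x \<otimes> y) = inv y \<longleftrightarrow> x = \<one>" if "x \<in> carrier G" "y \<in> carrier G" for x y
    using that inj_on_eq_iff[OF inv_inj, of "x \<otimes> y" y] by simp
  ultimately show ?thesis unfolding v using w by simp
qed

lemma search_given:
  assumes "snd ` set tr \<subseteq> S" and "fst ` set l2 \<subseteq> lists S"
  shows "search (Some (Given a)) (map Inl tr @ map Inr l1) (map Inr l2) =
    (if \<forall>(w, a')\<in>set l2. val w = inv (val (map snd tr)) \<longrightarrow> a' = a then Some (Some (Given a)) else None)"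
  using assms(2)
proof (induction l2 arbitrary: l1)
  case (Cons wa l2)
  obtain w a' where wa: "wa = (w, a')" by fastforce
  have ww: "w \<in> lists S" using Cons.prems wa by simp
  have h: "hit (map Inl tr @ map Inr l1) (Inr (w, a')) \<longleftrightarrow> val w = inv (val (map snd tr))"
    using hit_given[OF assms(1) ww, of l1 a'] .
  have IH: "search (Some (Given a)) (map Inl tr @ map Inr l1 @ [Inr (w, a')]) (map Inr l2) =
    (if \<forall>(w, a')\<in>set l2. val w = inv (val (map snd tr)) \<longrightarrow> a' = a then Some (Some (Given a)) else None)"
    using Cons.IH[of "l1 @ [(w, a')]"] Cons.prems by simp
  have "search (Some (Given a)) (map Inl tr @ map Inr l1) (map Inr (wa # l2)) =
    (if val w = inv (val (map snd tr)) \<and> a' \<noteq> a then None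
     else search (Some (Given a)) (map Inl tr @ map Inr l1 @ [Inr (w, a')]) (map Inr l2))"
    using h by (cases "val w = inv (val (map snd tr))") (simp_all add: wa)
  then show ?case unfolding IH by (auto simp: wa)
qed simp

text \<open>The first listed letter that is found under the head is compared with all later ones, so the
search succeeds if and only if the listed letters at this position agree.\<close>

lemma search_letter:
  assumes "snd ` set tr \<subseteq> S" and "fst ` set l2 \<subseteq> lists S"
  shows "map_option found_symbol (search None (map Inl tr @ map Inr l1) (map Inr l2)) =
    letter_at G (set l2) (inv (val (map snd tr)))"
  using assms(2)
proof (induction l2 arbitrary: l1)
  case Nil then show ?case by (simp add: letter_at_def)
next
  case (Cons wa l2)
  obtain w a where wa: "wa = (w, a)" by fastforce
  let ?h = "inv (val (map snd tr))"
  have ww: "w \<in> lists S" using Cons.prems wa by simp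
  have h: "hit (map Inl tr @ map Inr l1) (Inr (w, a)) \<longleftrightarrow> val w = ?h"
    using hit_given[OF assms(1) ww, of l1 a] .
  let ?B = "{a. \<exists>w. (w, a) \<in> set l2 \<and> val w = ?h}"
  show ?case
  proof (cases "val w = ?h")
    case False
    then have "{a'. \<exists>w'. (w', a') \<in> set (wa # l2) \<and> val w' = ?h} = ?B" using wa by auto
    then have "letter_at G (set (wa # l2)) ?h = letter_at G (set l2) ?h"
      unfolding letter_at_def by (rule arg_cong)
    then show ?thesis using False h Cons.IH[of "l1 @ [(w, a)]"] Cons.prems by (simp add: wa)
  next
    case True
    have B: "{a'. \<exists>w'. (w', a') \<in> set (wa # l2) \<and> val w' = ?h} = insert a ?B"
      using True wa by auto
    then have l: "letter_at G (set (wa # l2)) ?h = (if ?B \<subseteq> {a} then Some (Letter a) else None)"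
    proof (cases "?B \<subseteq> {a}")
      case True
      then have "insert a ?B = {a}" by auto
      with B have "{a'. \<exists>w'. (w', a') \<in> set (wa # l2) \<and> val w' = ?h} = {a}" by (rule trans)
      then show ?thesis using True unfolding letter_at_def Let_def by simp
    next
      case False
      then have "\<nexists>b. insert a ?B = {b}" by auto
      then show ?thesis using False unfolding letter_at_def Let_def B by simp
    qed
    have 1: "search None (map Inl tr @ map Inr l1) (map Inr (wa # l2)) =
       search (Some (Given a)) (map Inl tr @ map Inr (l1 @ [(w, a)])) (map Inr l2)"
      using True h by (simp add: wa)
    have "fst ` set l2 \<subseteq> lists S" using Cons.prems by simp
    from search_given[OF assms(1) this, of a "l1 @ [(w, a)]"] show ?thesis
      unfolding 1 l by (auto simp del: map_append)
  qed
qed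

lemma search_trail:
  assumes "snd ` set (tr1 @ tr2) \<subseteq> S" and "fst ` set l \<subseteq> lists S"
  shows "map_option found_symbol (search None (map Inl tr1) (map Inl tr2 @ map Inr l)) =
    written (letter_at G (set l)) tr2 (inv (val (map snd (tr1 @ tr2))))"
  using assms(1)
proof (induction tr2 arbitrary: tr1)
  case Nil
  then show ?case using search_letter[of tr1 l "[]"] assms(2) by simp
next
  case (Cons bt tr2)
  obtain b t where bt: "bt = (b, t)" by fastforce
  note h = hit_written[OF Cons.prems[unfolded bt]]
  show ?case
  proof (cases "hit (map Inl tr1) (Inl (b, t))")
    case True
    then show ?thesis using h by (simp add: bt search_written)
  next
    case False
    then show ?thesis using h Cons.IH[of "tr1 @ [(b, t)]"] Cons.prems by (simp add: bt)
  qed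
qed

lemma written_symbol:
  assumes "written base tr g = Some \<sigma>" "fst ` set tr \<subseteq> \<Sigma>" "\<And>g \<sigma>. base g = Some \<sigma> \<Longrightarrow> \<sigma> \<in> \<Sigma>"
  shows "\<sigma> \<in> \<Sigma>"
  using assms(1,2)
proof (induction tr)
  case (Cons bt tr) then show ?case by (cases bt) (auto split: if_splits)
qed (use assms(3) in auto)

lemma letter_at_symbol:
  assumes "letter_at G c g = Some \<sigma>" "snd ` c \<subseteq> A" shows "\<sigma> \<in> insert Blank (Letter ` A)"
proof -
  let ?B = "{a. \<exists>w. (w, a) \<in> c \<and> val w = g}"
  have "?B \<subseteq> A" using assms(2) by force
  then show ?thesis using assms(1) unfolding letter_at_def Let_def
    by (auto split: if_splits)
qed

context
  fixes N :: "('g, 'a tape_symbol) G_machine" and A :: "'a set"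
  assumes N: "is_G_machine S N" "Letter ` A \<subseteq> gm_symbols N" "gm_blank N = Blank"
begin

lemma delta_closed:
  assumes "gm_delta N (\<sigma>, q) = (b, q', s)" "\<sigma> \<in> gm_symbols N" "q \<in> gm_states N"
  shows "b \<in> gm_symbols N" "q' \<in> gm_states N" "s \<in> S"
proof -
  have "gm_delta N \<in> gm_symbols N \<times> gm_states N \<rightarrow> gm_symbols N \<times> gm_states N \<times> S"
    using N(1) by (simp add: is_G_machine_def)
  from funcset_mem[OF this, of "(\<sigma>, q)"] have "(b, q', s) \<in> gm_symbols N \<times> gm_states N \<times> S"
    using assms by simp
  then show "b \<in> gm_symbols N" "q' \<in> gm_states N" "s \<in> S" by simp_all
qed

lemma blank_symbol: "Blank \<in> gm_symbols N"
  using N by (auto simp: is_G_machine_def)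

text \<open>The invariant relates a trail to the tape \<open>written\<close> by it and to the head position, which is the
inverse of the product of the stored steps.\<close>

lemma accepts_lookup_rounds:
  assumes l: "set l \<subseteq> lists S \<times> A"
  shows "accepts (lk_round N) (\<lambda>(r, _). lk_acc N r) (Look (gm_init N) None Before, marked (map Inr l)) \<longleftrightarrow>
    accepted_coding G N (set l)"
  unfolding accepted_coding_def
proof (rule accepts_simulation[where R = "\<lambda>(r, cs) a. case a of None \<Rightarrow> r = Dead | Some (y, h, q) \<Rightarrow>
    \<exists>tr. y = written (letter_at G (set l)) tr \<and> h = inv (val (map snd tr)) \<and> snd ` set tr \<subseteq> S \<and>
      fst ` set tr \<subseteq> gm_symbols N \<and> q \<in> gm_states N \<and>
      r = Look q None Before \<and> cs = marked (map Inl tr @ map Inr l)"], goal_cases)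
  case 1
  then show ?case using N by (auto intro!: exI[of _ "[]"] simp: is_G_machine_def)
next
  case (2 c a)
  obtain r cs where c: "c = (r, cs)" by fastforce
  show ?case
  proof (cases a)
    case None
    then have r: "r = Dead" using 2 c by simp
    obtain cs' u where "sweep lk_tr Dead cs = (Dead, cs', u)"
      using sweep_dead[of cs] by (metis prod.collapse)
    then have "lk_move N (Dead, cs) (Dead, cs')"
      by (auto simp: move_def round_step_def)
    then have "(lk_move N)\<^sup>+\<^sup>+ c (Dead, cs')" unfolding c r by (rule tranclp.r_into_trancl)
    then show ?thesis using None by (intro exI[of _ "(Dead, cs')"]) simp
  next
    case (Some z)
    obtain y h q where z: "z = (y, h, q)" by (metis prod_cases3)
    obtain tr where tr: "y = written (letter_at G (set l)) tr" "h = inv (val (map snd tr))" "snd ` set tr \<subseteq> S"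
      "fst ` set tr \<subseteq> gm_symbols N" "q \<in> gm_states N" "r = Look q None Before" "cs = marked (map Inl tr @ map Inr l)"
      using 2(1) Some z c by auto
    have q: "q \<notin> gm_accepting N" using 2(2) Some z by (simp add: partial_acc_def)
    let ?segs = "map Inl tr @ map Inr l"
    let ?f = "search None [] ?segs"
    have f: "map_option found_symbol ?f = y h"
    proof -
      have "fst ` set l \<subseteq> lists S" using l by auto
      then show ?thesis using search_trail[of "[]" tr l] tr by simp
    qed
    obtain cs' where cs': "(lk_move N)\<^sup>+\<^sup>+ (r, cs) (fst (finish N q ?f), cs')"
        "?f \<noteq> None \<longrightarrow> cs' = the (snd (finish N q ?f)) # plain ?segs"
      using moves_lookup[OF q, of None "[]" ?segs] tr by auto
    show ?thesis
    proof (cases ?f)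
      case None
      then have "y h = None" using f by simp
      then show ?thesis using cs'(1) None Some z c by (auto simp: finish_def)
    next
      case (Some f')
      then have yh: "y h = Some (found_symbol f')" using f by simp
      have "found_symbol f' \<in> gm_symbols N"
      proof (rule written_symbol[OF yh[unfolded tr(1)] tr(4)])
        fix g \<sigma> assume "letter_at G (set l) g = Some \<sigma>"
        then have "\<sigma> \<in> insert Blank (Letter ` A)" by (rule letter_at_symbol) (use l in force)
        then show "\<sigma> \<in> gm_symbols N" using N blank_symbol by auto
      qed
      moreover obtain b q' s where d: "gm_delta N (found_symbol f', q) = (b, q', s)" by (metis prod_cases3)
      ultimately have bqs: "b \<in> gm_symbols N" "q' \<in> gm_states N" "s \<in> S" using delta_closed tr(5) by blast+
      have fin: "finish N q ?f = (Look q' None Before, Some (Tr b (inv s) True))"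
        using d Some by (simp add: finish_def)
      have v: "map snd tr \<in> lists S" using tr(3) by auto
      have "inv (val (map snd ((b, inv s) # tr))) = h \<otimes> s"
        using bqs S_inv v tr(2) by (simp add: inv_mult_group)
      then have "partial_step G N a = Some (written (letter_at G (set l)) ((b, inv s) # tr),
          inv (val (map snd ((b, inv s) # tr))), q')"
        using yh d tr(1,2) \<open>a = Some z\<close> z by simp
      moreover have "cs' = marked (map Inl ((b, inv s) # tr) @ map Inr l)" using cs'(2) Some fin by simp
      ultimately show ?thesis using cs'(1) c bqs tr S_inv unfolding fin
        by (intro exI[of _ "(Look q' None Before, cs')"])
          (simp del: written.simps, intro exI[of _ "(b, inv s) # tr"], simp)
    qed
  qed
next
  case (3 c a)
  then show ?case by (auto simp: partial_acc_def split: option.splits intro!: accepts_now)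
qed

lemma re_accepted_codings:
  assumes A: "finite A"
  shows "oracle_re_codings G S A {c \<in> pattern_codings S A. accepted_coding G N c}"
proof -
  let ?\<Sigma> = "gm_symbols N"
  define W where "W = Written ` ?\<Sigma> \<union> Given ` A"
  define T where "T = {Before, Inside} \<union> Marking ` W \<union> After ` W"
  define C where "C = {c. case c of In x m \<Rightarrow> x \<in> S <+> A | Tr b t m \<Rightarrow> b \<in> ?\<Sigma> \<and> t \<in> S}"
  define R where "R = {r. case r of
    Look q f st \<Rightarrow> q \<in> gm_states N \<and> f \<in> insert None (Some ` W) \<and> st \<in> T | _ \<Rightarrow> True}"
  have fin: "finite ?\<Sigma>" "finite (gm_states N)" "gm_init N \<in> gm_states N"
    using N by (auto simp: is_G_machine_def)
  have finW: "finite W" "finite T" using fin A by (auto simp: W_def T_def)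
  have WC: "Written b \<in> W \<longleftrightarrow> b \<in> ?\<Sigma>" "Given a \<in> W \<longleftrightarrow> a \<in> A" for a b by (auto simp: W_def)
  have TC: "Before \<in> T" "Inside \<in> T" "Marking c \<in> T \<longleftrightarrow> c \<in> W" "After c \<in> T \<longleftrightarrow> c \<in> W" for c
    by (auto simp: T_def)
  have "C \<subseteq> (\<lambda>(x, m). In x m) ` ((S <+> A) \<times> UNIV) \<union> (\<lambda>(b, t, m). Tr b t m) ` (?\<Sigma> \<times> S \<times> UNIV)"
  proof
    fix c assume "c \<in> C"
    then show "c \<in> (\<lambda>(x, m). In x m) ` ((S <+> A) \<times> UNIV) \<union> (\<lambda>(b, t, m). Tr b t m) ` (?\<Sigma> \<times> S \<times> UNIV)"
      by (cases c) (force simp: C_def)+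
  qed
  then have finC: "finite C" by (rule finite_subset) (use fin finite_S A in auto)
  have "R \<subseteq> {Check_Start, Dead} \<union> range Check \<union>
    (\<lambda>(q, f, st). Look q f st) ` (gm_states N \<times> insert None (Some ` W) \<times> T)"
  proof
    fix r assume "r \<in> R"
    then show "r \<in> {Check_Start, Dead} \<union> range Check \<union>
      (\<lambda>(q, f, st). Look q f st) ` (gm_states N \<times> insert None (Some ` W) \<times> T)"
      by (cases r) (force simp: R_def)+
  qed
  then have finR: "finite R" by (rule finite_subset) (use fin finW in auto)
  have found: "found_symbol f \<in> ?\<Sigma>" if "f \<in> insert None (Some ` W)" for f
    using that N blank_symbol by (auto simp: W_def)
  have finish_closed: "fst (finish N q f) \<in> R \<and> snd (finish N q f) \<in> insert None (Some ` C)"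
    if q: "q \<in> gm_states N" and f: "f \<in> insert None (Some ` insert None (Some ` W))" for q f
  proof (cases f)
    case (Some f')
    then have f': "f' \<in> insert None (Some ` W)" using f by auto
    obtain b q' s where d: "gm_delta N (found_symbol f', q) = (b, q', s)" by (metis prod_cases3)
    note bqs = delta_closed[OF d found[OF f'] q]
    show ?thesis using bqs Some d S_inv by (auto simp: finish_def R_def C_def TC)
  qed (simp add: finish_def R_def)
  have judge_closed: "judge f c b \<in> insert None (Some ` insert None (Some ` W))"
    if "f \<in> insert None (Some ` W)" "c \<in> W" for f c b
    using that by (cases "(f, c, b)" rule: judge.cases) auto
  have "\<exists>M. is_oracle_tm (S <+> A) S M \<and> (\<forall>w\<in>lists (S <+> A). otm_accepts (word_problem G S) M w \<longleftrightarrow>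
     accepts (lk_round N) (\<lambda>(r, _). lk_acc N r) (Check_Start, map (\<lambda>x. In x False) w))"
  proof (rule sweeping_tm[where C=C and R=R])
    show "(\<lambda>x. In x False) ` (S <+> A) \<subseteq> C" by (auto simp: C_def)
    show "inj_on (\<lambda>x. In x False) (S <+> A)" by (auto simp: inj_on_def)
  next
    fix r c r' c' e assume r: "r \<in> R" and c: "c \<in> C" and t: "lk_tr r c = (r', c', e)"
    show "r' \<in> R \<and> c' \<in> C \<and> e \<in> insert None (Some ` S)"
      using r c t by (cases "(r, c)" rule: lk_tr.cases) (auto simp: R_def C_def TC WC split: if_splits)
  next
    fix r b r' p assume r: "r \<in> R" and f: "lk_fin N r b = (r', p)"
    show "r' \<in> R \<and> p \<in> insert None (Some ` C)"
    proof (cases r)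
      case (Look q f' st)
      then have qf: "q \<in> gm_states N" "f' \<in> insert None (Some ` W)" "st \<in> T"
        using r by (auto simp: R_def)
      show ?thesis
      proof (cases st)
        case Before
        then show ?thesis using finish_closed[of q "Some f'"] qf f Look by auto
      next
        case (Marking c)
        then have "c \<in> W" using qf by (simp add: TC)
        then show ?thesis using finish_closed[OF qf(1) judge_closed[OF qf(2)], of c b] f Look Marking by auto
      next
        case (After c)
        then have "c \<in> W" using qf by (simp add: TC)
        from judge_closed[OF qf(2) this, of b] show ?thesis using f Look After qf
          by (cases "judge f' c b") (auto simp: R_def TC)
      qed (use f Look in \<open>auto simp: R_def\<close>)
    qed (use r f fin in \<open>auto simp: R_def TC split: if_splits\<close>)
  qed (use finC finR in \<open>auto simp: R_def\<close>)
  then obtain M where M: "is_oracle_tm (S <+> A) S M" and acc: "\<And>w. w \<in> lists (S <+> A) \<Longrightarrow>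
     otm_accepts (word_problem G S) M w \<longleftrightarrow>
     accepts (lk_round N) (\<lambda>(r, _). lk_acc N r) (Check_Start, map (\<lambda>x. In x False) w)" by blast
  let ?K = "{encode_listing l | l. set l \<in> {c \<in> pattern_codings S A. accepted_coding G N c}}"
  have listing: "set l \<subseteq> lists S \<times> A" if "encode_listing l \<in> lists (S <+> A)" for l
    using that set_encode_listing[of l S A] by (simp add: lists_eq_set)
  have acc_listing: "otm_accepts (word_problem G S) M (encode_listing l) \<longleftrightarrow> accepted_coding G N (set l)"
    if w: "encode_listing l \<in> lists (S <+> A)" for l
  proof -
    have "lk_move N (Check_Start, map (\<lambda>x. In x False) (encode_listing l))
       (Look (gm_init N) None Before, marked (map Inr l))"
    proof -
      have "encode_listing l = [] \<or> \<not> isl (last (encode_listing l))"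
        using encode_listing_iff[of "encode_listing l"] by blast
      then show ?thesis unfolding move_def round_step_def prod.case sweep_check_start marked_encode
        by (cases "encode_listing l") auto
    qed
    then have "otm_accepts (word_problem G S) M (encode_listing l) \<longleftrightarrow>
       accepts (lk_round N) (\<lambda>(r, _). lk_acc N r) (Look (gm_init N) None Before, marked (map Inr l))"
      using acc[OF w] accepts_move by metis
    then show ?thesis using accepts_lookup_rounds[OF listing[OF w]] by simp
  qed
  have rej: "\<not> otm_accepts (word_problem G S) M w"
    if w: "w \<in> lists (S <+> A)" and no: "\<not> (\<exists>l. w = encode_listing l)" for w
  proof -
    obtain x z where wz: "w = x # z" "isl (last w)" using no encode_listing_iff[of w] by (cases w) auto
    then have "lk_move N (Check_Start, map (\<lambda>x. In x False) w) (Dead, In x True # map (\<lambda>x. In x False) z)"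
      unfolding move_def round_step_def prod.case sweep_check_start wz(1) list.case by simp
    moreover have "\<not> accepts (lk_round N) (\<lambda>(r, _). lk_acc N r) (Dead, In x True # map (\<lambda>x. In x False) z)"
    proof (rule accepts_invariant_False[where P="\<lambda>(r, cs). r = Dead"])
      fix c :: "'a lookup_reg \<times> ('g, 'a) trail_cell list" assume "case c of (r, cs) \<Rightarrow> r = Dead"
      then obtain cs where "c = (Dead, cs)" by auto
      then show "case lk_round N c of (r, cs) \<Rightarrow> r = Dead"
        using sweep_dead[of cs] by (auto simp: round_step_def split: prod.splits)
    qed auto
    ultimately show ?thesis using acc[OF w] accepts_move by metis
  qed
  have "?K \<subseteq> lists (S <+> A)"
    using set_encode_listing[of _ S A] by (auto simp: pattern_codings_def lists_eq_set)
  moreover have "otm_accepts (word_problem G S) M w \<longleftrightarrow> w \<in> ?K" if w: "w \<in> lists (S <+> A)" for w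
  proof (cases "\<exists>l. w = encode_listing l")
    case True
    then obtain l where l: "w = encode_listing l" by blast
    show ?thesis
    proof
      assume "otm_accepts (word_problem G S) M w"
      then have "accepted_coding G N (set l)" using acc_listing w l by blast
      moreover have "set l \<in> pattern_codings S A" using listing w l by (simp add: pattern_codings_def)
      ultimately show "w \<in> ?K" using l by blast
    next
      assume "w \<in> ?K"
      then obtain l' where "w = encode_listing l'" "accepted_coding G N (set l')" by blast
      then show "otm_accepts (word_problem G S) M w" using acc_listing w by blast
    qed
  qed (use rej w in blast)
  ultimately show ?thesis using M unfolding oracle_re_codings_def oracle_re_def by blast
qed

text \<open>For a coding that describes a pattern, the prescribed tape is total, and the partial machine
runs in lockstep with the actual one.\<close>

lemma accepted_coding_pattern:
  assumes p: "p \<in> patterns G A" and c: "c \<subseteq> lists S \<times> A"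
    and cp: "\<And>w a. (w, a) \<in> c \<Longrightarrow> p (val w) = Some a"
    and pc: "\<And>g a. p g = Some a \<Longrightarrow> \<exists>w. (w, a) \<in> c \<and> val w = g"
  shows "accepted_coding G N c \<longleftrightarrow> gm_accepts G N (map_option Letter \<circ> p)"
proof -
  let ?y = "\<lambda>g. case p g of None \<Rightarrow> Blank | Some a \<Rightarrow> Letter a"
  have y: "letter_at G c = Some \<circ> ?y"
  proof
    fix g
    have "{a. \<exists>w. (w, a) \<in> c \<and> val w = g} = (case p g of None \<Rightarrow> {} | Some a \<Rightarrow> {a})"
      using cp pc by (auto split: option.splits) 
    then show "letter_at G c g = (Some \<circ> ?y) g"
      by (auto simp: letter_at_def split: option.splits)
  qed
  have pa: "p g = Some a \<Longrightarrow> a \<in> A" for g a using p by (auto simp: patterns_def ran_def)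
  have "gm_accepts G N (map_option Letter \<circ> p) \<longleftrightarrow> accepts (gm_step G N) (\<lambda>c. snd c \<in> gm_accepting N)
      (pattern_config G (gm_blank N) (map_option Letter \<circ> p), gm_init N)"
    by (simp add: gm_accepts_def accepts_def)
  also have "\<dots> \<longleftrightarrow> accepted_coding G N c"
    unfolding accepted_coding_def y
  proof (rule accepts_lockstep[where R = "\<lambda>x a. \<exists>y h q. a = Some (Some \<circ> y, h, q) \<and> h \<in> carrier G \<and>
     q \<in> gm_states N \<and> range y \<subseteq> gm_symbols N \<and> x = (\<lambda>k\<in>carrier G. y (h \<otimes> k), q)"], goal_cases)
    case 1
    have "range ?y \<subseteq> gm_symbols N"
    proof clarify
      fix g show "?y g \<in> gm_symbols N" using N(2) blank_symbol pa[of g] by (cases "p g") auto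
    qed
    moreover have "pattern_config G (gm_blank N) (map_option Letter \<circ> p) = (\<lambda>k\<in>carrier G. ?y (\<one> \<otimes> k))"
      unfolding pattern_config_def N(3) by (intro restrict_ext) (auto split: option.splits)
    moreover have "gm_init N \<in> gm_states N" using N by (simp add: is_G_machine_def)
    ultimately show ?case by (intro exI[of _ ?y] exI[of _ \<one>] exI[of _ "gm_init N"]) simp
  next
    case (2 x a)
    from 2(1) obtain y h q where a: "a = Some (Some \<circ> y, h, q)" and h: "h \<in> carrier G" and q: "q \<in> gm_states N"
      and ry: "range y \<subseteq> gm_symbols N" and x: "x = (\<lambda>k\<in>carrier G. y (h \<otimes> k), q)"
      by (elim exE conjE)
    obtain b q' s where d: "gm_delta N (y h, q) = (b, q', s)" by (metis prod_cases3)
    have bqs: "b \<in> gm_symbols N" "q' \<in> gm_states N" "s \<in> S" using delta_closed[OF d _ q] ry by auto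
    have st: "gm_step G N x = (\<lambda>k\<in>carrier G. (y(h := b)) ((h \<otimes> s) \<otimes> k), q')"
      unfolding x by (rule gm_step_absolute[where y=y, OF is_group h d]) (use bqs in simp)
    have "(Some \<circ> y)(h := Some b) = Some \<circ> y(h := b)" by auto
    then have "partial_step G N a = Some (Some \<circ> y(h := b), h \<otimes> s, q')" using d a by simp
    then show ?case using st bqs h ry
      by (intro exI[of _ "y(h := b)"] exI[of _ "h \<otimes> s"] exI[of _ q'] conjI) auto
  qed (auto simp: partial_acc_def)
  finally show ?thesis by simp
qed

end

lemma ex_pattern_of_coding:
  assumes c: "finite c" "c \<subseteq> lists S \<times> A"
    and cons: "\<forall>w w' a a'. (w, a) \<in> c \<longrightarrow> (w', a') \<in> c \<longrightarrow> val w = val w' \<longrightarrow> a = a'"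
  obtains p where "p \<in> patterns G A" "\<And>w a. (w, a) \<in> c \<Longrightarrow> p (val w) = Some a"
    "\<And>g a. p g = Some a \<Longrightarrow> \<exists>w. (w, a) \<in> c \<and> val w = g"
proof -
  define p where "p g = (if \<exists>w a. (w, a) \<in> c \<and> val w = g then Some (SOME a. \<exists>w. (w, a) \<in> c \<and> val w = g) else None)" for g
  have some: "(SOME a. \<exists>w. (w, a) \<in> c \<and> val w = g) = a" if "(w, a) \<in> c" "val w = g" for g w a
  proof (rule some_equality)
    show "\<exists>w. (w, a) \<in> c \<and> val w = g" using that by blast
    show "a' = a" if "\<exists>w. (w, a') \<in> c \<and> val w = g" for a'
      using that cons \<open>(w, a) \<in> c\<close> \<open>val w = g\<close> by blast
  qed
  have cp: "p (val w) = Some a" if "(w, a) \<in> c" for w a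
  proof -
    have "\<exists>w' a. (w', a) \<in> c \<and> val w' = val w" using that by blast
    then show ?thesis using some[OF that refl] by (simp add: p_def)
  qed
  have pc: "\<exists>w. (w, a) \<in> c \<and> val w = g" if pg: "p g = Some a" for g a
  proof -
    have "\<exists>w a. (w, a) \<in> c \<and> val w = g"
    proof (rule ccontr)
      assume "\<not> ?thesis"
      then have "p g = None" unfolding p_def by (rule if_not_P)
      then show False using pg by simp
    qed
    then obtain w a' where w: "(w, a') \<in> c" "val w = g" by blast
    then have "a' = a" using cp[OF w(1)] pg by simp
    then show ?thesis using w by blast
  qed
  have "dom p \<subseteq> (\<lambda>(w, a). val w) ` c"
  proof
    fix g assume "g \<in> dom p"
    then obtain a where "p g = Some a" by blast
    then obtain w where "(w, a) \<in> c" "val w = g" using pc by blast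
    then show "g \<in> (\<lambda>(w, a). val w) ` c" by (intro image_eqI[of _ _ "(w, a)"]) auto
  qed
  moreover have "(\<lambda>(w, a). val w) ` c \<subseteq> carrier G"
  proof clarify
    fix w a assume "(w, a) \<in> c"
    then have "w \<in> lists S" using c(2) by blast
    then show "val w \<in> carrier G" by (rule val_closed)
  qed
  moreover have "ran p \<subseteq> A"
  proof
    fix a assume "a \<in> ran p"
    then obtain g where "p g = Some a" by (auto simp: ran_def)
    then obtain w where "(w, a) \<in> c" using pc by blast
    then show "a \<in> A" using c(2) by auto
  qed
  ultimately have "p \<in> patterns G A"
    using c(1) by (simp add: patterns_def finite_subset[OF _ finite_imageI])
  then show ?thesis using that cp pc by blast
qed

text \<open>Inconsistent codings have empty cylinders, so it suffices to find for each consistent coding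
a pattern that it contains, and for each pattern a coding that it contains.\<close>

lemma forbidding_codings_cong:
  assumes F: "\<And>p. p \<in> F \<Longrightarrow> \<exists>c\<in>C. \<forall>w a. (w, a) \<in> c \<longrightarrow> p (val w) = Some a"
    and C: "\<And>c. c \<in> C \<Longrightarrow> c \<subseteq> lists S \<times> A"
    and FC: "\<And>c. c \<in> C \<Longrightarrow> (\<forall>w w' a a'. (w, a) \<in> c \<longrightarrow> (w', a') \<in> c \<longrightarrow> val w = val w' \<longrightarrow> a = a') \<Longrightarrow>
      \<exists>p\<in>F. \<forall>g a. p g = Some a \<longrightarrow> (\<exists>w. (w, a) \<in> c \<and> val w = g)"
  shows "forbidding_patterns G A F = forbidding_codings G A C"
proof -
  have pat: "x \<in> pattern_cylinder G A p g \<longleftrightarrow> x \<in> configurations G A \<and> (\<forall>h a. p h = Some a \<longrightarrow> x (g \<otimes> h) = a)" for x p g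
    by (auto simp: pattern_cylinder_def symbol_cylinder_def dom_def)
  have cod: "x \<in> coding_cylinder G A c g \<longleftrightarrow> x \<in> configurations G A \<and> (\<forall>w a. (w, a) \<in> c \<longrightarrow> x (g \<otimes> val w) = a)" for x c g
    by (auto simp: coding_cylinder_def symbol_cylinder_def)
  have "(\<exists>p\<in>F. \<exists>g\<in>carrier G. x \<in> pattern_cylinder G A p g) \<longleftrightarrow> (\<exists>g\<in>carrier G. \<exists>c\<in>C. x \<in> coding_cylinder G A c g)" for x
  proof
    assume "\<exists>p\<in>F. \<exists>g\<in>carrier G. x \<in> pattern_cylinder G A p g"
    then obtain p g where pg: "p \<in> F" "g \<in> carrier G" "x \<in> pattern_cylinder G A p g" by blast
    from F[OF pg(1)] obtain c where c: "c \<in> C" "\<forall>w a. (w, a) \<in> c \<longrightarrow> p (val w) = Some a" by blast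
    then have "x \<in> coding_cylinder G A c g" using pg(3) unfolding pat cod by blast
    then show "\<exists>g\<in>carrier G. \<exists>c\<in>C. x \<in> coding_cylinder G A c g" using pg(2) c(1) by blast
  next
    assume "\<exists>g\<in>carrier G. \<exists>c\<in>C. x \<in> coding_cylinder G A c g"
    then obtain c g where cg: "c \<in> C" "g \<in> carrier G" "x \<in> coding_cylinder G A c g" by blast
    then have "\<forall>w w' a a'. (w, a) \<in> c \<longrightarrow> (w', a') \<in> c \<longrightarrow> val w = val w' \<longrightarrow> a = a'"
      unfolding cod by metis
    from FC[OF cg(1) this] obtain p where p: "p \<in> F" "\<forall>g a. p g = Some a \<longrightarrow> (\<exists>w. (w, a) \<in> c \<and> val w = g)" by blast
    then have "x \<in> pattern_cylinder G A p g" using cg(3) unfolding pat cod by blast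
    then show "\<exists>p\<in>F. \<exists>g\<in>carrier G. x \<in> pattern_cylinder G A p g" using cg(2) p(1) by blast
  qed
  then show ?thesis unfolding forbidding_patterns_def forbidding_codings_def by auto
qed

theorem effectively_closed_of_G_re:
  assumes F: "G_recursively_enumerable G S A F" and A: "finite A"
  shows "effectively_closed G S A (forbidding_patterns G A F)"
proof -
  obtain N :: "('g, 'a tape_symbol) G_machine" where
    N: "is_G_machine S N" "Letter ` A \<subseteq> gm_symbols N" "gm_blank N = Blank"
    and acc: "\<And>p. p \<in> patterns G A \<Longrightarrow> gm_accepts G N (map_option Letter \<circ> p) \<longleftrightarrow> p \<in> F"
    and FP: "F \<subseteq> patterns G A"
    using F unfolding G_recursively_enumerable_def by (elim conjE exE)
      (rule that, assumption, assumption, assumption, erule (1) bspec, assumption)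
  let ?C = "{c \<in> pattern_codings S A. accepted_coding G N c}"
  have "forbidding_patterns G A F = forbidding_codings G A ?C"
  proof (rule forbidding_codings_cong)
    fix p assume p: "p \<in> F"
    then have pp: "p \<in> patterns G A" using FP by blast
    have "\<exists>w. w \<in> lists S \<and> val w = g" if "g \<in> dom p" for g
    proof -
      have "g \<in> carrier G" using that pp by (auto simp: patterns_def)
      then obtain w where "w \<in> lists S" "val w = g" by (rule ex_word)
      then show ?thesis by blast
    qed
    then have "\<forall>g\<in>dom p. \<exists>w. w \<in> lists S \<and> val w = g" by blast
    from bchoice[OF this] obtain wd where wd: "\<And>g. g \<in> dom p \<Longrightarrow> wd g \<in> lists S \<and> val (wd g) = g" by blast
    define c where "c = (\<lambda>g. (wd g, the (p g))) ` dom p"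
    have pa: "p g = Some a \<Longrightarrow> a \<in> A" for g a using pp by (auto simp: patterns_def ran_def)
    have cs: "c \<subseteq> lists S \<times> A" using wd pa by (auto simp: c_def)
    have cp: "p (val w) = Some a" if i: "(w, a) \<in> c" for w a
    proof -
      obtain g where g: "g \<in> dom p" "w = wd g" "a = the (p g)" using i by (auto simp: c_def)
      then show ?thesis using wd[OF g(1)] by auto
    qed
    have pc: "\<exists>w. (w, a) \<in> c \<and> val w = g" if "p g = Some a" for g a
    proof (intro exI conjI)
      show "(wd g, a) \<in> c" using that unfolding c_def by (intro image_eqI[of _ _ g]) auto
      show "val (wd g) = g" using wd[of g] that by auto
    qed
    have "accepted_coding G N c \<longleftrightarrow> p \<in> F"
      by (rule trans[OF accepted_coding_pattern[OF N pp cs cp pc] acc[OF pp]])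
    then have "accepted_coding G N c" using p by simp
    moreover have "finite c" using pp by (simp add: patterns_def c_def)
    ultimately have "c \<in> ?C" using cs by (simp add: pattern_codings_def)
    then show "\<exists>c\<in>?C. \<forall>w a. (w, a) \<in> c \<longrightarrow> p (val w) = Some a"
      using cp by (intro bexI[of _ c]) simp_all
  next
    fix c assume c: "c \<in> ?C" and cons: "\<forall>w w' a a'. (w, a) \<in> c \<longrightarrow> (w', a') \<in> c \<longrightarrow> val w = val w' \<longrightarrow> a = a'"
    have cs: "finite c" "c \<subseteq> lists S \<times> A" using c by (auto simp: pattern_codings_def)
    obtain p where pp: "p \<in> patterns G A" and cp: "\<And>w a. (w, a) \<in> c \<Longrightarrow> p (val w) = Some a"
      and pc: "\<And>g a. p g = Some a \<Longrightarrow> \<exists>w. (w, a) \<in> c \<and> val w = g" using ex_pattern_of_coding[OF cs cons] by metis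
    have "accepted_coding G N c \<longleftrightarrow> p \<in> F"
      by (rule trans[OF accepted_coding_pattern[OF N pp cs(2) cp pc] acc[OF pp]])
    then have "p \<in> F" using c by simp
    then show "\<exists>p\<in>F. \<forall>g a. p g = Some a \<longrightarrow> (\<exists>w. (w, a) \<in> c \<and> val w = g)"
      using pc by (intro bexI[of _ p]) simp_all
  qed (auto simp: pattern_codings_def)
  then show ?thesis using re_accepted_codings[OF N A] unfolding effectively_closed_def by blast
qed

end

section \<open>Finite groups\<close>

lemma subshift_configurations:
  assumes "subshift G A X" shows "X \<subseteq> configurations G A"
  using closedin_subset[of "product_topology (\<lambda>_. discrete_topology A) (carrier G)" X] assms
  by (simp add: subshift_def configurations_def)

context fg_group
begin

lemma val_take_Suc:
  assumes "w \<in> lists S" "k < length w"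
  shows "val (take (Suc k) w) = val (take k w) \<otimes> w ! k"
proof -
  have "take k w \<in> lists S" "[w ! k] \<in> lists S" "w ! k \<in> carrier G"
    using assms S_carrier by (auto simp: lists_eq_set subset_iff dest: in_set_takeD)
  then show ?thesis using val_append[of "take k w" "[w ! k]"] assms(2)
    by (simp add: take_Suc_conv_app_nth)
qed

text \<open>A walk that visits all elements of a finite set. Each new element is reached from wherever the walk
has arrived so far; the final \<open>\<one>\<close> makes the end point of the walk a proper prefix as well.\<close>

lemma covering_word:
  assumes "finite D" "D \<subseteq> carrier G"
  shows "\<exists>w\<in>lists S. \<forall>g\<in>D. \<exists>i<length w. val (take i w) = g"
  using assms
proof (induction D)
  case empty then show ?case by (intro bexI[of _ "[]"]) auto
next
  case (insert g D)
  then obtain w where w: "w \<in> lists S" "\<forall>g\<in>D. \<exists>i<length w. val (take i w) = g" by auto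
  have g: "g \<in> carrier G" and "inv (val w) \<otimes> g \<in> carrier G" using insert.prems w by auto
  then obtain u where u: "u \<in> lists S" "val u = inv (val w) \<otimes> g" using ex_word by blast
  have "val (w @ u) = g" using w u g by (simp add: val_append m_assoc[symmetric])
  then have "\<exists>i<length (w @ u @ [\<one>]). val (take i (w @ u @ [\<one>])) = g"
    by (intro exI[of _ "length (w @ u)"]) simp
  moreover have "\<exists>i<length (w @ u @ [\<one>]). val (take i (w @ u @ [\<one>])) = g'" if "g' \<in> D" for g'
  proof -
    from w(2) that obtain i where "i < length w" "val (take i w) = g'" by blast
    then show ?thesis by (intro exI[of _ i]) simp
  qed
  moreover have "w @ u @ [\<one>] \<in> lists S" using w u S_one by simp
  ultimately show ?case by blast
qed

lemma G_re_of_finite_group: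
  assumes G: "finite (carrier G)" and A: "finite A" and F: "F \<subseteq> patterns G A"
  shows "G_recursively_enumerable G S A F"
proof -
  obtain w where w: "w \<in> lists S" and cov: "\<And>g. g \<in> carrier G \<Longrightarrow> \<exists>i<length w. val (take i w) = g"
    using covering_word[OF G] by blast
  let ?n = "length w"
  let ?\<Lambda> = "insert None (Some ` A)"
  let ?Q = "{st. set st \<subseteq> ?\<Lambda> \<and> length st \<le> ?n}"
  \<comment> \<open>The state is the list of symbols read so far on the walk along \<open>w\<close>.\<close>
  define \<delta> where "\<delta> l st = (if length st < ?n then (l, st @ [l], w ! length st) else (l, st, \<one>))"
    for l :: "'a option" and st
  define reading where "reading p k = map (\<lambda>i. p (val (take i w))) [0..<k]" for p :: "'g \<rightharpoonup> 'a" and k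
  define acc where "acc st \<longleftrightarrow> (\<exists>p\<in>F. st = reading p ?n)" for st
  have wS: "k < ?n \<Longrightarrow> w ! k \<in> S" for k using w by (auto simp: lists_eq_set)
  have "\<exists>M :: ('g, 'a tape_symbol) G_machine. is_G_machine S M \<and> gm_blank M = Blank \<and>
     Letter ` A \<subseteq> gm_symbols M \<and> (\<forall>p\<in>patterns G A. gm_accepts G M (map_option Letter \<circ> p) \<longleftrightarrow>
       accepts (walk_step G \<delta>) (\<lambda>(_, _, q). acc q)
         (\<lambda>g. case p g of None \<Rightarrow> None | Some a \<Rightarrow> Some a, \<one>, []))"
  proof (rule G_machine_of_abstract[where \<Lambda>="?\<Lambda>" and Q="?Q"])
    show "finite ?Q" using finite_lists_length_le[of ?\<Lambda> ?n] A by simp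
    fix l q l' q' s assume "l \<in> ?\<Lambda>" "q \<in> ?Q" "\<delta> l q = (l', q', s)"
    then show "l' \<in> ?\<Lambda> \<and> q' \<in> ?Q \<and> s \<in> S"
      using wS S_one by (auto simp: \<delta>_def split: if_splits)
  qed (use A S_carrier in \<open>auto simp: is_group\<close>)
  moreover have "accepts (walk_step G \<delta>) (\<lambda>(_, _, q). acc q)
         (\<lambda>g. case p g of None \<Rightarrow> None | Some a \<Rightarrow> Some a, \<one>, []) \<longleftrightarrow> p \<in> F" if p: "p \<in> patterns G A" for p
  proof -
    have p': "(\<lambda>g. case p g of None \<Rightarrow> None | Some a \<Rightarrow> Some a) = p"
      by (auto split: option.splits)
    have run: "(walk_step G \<delta> ^^ k) (p, \<one>, []) = (p, val (take k w), reading p k)" if "k \<le> ?n" for k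
      using that
    proof (induction k)
      case (Suc k)
      then show ?case using val_take_Suc[OF w, of k]
        by (simp add: walk_step_def \<delta>_def reading_def)
    qed (simp add: reading_def)
    have stay: "(walk_step G \<delta> ^^ (?n + k)) (p, \<one>, []) = (p, val w, reading p ?n)" for k
    proof (induction k)
      case 0 then show ?case using run[of ?n] by simp
    next
      case (Suc k)
      then show ?case using w by (simp add: walk_step_def \<delta>_def reading_def)
    qed
    have len: "length (reading p' k) = k" for p' k by (simp add: reading_def)
    have "accepts (walk_step G \<delta>) (\<lambda>(_, _, q). acc q) (p, \<one>, []) \<longleftrightarrow> acc (reading p ?n)"
    proof
      assume "accepts (walk_step G \<delta>) (\<lambda>(_, _, q). acc q) (p, \<one>, [])"
      then obtain k where k: "case (walk_step G \<delta> ^^ k) (p, \<one>, []) of (_, _, q) \<Rightarrow> acc q"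
        unfolding accepts_def by (rule exE)
      show "acc (reading p ?n)"
      proof (cases "k \<le> ?n")
        case True
        then have "acc (reading p k)" using k run by simp
        then have "k = ?n" unfolding acc_def using len by metis
        then show ?thesis using \<open>acc (reading p k)\<close> by simp
      next
        case False
        then show ?thesis using k stay[of "k - ?n"] by simp
      qed
    next
      assume "acc (reading p ?n)"
      then show "accepts (walk_step G \<delta>) (\<lambda>(_, _, q). acc q) (p, \<one>, [])"
        unfolding accepts_def using run[of ?n] by (intro exI[of _ ?n]) simp
    qed
    also have "\<dots> \<longleftrightarrow> p \<in> F"
    proof
      assume "acc (reading p ?n)"
      then obtain p' where p'F: "p' \<in> F" and eq: "reading p ?n = reading p' ?n" by (auto simp: acc_def)
      have "p g = p' g" for g
      proof (cases "g \<in> carrier G")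
        case True
        then obtain i where i: "i < ?n" "val (take i w) = g" using cov by blast
        then have "reading p ?n ! i = p g" "reading p' ?n ! i = p' g" by (simp_all add: reading_def)
        then show ?thesis using eq by simp
      next
        case False
        have "g \<notin> dom p" "g \<notin> dom p'" using False p p'F F by (auto simp: patterns_def)
        then show ?thesis by (simp add: domIff)
      qed
      then show "p \<in> F" using p'F by (metis ext)
    qed (auto simp: acc_def)
    finally show ?thesis unfolding p' .
  qed
  ultimately show ?thesis unfolding G_recursively_enumerable_def using F by simp
qed

text \<open>A pattern on all of \<open>G\<close> is a configuration, and shift invariance of \<open>X\<close> makes it irrelevant
at which \<open>g\<close> it is placed.\<close>

lemma subshift_of_finite_group:
  assumes G: "finite (carrier G)" and X: "subshift G A X"
  shows "\<exists>F\<subseteq>patterns G A. X = forbidding_patterns G A F"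
proof -
  define F where "F = {p \<in> patterns G A. dom p = carrier G \<and> (\<lambda>g\<in>carrier G. the (p g)) \<notin> X}"
  have XA: "X \<subseteq> configurations G A" using X by (rule subshift_configurations)
  have "X = forbidding_patterns G A F"
  proof (intro equalityI subsetI)
    fix x assume x: "x \<in> X"
    have "x \<notin> pattern_cylinder G A p g" if p: "p \<in> F" and g: "g \<in> carrier G" for p g
    proof
      assume "x \<in> pattern_cylinder G A p g"
      then have "x (g \<otimes> h) = the (p h)" if "h \<in> carrier G" for h
        using that p by (auto simp: pattern_cylinder_def symbol_cylinder_def F_def)
      then have "shift G (inv g) x = (\<lambda>h\<in>carrier G. the (p h))"
        unfolding shift_def using g by (intro restrict_ext) simp
      moreover have "shift G (inv g) x \<in> X" using X x g by (auto simp: subshift_def)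
      ultimately show False using p by (simp add: F_def)
    qed
    then show "x \<in> forbidding_patterns G A F" using x XA by (auto simp: forbidding_patterns_def)
  next
    fix x assume x: "x \<in> forbidding_patterns G A F"
    then have xc: "x \<in> configurations G A" by (simp add: forbidding_patterns_def)
    show "x \<in> X"
    proof (rule ccontr)
      assume nx: "x \<notin> X"
      define p where "p g = (if g \<in> carrier G then Some (x g) else None)" for g
      have "(\<lambda>g\<in>carrier G. the (p g)) = x"
        using xc by (auto simp: p_def configurations_def PiE_def extensional_def restrict_def fun_eq_iff)
      moreover have d: "dom p = carrier G" by (auto simp: p_def dom_def)
      moreover have "ran p \<subseteq> A" using xc by (auto simp: p_def ran_def configurations_def)
      ultimately have "p \<in> F" using G nx by (simp add: F_def patterns_def)
      moreover have "x \<in> pattern_cylinder G A p \<one>"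
        using xc by (auto simp: pattern_cylinder_def symbol_cylinder_def p_def split: if_splits)
      ultimately show False using x one_closed unfolding forbidding_patterns_def by blast
    qed
  qed
  moreover have "F \<subseteq> patterns G A" by (auto simp: F_def)
  ultimately show ?thesis by blast
qed

end

section \<open>Balls and spanning trees of the Cayley graph\<close>

text \<open>The generators are numbered so that a machine can loop over them. The identity comes first:
visiting all neighbours of an element in the order of the generators then begins with the element itself.\<close>

locale fg_gens = fg_group G S for G :: "('g, 'm) monoid_scheme" (structure) and S +
  fixes s :: "nat \<Rightarrow> 'g" and m :: nat
  assumes gens: "s ` {..<m} = S" and m_pos: "0 < m" and s_zero: "s 0 = \<one>"
begin

lemma s_in [simp]: "k < m \<Longrightarrow> s k \<in> S" using gens by auto

lemma s_closed [simp]: "k < m \<Longrightarrow> s k \<in> carrier G" by simp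

primrec ball :: "nat \<Rightarrow> 'g set" where
  "ball 0 = {\<one>}"
| "ball (Suc n) = (\<lambda>(v, k). v \<otimes> s k) ` (ball n \<times> {..<m})"

lemma ball_SucI: "v \<in> ball n \<Longrightarrow> k < m \<Longrightarrow> v \<otimes> s k \<in> ball (Suc n)"
  by (auto intro!: image_eqI[of _ _ "(v, k)"])

lemma ball_carrier: "ball n \<subseteq> carrier G"
  by (induction n) auto

lemma ball_closed [simp]: "v \<in> ball n \<Longrightarrow> v \<in> carrier G"
  using ball_carrier by blast

lemma finite_ball [simp]: "finite (ball n)"
  by (induction n) auto

lemma ball_Suc_mono: "v \<in> ball n \<Longrightarrow> v \<in> ball (Suc n)"
  using ball_SucI[of v n 0] m_pos s_zero by simp

lemma ball_mono:
  assumes "v \<in> ball n" "n \<le> n'" shows "v \<in> ball n'"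
  using assms(2,1) by (induction rule: dec_induct) (auto simp: ball_Suc_mono simp del: ball.simps)

lemma one_in_ball [simp]: "\<one> \<in> ball n"
  using ball_mono[of \<one> 0 n] by simp

lemma val_in_ball: "w \<in> lists S \<Longrightarrow> val w \<in> ball (length w)"
proof (induction w rule: rev_induct)
  case (snoc x w)
  then obtain k where k: "k < m" "x = s k" using gens by auto
  then have "val (w @ [x]) = val w \<otimes> s k" using snoc.prems val_append[of w "[x]"] by simp
  then show ?case using ball_SucI[of "val w" "length w" k] k snoc by simp
qed simp

lemma ex_ball: "g \<in> carrier G \<Longrightarrow> \<exists>n. g \<in> ball n"
proof -
  assume "g \<in> carrier G"
  then obtain w where "w \<in> lists S" "val w = g" by (rule ex_word)
  then show ?thesis using val_in_ball by blast
qed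

definition len :: "'g \<Rightarrow> nat" where "len v = (LEAST n. v \<in> ball n)"

lemma in_ball_iff: "v \<in> carrier G \<Longrightarrow> v \<in> ball n \<longleftrightarrow> len v \<le> n"
proof
  assume "v \<in> ball n" then show "len v \<le> n" unfolding len_def by (rule Least_le)
next
  assume "v \<in> carrier G" "len v \<le> n"
  from ex_ball[OF this(1)] have "v \<in> ball (len v)" unfolding len_def by (rule LeastI_ex)
  then show "v \<in> ball n" using \<open>len v \<le> n\<close> by (rule ball_mono)
qed

lemma len_one [simp]: "len \<one> = 0"
  using iffD1[OF in_ball_iff[OF one_closed] one_in_ball[of 0]] by simp

lemma len_zero:
  assumes "v \<in> carrier G" "len v = 0" shows "v = \<one>"
proof -
  have "v \<in> ball 0" by (rule iffD2[OF in_ball_iff]) (use assms in simp_all)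
  then show ?thesis by simp
qed

text \<open>As long as the balls grow, each has at least one more element than the one before, and if they stop
growing they exhaust \<open>G\<close>.\<close>

lemma ball_unbounded:
  assumes "infinite (carrier G)" shows "n < card (ball n)"
proof (induction n)
  case (Suc n)
  have "ball n \<noteq> ball (Suc n)"
  proof
    assume eq: "ball n = ball (Suc n)"
    have "ball n' \<subseteq> ball n" for n'
    proof (induction n')
      case (Suc n')
      show ?case
      proof
        fix x assume "x \<in> ball (Suc n')"
        then obtain v k where "v \<in> ball n'" "k < m" "x = v \<otimes> s k" by auto
        then have "x \<in> ball (Suc n)" using Suc ball_SucI by blast
        then show "x \<in> ball n" unfolding eq .
      qed
    qed simp
    then have "carrier G \<subseteq> ball n" using ex_ball by fast
    then show False using assms finite_subset[OF _ finite_ball] by blast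
  qed
  moreover have "ball n \<subseteq> ball (Suc n)" using ball_Suc_mono by blast
  ultimately have "card (ball n) < card (ball (Suc n))" by (intro psubset_card_mono) auto
  then show ?case using Suc by simp
qed simp

text \<open>\<open>par v\<close> is the index of the generator that leads to \<open>v\<close> from its parent, which lies one step
closer to the identity.\<close>

definition spanning :: "nat \<Rightarrow> ('g \<Rightarrow> nat option) \<Rightarrow> bool" where
  "spanning n par \<longleftrightarrow> par \<one> = None \<and>
     (\<forall>v\<in>ball n. v \<noteq> \<one> \<longrightarrow> (\<exists>j<m. par v = Some j \<and> Suc (len (v \<otimes> inv (s j))) = len v))"

definition child :: "nat \<Rightarrow> ('g \<Rightarrow> nat option) \<Rightarrow> 'g \<Rightarrow> nat \<Rightarrow> bool" where
  "child n par v k \<longleftrightarrow> k < m \<and> v \<otimes> s k \<in> ball n \<and> par (v \<otimes> s k) = Some k"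

lemma cancel_step [simp]: "v \<in> carrier G \<Longrightarrow> k < m \<Longrightarrow> v \<otimes> s k \<otimes> inv (s k) = v"
  by (simp add: m_assoc)

lemma cancel_step' [simp]: "v \<in> carrier G \<Longrightarrow> k < m \<Longrightarrow> v \<otimes> inv (s k) \<otimes> s k = v"
  by (simp add: m_assoc)

lemma child_len:
  assumes "spanning n par" "v \<in> carrier G" "child n par v k"
  shows "len (v \<otimes> s k) = Suc (len v)"
proof -
  have k: "k < m" "v \<otimes> s k \<in> ball n" "par (v \<otimes> s k) = Some k" using assms by (auto simp: child_def)
  then have "v \<otimes> s k \<noteq> \<one>" using assms by (auto simp: spanning_def)
  then obtain j where "par (v \<otimes> s k) = Some j" "Suc (len (v \<otimes> s k \<otimes> inv (s j))) = len (v \<otimes> s k)"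
    using assms k by (auto simp: spanning_def)
  then show ?thesis using k assms by simp
qed

text \<open>The postorder of the subtree below \<open>v\<close>, where \<open>d\<close> bounds its depth. The recursion is on
the depth because the tree is only given by its parent function.\<close>

primrec order :: "nat \<Rightarrow> ('g \<Rightarrow> nat option) \<Rightarrow> nat \<Rightarrow> 'g \<Rightarrow> 'g list" where
  "order n par 0 v = [v]"
| "order n par (Suc d) v =
     concat (map (\<lambda>k. if child n par v k then order n par d (v \<otimes> s k) else []) [0..<m]) @ [v]"

lemma in_order_Suc: "w \<in> set (order n par (Suc d) v) \<longleftrightarrow>
    w = v \<or> (\<exists>k. child n par v k \<and> w \<in> set (order n par d (v \<otimes> s k)))"
  by (auto simp: child_def)

definition parent :: "('g \<Rightarrow> nat option) \<Rightarrow> 'g \<Rightarrow> 'g" where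
  "parent par v = v \<otimes> inv (s (the (par v)))"

lemma parent_child: "v \<in> carrier G \<Longrightarrow> child n par v k \<Longrightarrow> parent par (v \<otimes> s k) = v"
  by (simp add: child_def parent_def)

text \<open>All elements of the subtree of \<open>v\<close> have \<open>v\<close> as their ancestor at the same distance from the
identity. Subtrees of different children are therefore disjoint.\<close>

lemma order_ancestor:
  assumes "spanning n par"
  shows "v \<in> ball n \<Longrightarrow> w \<in> set (order n par d v) \<Longrightarrow>
    w \<in> ball n \<and> len v \<le> len w \<and> (parent par ^^ (len w - len v)) w = v"
proof (induction d arbitrary: v)
  case (Suc d)
  from Suc.prems(2)[unfolded in_order_Suc] show ?case
  proof
    assume "\<exists>k. child n par v k \<and> w \<in> set (order n par d (v \<otimes> s k))"
    then obtain k where k: "child n par v k" "w \<in> set (order n par d (v \<otimes> s k))" by blast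
    have l: "len (v \<otimes> s k) = Suc (len v)" using child_len[OF assms _ k(1)] Suc.prems by simp
    have IH: "w \<in> ball n" "len (v \<otimes> s k) \<le> len w" "(parent par ^^ (len w - len (v \<otimes> s k))) w = v \<otimes> s k"
      using Suc.IH[OF _ k(2)] k(1) by (auto simp: child_def)
    have "len w - len v = Suc (len w - len (v \<otimes> s k))" using IH(2) l by simp
    then have "(parent par ^^ (len w - len v)) w = parent par (v \<otimes> s k)" using IH(3) by simp
    then show ?thesis using parent_child[OF _ k(1)] Suc.prems(1) IH l by simp
  qed (use Suc.prems in simp)
qed simp

lemma distinct_concat_map:
  assumes "distinct ks" "\<And>k. k \<in> set ks \<Longrightarrow> distinct (f k)"
    and "\<And>k k' w. k \<in> set ks \<Longrightarrow> k' \<in> set ks \<Longrightarrow> w \<in> set (f k) \<Longrightarrow> w \<in> set (f k') \<Longrightarrow> k = k'"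
  shows "distinct (concat (map f ks))"
  using assms
proof (induction ks)
  case (Cons k ks)
  have "distinct (concat (map f ks))" by (rule Cons.IH) (use Cons.prems in \<open>auto intro: Cons.prems(3)\<close>)
  moreover have "set (f k) \<inter> set (concat (map f ks)) = {}"
  proof (rule ccontr)
    assume "set (f k) \<inter> set (concat (map f ks)) \<noteq> {}"
    then obtain w k' where "w \<in> set (f k)" "k' \<in> set ks" "w \<in> set (f k')" by auto
    then have "k = k'" using Cons.prems(3)[of k k' w] by simp
    then show False using Cons.prems(1) \<open>k' \<in> set ks\<close> by simp
  qed
  ultimately show ?case using Cons.prems(2)[of k] by simp
qed simp

lemma order_disjoint:
  assumes "spanning n par" "v \<in> ball n" "child n par v k" "child n par v k'"
    and "w \<in> set (order n par d (v \<otimes> s k))" "w \<in> set (order n par d (v \<otimes> s k'))"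
  shows "k = k'"
proof -
  have "len (v \<otimes> s k) = len (v \<otimes> s k')" using child_len[OF assms(1)] assms by simp
  moreover have b: "v \<otimes> s k \<in> ball n" "v \<otimes> s k' \<in> ball n" using assms by (simp_all add: child_def)
  moreover note order_ancestor[OF assms(1) b(1) assms(5)] order_ancestor[OF assms(1) b(2) assms(6)]
  ultimately have "v \<otimes> s k = v \<otimes> s k'" by metis
  then show ?thesis using assms(3,4) by (simp add: child_def)
qed

lemma order_not_root:
  assumes "spanning n par" "v \<in> ball n" "child n par v k"
  shows "v \<notin> set (order n par d (v \<otimes> s k))"
proof
  assume v: "v \<in> set (order n par d (v \<otimes> s k))"
  have "v \<otimes> s k \<in> ball n" using assms(3) by (simp add: child_def)
  from order_ancestor[OF assms(1) this v] have "len (v \<otimes> s k) \<le> len v" by blast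
  then show False using child_len[OF assms(1) _ assms(3)] assms(2) by simp
qed

lemma distinct_order:
  assumes "spanning n par"
  shows "v \<in> ball n \<Longrightarrow> distinct (order n par d v)"
proof (induction d arbitrary: v)
  case (Suc d)
  have "distinct (concat (map (\<lambda>k. if child n par v k then order n par d (v \<otimes> s k) else []) [0..<m]))"
  proof (rule distinct_concat_map)
    fix k assume "k \<in> set [0..<m]"
    show "distinct (if child n par v k then order n par d (v \<otimes> s k) else [])"
      using Suc.IH[of "v \<otimes> s k"] by (auto simp: child_def)
  next
    fix k k' w
    assume "w \<in> set (if child n par v k then order n par d (v \<otimes> s k) else [])"
      and "w \<in> set (if child n par v k' then order n par d (v \<otimes> s k') else [])"
    then have "child n par v k \<and> w \<in> set (order n par d (v \<otimes> s k))"
      and "child n par v k' \<and> w \<in> set (order n par d (v \<otimes> s k'))"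
      by (simp_all split: if_splits)
    then show "k = k'" using order_disjoint[OF assms Suc.prems, of k k' w d] by blast
  qed simp
  moreover have "v \<notin> set (concat (map (\<lambda>k. if child n par v k then order n par d (v \<otimes> s k) else []) [0..<m]))"
  proof
    assume "v \<in> set (concat (map (\<lambda>k. if child n par v k then order n par d (v \<otimes> s k) else []) [0..<m]))"
    then obtain k where "v \<in> set (if child n par v k then order n par d (v \<otimes> s k) else [])" by auto
    then have "child n par v k \<and> v \<in> set (order n par d (v \<otimes> s k))" by (simp split: if_splits)
    then show False using order_not_root[OF assms Suc.prems, of k d] by blast
  qed
  ultimately show ?case by simp
qed simp

lemma order_children:
  assumes "spanning n par"
  shows "v \<in> ball n \<Longrightarrow> len v + d = n \<Longrightarrow> w \<in> set (order n par d v) \<Longrightarrow> child n par w k \<Longrightarrow>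
    w \<otimes> s k \<in> set (order n par d v)"
proof (induction d arbitrary: v)
  case 0
  then have "len (v \<otimes> s k) = Suc n" "v \<otimes> s k \<in> ball n" using child_len[OF assms, of v k] by (auto simp: child_def)
  then show ?case using iffD1[OF in_ball_iff[of "v \<otimes> s k" n]] ball_closed by fastforce
next
  case (Suc d)
  have self: "u \<in> set (order n par d u)" for u by (cases d) auto
  from Suc.prems(3)[unfolded in_order_Suc] show ?case
  proof
    assume "w = v" then show ?thesis unfolding in_order_Suc using Suc.prems(4) self by blast
  next
    assume "\<exists>k. child n par v k \<and> w \<in> set (order n par d (v \<otimes> s k))"
    then obtain k' where k': "child n par v k'" "w \<in> set (order n par d (v \<otimes> s k'))" by blast
    have "len (v \<otimes> s k') + d = n" using child_len[OF assms _ k'(1)] Suc.prems by simp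
    then have "w \<otimes> s k \<in> set (order n par d (v \<otimes> s k'))"
      using Suc.IH[of "v \<otimes> s k'"] k' Suc.prems(4) by (simp add: child_def)
    then show ?thesis unfolding in_order_Suc using k'(1) by blast
  qed
qed

lemma set_order:
  assumes "spanning n par" shows "set (order n par n \<one>) = ball n"
proof (intro equalityI subsetI)
  fix w assume "w \<in> set (order n par n \<one>)"
  then show "w \<in> ball n" using order_ancestor[OF assms one_in_ball] by blast
next
  fix w assume "w \<in> ball n"
  then show "w \<in> set (order n par n \<one>)"
  proof (induction "len w" arbitrary: w)
    case 0
    then have "w = \<one>" using len_zero[of w] by simp
    then show ?case by (cases n) auto
  next
    case (Suc l)
    then have "w \<noteq> \<one>" by auto
    then obtain j where j: "j < m" "par w = Some j" "Suc (len (w \<otimes> inv (s j))) = len w"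
      using assms Suc.prems by (auto simp: spanning_def)
    let ?u = "w \<otimes> inv (s j)"
    have u: "?u \<in> carrier G" using j Suc.prems by simp
    have "len w \<le> n" using iffD1[OF in_ball_iff[OF ball_closed[OF Suc.prems]] Suc.prems] .
    then have "?u \<in> ball n" using j(3) by (intro iffD2[OF in_ball_iff[OF u]]) simp
    then have "?u \<in> set (order n par n \<one>)" using Suc.hyps(1)[of ?u] Suc.hyps(2) j(3) by simp
    moreover have "child n par ?u j" using j Suc.prems by (simp add: child_def)
    ultimately have "?u \<otimes> s j \<in> set (order n par n \<one>)"
      using order_children[OF assms one_in_ball] by simp
    then show ?case using j Suc.prems by simp
  qed
qed

end

section \<open>Sweeping a spanning tree with a G-machine\<close>

datatype ('a, 'd) tree_label = Raw "'a option" | Node "'a option" "nat option" 'd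

text \<open>\<open>Try k\<close>: look for the next child, beginning with generator \<open>k\<close>; \<open>Probe k\<close>: standing on
the neighbour along generator \<open>k\<close>, decide whether it is a child; \<open>Visit k\<close>: all children are done,
the neighbours from \<open>k\<close> on are to be processed; \<open>Work k\<close>: standing on the neighbour along \<open>k\<close>,
process it.\<close>

datatype 'r tree_state = Start | Try nat 'r | Probe nat 'r | Visit nat 'r | Work nat 'r | Stop

text \<open>A \<open>G\<close>-machine that sweeps its tree over and over again. Visiting an element means
processing all its neighbours, beginning with the element itself: \<open>upd\<close> changes the data of neighbours that
belong to the tree and \<open>new\<close> may adopt those that do not. At the end of a sweep the machine is at the root
and \<open>eps\<close> prepares the control for the next sweep.\<close>

locale tree_machine = fg_gens G S s m
  for G :: "('g, 'm) monoid_scheme" (structure) and S s m +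
  fixes upd :: "'r \<Rightarrow> nat \<Rightarrow> 'a option \<Rightarrow> bool \<Rightarrow> 'd \<Rightarrow> 'r \<times> 'd"
    and new :: "'r \<Rightarrow> nat \<Rightarrow> 'r \<times> 'd option"
    and eps :: "'r \<Rightarrow> 'r" and fin :: "'r \<Rightarrow> bool" and r0 :: 'r and d0 :: 'd
begin

fun touch :: "nat \<Rightarrow> 'r \<Rightarrow> ('a, 'd) tree_label \<Rightarrow> 'r \<times> ('a, 'd) tree_label" where
  "touch k r (Node i p d) = (case upd r k i (p = None) d of (r', d') \<Rightarrow> (r', Node i p d'))"
| "touch k r (Raw i) = (case new r k of (r', None) \<Rightarrow> (r', Raw i) | (r', Some d) \<Rightarrow> (r', Node i (Some k) d))"

definition enter :: "'r \<Rightarrow> 'r tree_state" where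
  "enter r = (if fin r then Stop else Try 0 r)"

fun tdelta :: "('a, 'd) tree_label \<Rightarrow> 'r tree_state \<Rightarrow> ('a, 'd) tree_label \<times> 'r tree_state \<times> 'g" where
  "tdelta l Start = (Node (case l of Raw i \<Rightarrow> i | Node i _ _ \<Rightarrow> i) None d0, Try 0 r0, \<one>)"
| "tdelta l (Try k r) = (if k < m then (l, Probe k r, s k) else (l, Visit 0 r, \<one>))"
| "tdelta l (Probe k r) = (if \<exists>i d. l = Node i (Some k) d then (l, Try 0 r, \<one>) else (l, Try (Suc k) r, inv (s k)))"
| "tdelta l (Visit k r) = (if k < m then (l, Work k r, s k)
     else (case l of Node i (Some j) d \<Rightarrow> (l, Try (Suc j) r, inv (s j)) | _ \<Rightarrow> (l, enter (eps r), \<one>)))"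
| "tdelta l (Work k r) = (case touch k r l of (r', l') \<Rightarrow> (l', Visit (Suc k) r', inv (s k)))"
| "tdelta l Stop = (l, Stop, \<one>)"

abbreviation "tstep \<equiv> walk_step G tdelta"
abbreviation "tmove \<equiv> move tstep (\<lambda>(_, _, q). q = Stop)"

definition work :: "'g \<Rightarrow> nat \<Rightarrow> 'r \<times> ('g \<Rightarrow> ('a, 'd) tree_label) \<Rightarrow> 'r \<times> ('g \<Rightarrow> ('a, 'd) tree_label)" where
  "work v k = (\<lambda>(r, y). case touch k r (y (v \<otimes> s k)) of (r', l) \<Rightarrow> (r', y(v \<otimes> s k := l)))"

definition visit :: "'g \<Rightarrow> 'r \<times> ('g \<Rightarrow> ('a, 'd) tree_label) \<Rightarrow> 'r \<times> ('g \<Rightarrow> ('a, 'd) tree_label)" where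
  "visit v = fold (work v) [0..<m]"

definition at_in :: "'g \<Rightarrow> ('r \<Rightarrow> 'r tree_state) \<Rightarrow> 'r \<times> ('g \<Rightarrow> ('a, 'd) tree_label) \<Rightarrow>
    ('g \<Rightarrow> ('a, 'd) tree_label) \<times> 'g \<times> 'r tree_state" where
  "at_in v q = (\<lambda>(r, y). (y, v, q r))"

definition is_child :: "('g \<Rightarrow> ('a, 'd) tree_label) \<Rightarrow> 'g \<Rightarrow> nat \<Rightarrow> bool" where
  "is_child y v k \<longleftrightarrow> (\<exists>i d. y (v \<otimes> s k) = Node i (Some k) d)"

lemma tmoveI: "q \<noteq> Stop \<Longrightarrow> tdelta (y h) q = (l, q', x) \<Longrightarrow> tmove (y, h, q) (y(h := l), h \<otimes> x, q')"
  by (simp add: move_def walk_step_def)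

lemma tmove_read: "q \<noteq> Stop \<Longrightarrow> tdelta (y h) q = (y h, q', x) \<Longrightarrow> tmove (y, h, q) (y, h \<otimes> x, q')"
  using tmoveI[of q y h "y h"] by simp

lemma moves_visit:
  assumes v: "v \<in> carrier G" and k: "k \<le> m"
  shows "tmove\<^sup>*\<^sup>* (at_in v (Visit k) z) (at_in v (Visit m) (fold (work v) [k..<m] z))"
  using k
proof (induction arbitrary: z rule: inc_induct)
  case (step k)
  obtain r y where z: "z = (r, y)" by fastforce
  obtain r' l where t: "touch k r (y (v \<otimes> s k)) = (r', l)" by fastforce
  have "tmove (y, v, Visit k r) (y, v \<otimes> s k, Work k r)"
    using tmoveI[of "Visit k r" y v] step.hyps by simp
  moreover have "tmove (y, v \<otimes> s k, Work k r) (y(v \<otimes> s k := l), v, Visit (Suc k) r')"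
    using tmoveI[of "Work k r" y "v \<otimes> s k"] t v step.hyps by simp
  moreover have "[k..<m] = k # [Suc k..<m]" using step.hyps by (simp add: upt_conv_Cons)
  ultimately show ?case using step.IH[of "(r', y(v \<otimes> s k := l))"]
    by (simp add: at_in_def z work_def t converse_rtranclp_into_rtranclp)
qed simp

lemma touch_node: "\<exists>d'. snd (touch k r (Node i p d)) = Node i p d'"
  by (auto split: prod.splits)

lemma work_node:
  assumes "snd z u = Node i p d" shows "\<exists>d'. snd (work v k z) u = Node i p d'"
proof (cases "u = v \<otimes> s k")
  case True
  then show ?thesis using assms touch_node[of k "fst z" i p d] by (auto simp: work_def split: prod.splits)
qed (use assms in \<open>auto simp: work_def split: prod.splits\<close>)

lemma fold_work_node: "\<exists>d. snd z u = Node i p d \<Longrightarrow> \<exists>d'. snd (fold (work v) ks z) u = Node i p d'"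
proof (induction ks arbitrary: z)
  case (Cons k ks)
  then have "\<exists>d. snd (work v k z) u = Node i p d" using work_node by blast
  from Cons.IH[OF this] show ?case by simp
qed simp

lemma fold_visit_node: "\<exists>d. snd z u = Node i p d \<Longrightarrow> \<exists>d'. snd (fold visit vs z) u = Node i p d'"
proof (induction vs arbitrary: z)
  case (Cons v vs)
  then have "\<exists>d. snd (visit v z) u = Node i p d" unfolding visit_def using fold_work_node by blast
  from Cons.IH[OF this] show ?case by simp
qed simp

text \<open>A neighbour adopted while \<open>v\<close> is visited becomes a child of \<open>v\<close> only. The search for
children of elements that are still to be visited is not affected by it.\<close>

lemma work_is_child:
  assumes "v \<in> carrier G" "w \<in> carrier G" "w \<noteq> v" "j < m" "k < m"
  shows "is_child (snd (work v k z)) w j \<longleftrightarrow> is_child (snd z) w j"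
proof (cases "w \<otimes> s j = v \<otimes> s k")
  case True
  then have jk: "j \<noteq> k" using assms by auto
  obtain r y where z: "z = (r, y)" by fastforce
  show ?thesis
  proof (cases "y (v \<otimes> s k)")
    case (Raw i)
    then show ?thesis using True jk by (auto simp: is_child_def work_def z split: prod.splits option.splits)
  next
    case (Node i p d)
    obtain d' where "snd (work v k z) (v \<otimes> s k) = Node i p d'" using work_node[of z "v \<otimes> s k" i p d v k] Node z by auto
    then show ?thesis using True Node by (simp add: is_child_def z)
  qed
next
  case False
  then show ?thesis by (auto simp: is_child_def work_def split: prod.splits)
qed

lemma visit_is_child:
  assumes "v \<in> carrier G" "w \<in> carrier G" "w \<noteq> v" "j < m"
  shows "is_child (snd (visit v z)) w j \<longleftrightarrow> is_child (snd z) w j"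
proof -
  have "is_child (snd (fold (work v) ks z)) w j \<longleftrightarrow> is_child (snd z) w j" if "set ks \<subseteq> {..<m}" for ks
    using that
  proof (induction ks arbitrary: z)
    case (Cons k ks)
    then show ?case using work_is_child[OF assms, of k z] by simp
  qed simp
  then show ?thesis unfolding visit_def by (simp add: subset_iff)
qed

lemma fold_visit_is_child:
  assumes "w \<in> carrier G" "w \<notin> set vs" "set vs \<subseteq> carrier G" "j < m"
  shows "is_child (snd (fold visit vs z)) w j \<longleftrightarrow> is_child (snd z) w j"
  using assms(2,3)
proof (induction vs arbitrary: z)
  case (Cons v vs)
  then show ?case using visit_is_child[of v w j z] assms(1,4) by auto
qed simp

context
  fixes n :: nat and par :: "'g \<Rightarrow> nat option"
  assumes sp: "spanning n par"
begin

definition tree_at :: "('g \<Rightarrow> ('a, 'd) tree_label) \<Rightarrow> 'g \<Rightarrow> bool" where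
  "tree_at y v \<longleftrightarrow> (\<forall>k<m. is_child y v k \<longleftrightarrow> child n par v k)"

lemma tree_at_fold:
  assumes "tree_at (snd z) w" "w \<in> carrier G" "w \<notin> set vs" "set vs \<subseteq> carrier G"
  shows "tree_at (snd (fold visit vs z)) w"
  using assms fold_visit_is_child[OF assms(2-4)] by (simp add: tree_at_def)

text \<open>The traversal of the children of \<open>v\<close>, given that the subtree of each child is traversed
correctly. An element that has not been visited still has the children which the tree prescribes.\<close>

lemma moves_children:
  assumes v: "v \<in> carrier G"
    and A: "\<And>k z. child n par v k \<Longrightarrow> \<forall>w\<in>set (f k). tree_at (snd z) w \<Longrightarrow>
      tmove\<^sup>*\<^sup>* (at_in (v \<otimes> s k) (Try 0) z) (at_in (v \<otimes> s k) (Visit m) (fold visit (f k) z))"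
    and B: "\<And>k. \<not> child n par v k \<Longrightarrow> f k = []"
    and C: "\<And>k k' w. w \<in> set (f k) \<Longrightarrow> w \<in> set (f k') \<Longrightarrow> k = k'"
    and D: "\<And>k. v \<notin> set (f k)" and E: "\<And>k. set (f k) \<subseteq> carrier G"
    and k: "k \<le> m"
  shows "tree_at (snd z) v \<Longrightarrow> (\<forall>j<m. k \<le> j \<longrightarrow> (\<forall>w\<in>set (f j). tree_at (snd z) w)) \<Longrightarrow>
    tmove\<^sup>*\<^sup>* (at_in v (Try k) z) (at_in v (Try m) (fold visit (concat (map f [k..<m])) z))"
  using k
proof (induction arbitrary: z rule: inc_induct)
  case (step k)
  obtain r y where z: "z = (r, y)" by fastforce
  have km: "k < m" using step.hyps by simp
  have upt: "[k..<m] = k # [Suc k..<m]" using km by (simp add: upt_conv_Cons)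
  have 1: "tmove (at_in v (Try k) z) (y, v \<otimes> s k, Probe k r)"
    using tmoveI[of "Try k r" y v] km by (simp add: z at_in_def)
  have ic: "is_child y v k \<longleftrightarrow> child n par v k" using step.prems(1) km by (simp add: tree_at_def z)
  show ?case
  proof (cases "child n par v k")
    case True
    then obtain i d where yk: "y (v \<otimes> s k) = Node i (Some k) d" using ic by (auto simp: is_child_def)
    have 2: "tmove (y, v \<otimes> s k, Probe k r) (at_in (v \<otimes> s k) (Try 0) z)"
      using tmove_read[of "Probe k r" y "v \<otimes> s k"] yk km v by (simp add: z at_in_def)
    have 3: "tmove\<^sup>*\<^sup>* (at_in (v \<otimes> s k) (Try 0) z) (at_in (v \<otimes> s k) (Visit m) (fold visit (f k) z))"
      by (rule A[OF True]) (use step.prems(2) km in simp)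
    define z1 where "z1 = fold visit (f k) z"
    obtain r1 y1 where z1: "z1 = (r1, y1)" by fastforce
    obtain d' where y1k: "y1 (v \<otimes> s k) = Node i (Some k) d'"
      using fold_visit_node[of z "v \<otimes> s k" i "Some k" "f k"] yk z z1 z1_def by auto
    have 4: "tmove (at_in (v \<otimes> s k) (Visit m) z1) (at_in v (Try (Suc k)) z1)"
      using tmove_read[of "Visit m r1" y1 "v \<otimes> s k"] y1k km v by (simp add: z1 at_in_def)
    have 5: "tree_at (snd z1) v" unfolding z1_def by (rule tree_at_fold[OF step.prems(1) v D E])
    have 6: "tree_at (snd z1) w" if "j < m" "Suc k \<le> j" "w \<in> set (f j)" for j w
      unfolding z1_def
    proof (rule tree_at_fold[OF _ _ _ E])
      show "tree_at (snd z) w" using step.prems(2) that by simp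
      show "w \<in> carrier G" using E that(3) by blast
      show "w \<notin> set (f k)" using C[of w k j] that by auto
    qed
    have 7: "tmove\<^sup>*\<^sup>* (at_in v (Try (Suc k)) z1) (at_in v (Try m) (fold visit (concat (map f [Suc k..<m])) z1))"
      using step.IH[of z1] 5 6 by blast
    from 1 2 3 4 7 have "tmove\<^sup>*\<^sup>* (at_in v (Try k) z) (at_in v (Try m) (fold visit (concat (map f [Suc k..<m])) z1))"
      unfolding z1_def by (meson converse_rtranclp_into_rtranclp rtranclp_trans)
    then show ?thesis unfolding upt z1_def by simp
  next
    case False
    then have "\<nexists>i d. y (v \<otimes> s k) = Node i (Some k) d" using ic by (simp add: is_child_def)
    then have 2: "tmove (y, v \<otimes> s k, Probe k r) (at_in v (Try (Suc k)) z)"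
      using tmove_read[of "Probe k r" y "v \<otimes> s k"] km v by (simp add: z at_in_def)
    have "tmove\<^sup>*\<^sup>* (at_in v (Try (Suc k)) z) (at_in v (Try m) (fold visit (concat (map f [Suc k..<m])) z))"
      using step.IH[of z] step.prems by simp
    then show ?thesis using 1 2 B[OF False] unfolding upt by (simp add: converse_rtranclp_into_rtranclp)
  qed
qed simp

lemma moves_visit_try:
  assumes "v \<in> carrier G"
  shows "tmove\<^sup>*\<^sup>* (at_in v (Try m) z) (at_in v (Visit m) (visit v z))"
proof -
  obtain r y where z: "z = (r, y)" by fastforce
  have "tmove (at_in v (Try m) z) (at_in v (Visit 0) z)"
    using tmoveI[of "Try m r" y v] assms by (simp add: z at_in_def)
  then show ?thesis using moves_visit[OF assms, of 0 z] unfolding visit_def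
    by (simp add: converse_rtranclp_into_rtranclp)
qed

lemma moves_subtree:
  "v \<in> ball n \<Longrightarrow> len v + d = n \<Longrightarrow> \<forall>w\<in>set (order n par d v). tree_at (snd z) w \<Longrightarrow>
   tmove\<^sup>*\<^sup>* (at_in v (Try 0) z) (at_in v (Visit m) (fold visit (order n par d v) z))"
proof (induction d arbitrary: v z)
  case 0
  have no: "\<not> child n par v k" for k
  proof
    assume c: "child n par v k"
    then have "v \<otimes> s k \<in> ball n" by (simp add: child_def)
    then have "len (v \<otimes> s k) \<le> n" using in_ball_iff[OF ball_closed, of "v \<otimes> s k" n n] by simp
    then show False using child_len[OF sp _ c] 0 by simp
  qed
  have "tmove\<^sup>*\<^sup>* (at_in v (Try 0) z) (at_in v (Try m) (fold visit (concat (map (\<lambda>_. []) [0..<m])) z))"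
    by (rule moves_children[where f="\<lambda>_. []"]) (use 0 no in simp_all)
  moreover have "concat (map (\<lambda>_. []) [0..<m]) = ([] :: 'g list)" by simp
  ultimately show ?case using moves_visit_try[of v z] 0(1) by simp
next
  case (Suc d)
  let ?f = "\<lambda>k. if child n par v k then order n par d (v \<otimes> s k) else []"
  have "tmove\<^sup>*\<^sup>* (at_in v (Try 0) z) (at_in v (Try m) (fold visit (concat (map ?f [0..<m])) z))"
  proof (rule moves_children[where f="?f"])
    fix k and z :: "'r \<times> ('g \<Rightarrow> ('a, 'd) tree_label)"
    assume c: "child n par v k" and w: "\<forall>w\<in>set (?f k). tree_at (snd z) w"
    have "len (v \<otimes> s k) + d = n" using child_len[OF sp _ c] Suc.prems by simp
    then show "tmove\<^sup>*\<^sup>* (at_in (v \<otimes> s k) (Try 0) z) (at_in (v \<otimes> s k) (Visit m) (fold visit (?f k) z))"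
      using Suc.IH[of "v \<otimes> s k" z] c w by (simp add: child_def)
  next
    fix k k' w assume "w \<in> set (?f k)" "w \<in> set (?f k')"
    then have "child n par v k \<and> w \<in> set (order n par d (v \<otimes> s k))"
      and "child n par v k' \<and> w \<in> set (order n par d (v \<otimes> s k'))"
      by (simp_all split: if_splits)
    then show "k = k'" using order_disjoint[OF sp Suc.prems(1), of k k' w d] by blast
  next
    fix k show "v \<notin> set (?f k)" using order_not_root[OF sp Suc.prems(1), of k d] by simp
  next
    fix k
    have "w \<in> carrier G" if c: "child n par v k" and w: "w \<in> set (order n par d (v \<otimes> s k))" for w
    proof -
      have "v \<otimes> s k \<in> ball n" using c by (simp add: child_def)
      from order_ancestor[OF sp this w] show ?thesis using ball_closed[of w n] by blast
    qed
    then show "set (?f k) \<subseteq> carrier G" by auto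
  next
    show "\<forall>j<m. 0 \<le> j \<longrightarrow> (\<forall>w\<in>set (?f j). tree_at (snd z) w)"
    proof (intro allI impI ballI)
      fix j w assume "w \<in> set (?f j)"
      then have "child n par v j \<and> w \<in> set (order n par d (v \<otimes> s j))" by (simp split: if_splits)
      then have "w \<in> set (order n par (Suc d) v)" unfolding in_order_Suc by blast
      then show "tree_at (snd z) w" using Suc.prems(3) by blast
    qed
  next
    show "tree_at (snd z) v" using Suc.prems(3) by simp
    show "v \<in> carrier G" using Suc.prems(1) by simp
  qed simp_all
  moreover have "tmove\<^sup>*\<^sup>* (at_in v (Try m) (fold visit (concat (map ?f [0..<m])) z))
      (at_in v (Visit m) (fold visit (order n par (Suc d) v) z))"
    using moves_visit_try[OF ball_closed[OF Suc.prems(1)], of "fold visit (concat (map ?f [0..<m])) z"] by simp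
  ultimately show ?case by (rule rtranclp_trans)
qed

text \<open>A sweep visits the elements of the ball in postorder. The order is fixed by the tree at the beginning
of the sweep: new leaves are attached when their parent is left for good, so the traversal never enters
them.\<close>

lemma moves_sweep:
  assumes nodes: "\<And>v. v \<in> ball n \<Longrightarrow> \<exists>i d. y v = Node i (par v) d"
    and raws: "\<And>v. v \<in> carrier G \<Longrightarrow> v \<notin> ball n \<Longrightarrow> \<exists>i. y v = Raw i"
    and z': "fold visit (order n par n \<one>) (r, y) = (r', y')"
  shows "tmove\<^sup>+\<^sup>+ (y, \<one>, Try 0 r) (y', \<one>, enter (eps r'))"
proof -
  have "tree_at y w" if w: "w \<in> ball n" for w
    unfolding tree_at_def
  proof (intro allI impI)
    fix k assume k: "k < m"
    show "is_child y w k \<longleftrightarrow> child n par w k"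
    proof (cases "w \<otimes> s k \<in> ball n")
      case True
      then show ?thesis using nodes[OF True] k by (auto simp: is_child_def child_def)
    next
      case False
      then show ?thesis using raws[of "w \<otimes> s k"] k w by (auto simp: is_child_def child_def)
    qed
  qed
  then have 1: "tmove\<^sup>*\<^sup>* (y, \<one>, Try 0 r) (y', \<one>, Visit m r')"
    using moves_subtree[of \<one> n "(r, y)"] z' set_order[OF sp] by (simp add: at_in_def)
  obtain i d where "y \<one> = Node i None d" using nodes[of \<one>] sp by (auto simp: spanning_def)
  then obtain d' where "y' \<one> = Node i None d'"
    using fold_visit_node[of "(r, y)" \<one> i None "order n par n \<one>"] z' by auto
  then have "tmove (y', \<one>, Visit m r') (y', \<one>, enter (eps r'))"
    using tmove_read[of "Visit m r'" y' \<one>] by simp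
  with 1 show ?thesis by (rule rtranclp_into_tranclp1)
qed

end

text \<open>States that leave alone all neighbours of the visited element other than this element itself.\<close>

definition quiet :: "'r \<Rightarrow> bool" where
  "quiet r \<longleftrightarrow> (\<forall>k i b d. 0 < k \<longrightarrow> upd r k i b d = (r, d)) \<and> (\<forall>k. new r k = (r, None))"

lemma visit_split: "visit v z = fold (work v) [1..<m] (work v 0 z)"
  using m_pos unfolding visit_def by (simp add: upt_conv_Cons)

lemma work_zero:
  assumes "v \<in> carrier G" "y v = Node i p d" "upd r 0 i (p = None) d = (r', d')"
  shows "work v 0 (r, y) = (r', y(v := Node i p d'))"
  using assms by (simp add: work_def s_zero)

lemma fold_work_quiet:
  assumes "quiet r" "0 \<notin> set ks" shows "fold (work v) ks (r, y) = (r, y)"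
  using assms(2)
proof (induction ks)
  case (Cons k ks)
  have "touch k r l = (r, l)" for l
    using assms(1) Cons.prems by (cases l) (auto simp: quiet_def)
  then have "work v k (r, y) = (r, y)" by (simp add: work_def)
  then show ?case using Cons by simp
qed simp

lemma visit_quiet:
  assumes "v \<in> carrier G" "y v = Node i p d" "upd r 0 i (p = None) d = (r', d')" "quiet r'"
  shows "visit v (r, y) = (r', y(v := Node i p d'))"
  unfolding visit_split work_zero[where y=y, OF assms(1-3)] by (rule fold_work_quiet[OF assms(4)]) simp

text \<open>The ball as a tape: cell \<open>i\<close> of the tape is the \<open>i\<close>-th element of the ball in
postorder.\<close>

definition stores :: "('g \<rightharpoonup> 'a) \<Rightarrow> nat \<Rightarrow> ('g \<Rightarrow> nat option) \<Rightarrow> (nat \<Rightarrow> 'd) \<Rightarrow> ('g \<Rightarrow> ('a, 'd) tree_label) \<Rightarrow> bool" where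
  "stores p n par E y \<longleftrightarrow>
     (\<forall>i<card (ball n). y (order n par n \<one> ! i) = Node (p (order n par n \<one> ! i)) (par (order n par n \<one> ! i)) (E i)) \<and>
     (\<forall>v. v \<notin> ball n \<longrightarrow> y v = Raw (p v))"

lemma fold_invariant:
  assumes "P 0 z" and "\<And>i z. i < length xs \<Longrightarrow> P i z \<Longrightarrow> P (Suc i) (f (xs ! i) z)"
  shows "P (length xs) (fold f xs z)"
  using assms
proof (induction xs arbitrary: P z)
  case (Cons x xs)
  have "P (Suc (length xs)) (fold f xs (f x z))"
    by (rule Cons.IH[of "\<lambda>i. P (Suc i)"]) (use Cons.prems(1) Cons.prems(2)[of 0] Cons.prems(2)[of "Suc _"] in auto)
  then show ?case by simp
qed simp

lemma length_order: "spanning n par \<Longrightarrow> length (order n par n \<one>) = card (ball n)"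
  using distinct_card[OF distinct_order[OF _ one_in_ball]] set_order by metis

lemma order_nth_in_ball: "spanning n par \<Longrightarrow> i < card (ball n) \<Longrightarrow> order n par n \<one> ! i \<in> ball n"
  using length_order set_order nth_mem by metis

lemma par_None_iff: "spanning n par \<Longrightarrow> v \<in> ball n \<Longrightarrow> par v = None \<longleftrightarrow> v = \<one>"
  by (auto simp: spanning_def)

lemma stores_tree:
  assumes "spanning n par" "stores p n par E y"
  shows "v \<in> ball n \<Longrightarrow> \<exists>i d. y v = Node i (par v) d" and "v \<in> carrier G \<Longrightarrow> v \<notin> ball n \<Longrightarrow> \<exists>i. y v = Raw i"
proof -
  assume "v \<in> ball n"
  then obtain i where "i < card (ball n)" "v = order n par n \<one> ! i"
    using set_order[OF assms(1)] length_order[OF assms(1)] by (metis in_set_conv_nth)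
  then show "\<exists>i d. y v = Node i (par v) d" using assms(2) by (auto simp: stores_def)
qed (use assms in \<open>auto simp: stores_def\<close>)

lemma moves_sweep_invariant:
  assumes sp: "spanning n par" and st: "stores p n par (E 0) y"
    and step: "\<And>i y. i < card (ball n) \<Longrightarrow> stores p n par (E i) y \<Longrightarrow>
      \<exists>y'. visit (order n par n \<one> ! i) (\<rho> i, y) = (\<rho> (Suc i), y') \<and> stores p n par (E (Suc i)) y'"
  shows "\<exists>y'. tmove\<^sup>+\<^sup>+ (y, \<one>, Try 0 (\<rho> 0)) (y', \<one>, enter (eps (\<rho> (card (ball n))))) \<and>
    stores p n par (E (card (ball n))) y'"
proof -
  let ?o = "order n par n \<one>"
  have "(\<lambda>i z. fst z = \<rho> i \<and> stores p n par (E i) (snd z)) (length ?o) (fold visit ?o (\<rho> 0, y))"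
  proof (rule fold_invariant)
    fix i and z :: "'r \<times> ('g \<Rightarrow> ('a, 'd) tree_label)"
    assume "i < length ?o" "fst z = \<rho> i \<and> stores p n par (E i) (snd z)"
    then show "fst (visit (?o ! i) z) = \<rho> (Suc i) \<and> stores p n par (E (Suc i)) (snd (visit (?o ! i) z))"
      using step[of i "snd z"] length_order[OF sp] by (metis prod.collapse fst_conv snd_conv)
  qed (use st in simp)
  then obtain y' where y': "fold visit ?o (\<rho> 0, y) = (\<rho> (card (ball n)), y')" "stores p n par (E (card (ball n))) y'"
    unfolding length_order[OF sp] by (metis prod.collapse)
  from moves_sweep[OF sp stores_tree[OF sp st] y'(1)] show ?thesis using y'(2) by blast
qed

lemma stores_upd:
  assumes sp: "spanning n par" and st: "stores p n par E y" and i: "i < card (ball n)"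
  shows "stores p n par (E(i := d)) (y(order n par n \<one> ! i := Node (p (order n par n \<one> ! i)) (par (order n par n \<one> ! i)) d))"
  unfolding stores_def
proof (intro conjI allI impI)
  fix j assume j: "j < card (ball n)"
  have "order n par n \<one> ! j = order n par n \<one> ! i \<longleftrightarrow> j = i"
    using nth_eq_iff_index_eq[OF distinct_order[OF sp one_in_ball]] length_order[OF sp] i j by simp
  then show "(y(order n par n \<one> ! i := Node (p (order n par n \<one> ! i)) (par (order n par n \<one> ! i)) d)) (order n par n \<one> ! j) =
    Node (p (order n par n \<one> ! j)) (par (order n par n \<one> ! j)) ((E(i := d)) j)"
    using st j by (auto simp: stores_def)
next
  fix v assume "v \<notin> ball n"
  then show "(y(order n par n \<one> ! i := Node (p (order n par n \<one> ! i)) (par (order n par n \<one> ! i)) d)) v = Raw (p v)"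
    using st order_nth_in_ball[OF sp i] by (auto simp: stores_def)
qed

lemma visit_quiet_stores:
  assumes sp: "spanning n par" and st: "stores p n par E y" and i: "i < card (ball n)"
    and u: "upd r 0 (p (order n par n \<one> ! i)) (order n par n \<one> ! i = \<one>) (E i) = (r', d')" and q: "quiet r'"
  shows "\<exists>y'. visit (order n par n \<one> ! i) (r, y) = (r', y') \<and> stores p n par (E(i := d')) y'"
proof -
  let ?v = "order n par n \<one> ! i"
  have v: "?v \<in> ball n" using order_nth_in_ball[OF sp i] .
  have yv: "y ?v = Node (p ?v) (par ?v) (E i)" using st i by (simp add: stores_def)
  have "upd r 0 (p ?v) (par ?v = None) (E i) = (r', d')" using u par_None_iff[OF sp v] by simp
  from visit_quiet[where y=y, OF ball_closed[OF v] yv this q] stores_upd[OF sp st i, of d'] show ?thesis by blast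
qed

text \<open>A sweep in quiet states is a pass of a finite transducer over the tape, described by its state
\<open>\<rho> i\<close> in front of cell \<open>i\<close> and the new content \<open>E' i\<close> of that cell.\<close>

lemma moves_local_sweep:
  assumes sp: "spanning n par" and st: "stores p n par E y"
    and step: "\<And>i. i < card (ball n) \<Longrightarrow>
      upd (\<rho> i) 0 (p (order n par n \<one> ! i)) (order n par n \<one> ! i = \<one>) (E i) = (\<rho> (Suc i), E' i)"
    and quiet: "\<And>i. quiet (\<rho> i)"
  shows "\<exists>y'. tmove\<^sup>+\<^sup>+ (y, \<one>, Try 0 (\<rho> 0)) (y', \<one>, enter (eps (\<rho> (card (ball n))))) \<and> stores p n par E' y'"
proof -
  define F where "F i j = (if j < i then E' j else E j)" for i j
  have F0: "F 0 = E" by (simp add: F_def fun_eq_iff)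
  have Fi: "F i i = E i" for i by (simp add: F_def)
  have FS: "(F i)(i := E' i) = F (Suc i)" for i by (auto simp: F_def fun_eq_iff)
  have "\<exists>y'. tmove\<^sup>+\<^sup>+ (y, \<one>, Try 0 (\<rho> 0)) (y', \<one>, enter (eps (\<rho> (card (ball n))))) \<and>
     stores p n par (F (card (ball n))) y'"
  proof (rule moves_sweep_invariant[OF sp, where E=F and \<rho>=\<rho>])
    fix i y assume i: "i < card (ball n)" and st: "stores p n par (F i) y"
    show "\<exists>y'. visit (order n par n \<one> ! i) (\<rho> i, y) = (\<rho> (Suc i), y') \<and> stores p n par (F (Suc i)) y'"
      using visit_quiet_stores[OF sp st i, unfolded Fi, OF step[OF i] quiet] unfolding FS .
  qed (simp add: F0 st)
  moreover have "stores p n par (F (card (ball n))) y' \<Longrightarrow> stores p n par E' y'" for y'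
    by (simp add: stores_def F_def)
  ultimately show ?thesis by blast
qed

lemma ex_G_machine:
  assumes A: "finite A" and R: "finite R" "r0 \<in> R" and D: "finite D" "d0 \<in> D"
    and upd: "\<And>r k i b d. r \<in> R \<Longrightarrow> k < m \<Longrightarrow> i \<in> insert None (Some ` A) \<Longrightarrow> d \<in> D \<Longrightarrow> upd r k i b d \<in> R \<times> D"
    and new: "\<And>r k. r \<in> R \<Longrightarrow> k < m \<Longrightarrow> new r k \<in> R \<times> insert None (Some ` D)"
    and eps: "\<And>r. r \<in> R \<Longrightarrow> eps r \<in> R"
  shows "\<exists>M :: ('g, 'a tape_symbol) G_machine. is_G_machine S M \<and> gm_blank M = Blank \<and>
     Letter ` A \<subseteq> gm_symbols M \<and> (\<forall>p\<in>patterns G A. gm_accepts G M (map_option Letter \<circ> p) \<longleftrightarrow>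
       accepts tstep (\<lambda>(_, _, q). q = Stop) (\<lambda>g. Raw (p g), \<one>, Start))"
proof -
  define \<Lambda> where "\<Lambda> = {l. case l of Raw i \<Rightarrow> i \<in> insert None (Some ` A)
    | Node i p d \<Rightarrow> i \<in> insert None (Some ` A) \<and> p \<in> insert None (Some ` {..<m}) \<and> d \<in> D}"
  define Q where "Q = {q. case q of Try k r \<Rightarrow> k \<le> m \<and> r \<in> R | Probe k r \<Rightarrow> k < m \<and> r \<in> R
    | Visit k r \<Rightarrow> k \<le> m \<and> r \<in> R | Work k r \<Rightarrow> k < m \<and> r \<in> R | _ \<Rightarrow> True}"
  let ?I = "insert None (Some ` A)" and ?J = "insert None (Some ` {..<m})"
  have "\<Lambda> \<subseteq> Raw ` ?I \<union> (\<Union>i\<in>?I. \<Union>p\<in>?J. Node i p ` D)"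
  proof
    fix l assume l: "l \<in> \<Lambda>"
    show "l \<in> Raw ` ?I \<union> (\<Union>i\<in>?I. \<Union>p\<in>?J. Node i p ` D)"
    proof (cases l)
      case (Raw i)
      then have "i \<in> ?I" using l by (simp add: \<Lambda>_def)
      then show ?thesis using Raw by blast
    next
      case (Node i p d)
      then have "i \<in> ?I" "p \<in> ?J" "d \<in> D" using l by (simp_all add: \<Lambda>_def)
      then show ?thesis using Node by blast
    qed
  qed
  then have fL: "finite \<Lambda>" by (rule finite_subset) (use A D in auto)
  have "Q \<subseteq> {Start, Stop} \<union> (\<Union>k\<le>m. Try k ` R \<union> Probe k ` R \<union> Visit k ` R \<union> Work k ` R)"
  proof
    fix q assume "q \<in> Q"
    then show "q \<in> {Start, Stop} \<union> (\<Union>k\<le>m. Try k ` R \<union> Probe k ` R \<union> Visit k ` R \<union> Work k ` R)"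
      by (cases q) (fastforce simp: Q_def)+
  qed
  then have fQ: "finite Q" by (rule finite_subset) (use R in auto)
  have touch: "touch k r l \<in> R \<times> \<Lambda>" if "k < m" "r \<in> R" "l \<in> \<Lambda>" for k r l
  proof (cases l)
    case (Raw i)
    obtain r' d where n: "new r k = (r', d)" by fastforce
    then show ?thesis using new[OF that(2,1)] that Raw by (cases d) (auto simp: \<Lambda>_def)
  next
    case (Node i p d)
    obtain r' d' where n: "upd r k i (p = None) d = (r', d')" by fastforce
    then show ?thesis using upd[OF that(2,1), of i d "p = None"] that Node by (auto simp: \<Lambda>_def)
  qed
  have enter: "enter r \<in> Q" if "r \<in> R" for r using that by (simp add: enter_def Q_def)
  have "\<exists>M :: ('g, 'a tape_symbol) G_machine. is_G_machine S M \<and> gm_blank M = Blank \<and>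
     Letter ` A \<subseteq> gm_symbols M \<and> (\<forall>p\<in>patterns G A. gm_accepts G M (map_option Letter \<circ> p) \<longleftrightarrow>
       accepts tstep (\<lambda>(_, _, q). q = Stop) (\<lambda>g. case p g of None \<Rightarrow> Raw None | Some a \<Rightarrow> Raw (Some a), \<one>, Start))"
  proof (rule G_machine_of_abstract[where \<delta>=tdelta and acc="\<lambda>q. q = Stop" and qi=Start
        and b="Raw None" and \<iota>="\<lambda>a. Raw (Some a)", OF is_group S_carrier fL fQ])
    fix l q l' q' x assume l: "l \<in> \<Lambda>" and q: "q \<in> Q" and d: "tdelta l q = (l', q', x)"
    show "l' \<in> \<Lambda> \<and> q' \<in> Q \<and> x \<in> S"
    proof (cases q)
      case Start
      then show ?thesis using d l R D S_one by (cases l) (auto simp: \<Lambda>_def Q_def)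
    next
      case (Try k r)
      then show ?thesis using d l q S_one by (auto simp: Q_def split: if_splits)
    next
      case (Probe k r)
      then show ?thesis using d l q S_one S_inv by (auto simp: Q_def split: if_splits)
    next
      case (Visit k r)
      then have r: "r \<in> R" "k \<le> m" using q by (auto simp: Q_def)
      show ?thesis
      proof (cases "k < m")
        case True then show ?thesis using Visit d l r by (auto simp: Q_def)
      next
        case False
        then have d': "(case l of Node i (Some j) d \<Rightarrow> (l, Try (Suc j) r, inv (s j)) | _ \<Rightarrow> (l, enter (eps r), \<one>)) = (l', q', x)"
          using d Visit by simp
        have e: "enter (eps r) \<in> Q" using enter eps r by simp
        show ?thesis
        proof (cases "\<exists>i j d. l = Node i (Some j) d")
          case True
          then obtain i j d where "l = Node i (Some j) d" by blast
          then show ?thesis using d' l r S_inv by (auto simp: Q_def \<Lambda>_def)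
        next
          case False
          then have "l' = l \<and> q' = enter (eps r) \<and> x = \<one>"
            using d' by (cases l) (simp_all split: option.splits)
          then show ?thesis using e l S_one by simp
        qed
      qed
    next
      case (Work k r)
      then have r: "r \<in> R" "k < m" using q by (auto simp: Q_def)
      obtain r1 l1 where t: "touch k r l = (r1, l1)" by fastforce
      have "r1 \<in> R" "l1 \<in> \<Lambda>" using touch[OF r(2,1) l] t by simp_all
      moreover have "l' = l1" "q' = Visit (Suc k) r1" "x = inv (s k)" using d t Work by simp_all
      ultimately show ?thesis using r S_inv[OF s_in[OF r(2)]] by (simp add: Q_def)
    next
      case Stop
      then show ?thesis using d l q S_one by simp
    qed
  next
    show "(\<lambda>a. Raw (Some a)) ` A \<subseteq> \<Lambda>" "Raw None \<in> \<Lambda>" "Start \<in> Q" by (auto simp: \<Lambda>_def Q_def)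
    show "inj_on (\<lambda>a. Raw (Some a)) A" by (simp add: inj_on_def)
    show "Raw None \<notin> (\<lambda>a. Raw (Some a)) ` A" by auto
  qed
  moreover have "(case x of None \<Rightarrow> Raw None | Some a \<Rightarrow> Raw (Some a)) = (Raw x :: ('a, 'd) tree_label)" for x :: "'a option"
    by (cases x) simp_all
  ultimately show ?thesis by simp
qed

end

section \<open>Bounded searches for an accepted listing\<close>

text \<open>The phases of a trial: comparing the candidate with the pattern, moving the head back to the left end,
and simulating the oracle machine.\<close>

datatype control = Scan | Rewind | Sim nat

datatype 'g walk = Rest | Home | Along 'g

locale enumerator = fg_gens G S s m
  for G :: "('g, 'm) monoid_scheme" (structure) and S s m +
  fixes M :: "('g + 'a, 'g) oracle_tm" and A :: "'a set" and letter :: "nat \<Rightarrow> 'g + 'a" and b :: nat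
  assumes finite_A: "finite A" and M: "is_oracle_tm (S <+> A) S M"
    and letter_inj: "inj_on letter {..<b}" and letter_range: "letter ` {..<b} = S <+> A"
begin

abbreviation "\<I> \<equiv> S <+> A"
abbreviation "cells n \<equiv> card (ball n)"

text \<open>One step of a trial. Besides the tape symbol, it depends on what the walker observes: whether
it is at the identity, and the letter of the pattern at its position.\<close>

fun vm :: "control \<Rightarrow> ('g + 'a) tape_symbol \<Rightarrow> bool \<Rightarrow> 'a option \<Rightarrow>
    (control \<times> ('g + 'a) tape_symbol \<times> head_move \<times> 'g walk) option" where
  "vm Scan x home i = (case x of
       Letter (Inl g) \<Rightarrow> Some (Scan, x, Go_Right, Along g)
     | Letter (Inr a) \<Rightarrow> (if i = Some a then Some (Scan, x, Go_Right, Home) else None)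
     | _ \<Rightarrow> Some (Rewind, x, Go_Left, Home))"
| "vm Rewind x home i = (if x = Blank then Some (Sim (otm_init M), x, Go_Right, Home)
     else Some (Rewind, x, Go_Left, Rest))"
| "vm (Sim q) x home i = (if q = otm_query M
     then Some (Sim (if home then otm_yes M else otm_no M), x, Stay, Home)
     else (case otm_delta M (x, q) of (x', q', mv, e) \<Rightarrow>
       Some (Sim q', x', mv, (case e of None \<Rightarrow> Rest | Some g \<Rightarrow> Along g))))"

fun walked :: "'g \<Rightarrow> 'g walk \<Rightarrow> 'g" where
  "walked w Rest = w" | "walked w Home = \<one>" | "walked w (Along g) = w \<otimes> g"

fun final :: "control \<Rightarrow> bool" where
  "final (Sim q) \<longleftrightarrow> q \<in> otm_accepting M" | "final _ \<longleftrightarrow> False"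

type_synonym ('x, 'y) vconfig = "(control \<times> (int \<Rightarrow> ('x + 'y) tape_symbol) \<times> int \<times> 'x) option"

fun ustep :: "('g \<rightharpoonup> 'a) \<Rightarrow> ('g, 'a) vconfig \<Rightarrow> ('g, 'a) vconfig" where
  "ustep p None = None"
| "ustep p (Some (c, t, h, w)) = (case vm c (t h) (w = \<one>) (p w) of None \<Rightarrow> None
     | Some (c', x, mv, wa) \<Rightarrow> Some (c', t(h := x), h + head_shift mv, walked w wa))"

definition uacc :: "('g, 'a) vconfig \<Rightarrow> bool" where
  "uacc u \<longleftrightarrow> (case u of None \<Rightarrow> False | Some (c, _) \<Rightarrow> final c)"

definition ustart :: "('g + 'a) list \<Rightarrow> ('g, 'a) vconfig" where
  "ustart z = Some (Scan, tm_input Blank Letter z, 0, \<one>)"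

subsection \<open>The unbounded machine\<close>

text \<open>The walker follows each word of the listing from the identity and compares the letter it
finds with the listed one.\<close>

fun matches :: "('g \<rightharpoonup> 'a) \<Rightarrow> 'g \<Rightarrow> ('g + 'a) list \<Rightarrow> bool" where
  "matches p w [] \<longleftrightarrow> True"
| "matches p w (Inl g # z) \<longleftrightarrow> matches p (w \<otimes> g) z"
| "matches p w (Inr a # z) \<longleftrightarrow> p w = Some a \<and> matches p \<one> z"

abbreviation "umove p \<equiv> move (ustep p) uacc"

lemma input_at: "tm_input Blank Letter (z1 @ x # z2) (int (length z1)) = Letter x"
  by (simp add: tm_input_def)

lemma input_end: "tm_input Blank Letter z (int (length z)) = Blank" "tm_input Blank Letter z (-1) = Blank"
  by (simp_all add: tm_input_def)

lemma moves_scan: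
  "z = z1 @ z2 \<Longrightarrow> if matches p w z2
   then \<exists>w'. (umove p)\<^sup>*\<^sup>* (Some (Scan, tm_input Blank Letter z, int (length z1), w))
      (Some (Scan, tm_input Blank Letter z, int (length z), w'))
   else (umove p)\<^sup>*\<^sup>* (Some (Scan, tm_input Blank Letter z, int (length z1), w)) None"
proof (induction z2 arbitrary: z1 w)
  case Nil then show ?case by auto
next
  case (Cons x z2)
  let ?t = "tm_input Blank Letter z"
  have at: "?t (int (length z1)) = Letter x" using input_at Cons.prems by simp
  have upd: "?t(int (length z1) := Letter x) = ?t" using at by (simp add: fun_upd_idem)
  have z: "z = (z1 @ [x]) @ z2" using Cons.prems by simp
  show ?case
  proof (cases x)
    case (Inl g)
    have 1: "umove p (Some (Scan, ?t, int (length z1), w)) (Some (Scan, ?t, int (length (z1 @ [x])), w \<otimes> g))"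
      using at upd Inl by (simp add: move_def uacc_def add.commute)
    show ?thesis using Cons.IH[OF z, of "w \<otimes> g"] converse_rtranclp_into_rtranclp[where r="umove p", OF 1] Inl
      by (auto split: if_splits)
  next
    case (Inr a)
    show ?thesis
    proof (cases "p w = Some a")
      case True
      have 1: "umove p (Some (Scan, ?t, int (length z1), w)) (Some (Scan, ?t, int (length (z1 @ [x])), \<one>))"
        using at upd Inr True by (simp add: move_def uacc_def add.commute)
      show ?thesis using Cons.IH[OF z, of \<one>] converse_rtranclp_into_rtranclp[where r="umove p", OF 1] Inr True
        by (auto split: if_splits)
    next
      case False
      have "umove p (Some (Scan, ?t, int (length z1), w)) None"
        using at Inr False by (simp add: move_def uacc_def)
      then show ?thesis using False Inr by (simp add: r_into_rtranclp)
    qed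
  qed
qed

lemma moves_rewind:
  "z = z1 @ z2 \<Longrightarrow> (umove p)\<^sup>*\<^sup>* (Some (Rewind, tm_input Blank Letter z, int (length z1) - 1, w))
    (Some (Rewind, tm_input Blank Letter z, -1, w))"
proof (induction z1 arbitrary: z2 rule: rev_induct)
  case (snoc x z1)
  let ?t = "tm_input Blank Letter z"
  have at: "?t (int (length z1)) = Letter x" using input_at snoc.prems by simp
  have "?t(int (length z1) := Letter x) = ?t" using at by (simp add: fun_upd_idem)
  then have "umove p (Some (Rewind, ?t, int (length (z1 @ [x])) - 1, w)) (Some (Rewind, ?t, int (length z1) - 1, w))"
    using at by (simp add: move_def uacc_def)
  from converse_rtranclp_into_rtranclp[where r="umove p", OF this snoc.IH[of "x # z2"]] show ?case using snoc.prems by simp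
qed simp

lemma M_delta:
  assumes "otm_delta M (x, q) = (x', q', mv, e)" "x \<in> otm_symbols M" "q \<in> otm_states M"
  shows "x' \<in> otm_symbols M" "q' \<in> otm_states M" "\<And>g. e = Some g \<Longrightarrow> g \<in> S"
proof -
  have "otm_delta M \<in> otm_symbols M \<times> otm_states M \<rightarrow>
      otm_symbols M \<times> otm_states M \<times> UNIV \<times> insert None (Some ` S)"
    using M by (simp add: is_oracle_tm_def)
  from funcset_mem[OF this, of "(x, q)"]
  have "(x', q', mv, e) \<in> otm_symbols M \<times> otm_states M \<times> UNIV \<times> insert None (Some ` S)"
    using assms by simp
  then show "x' \<in> otm_symbols M" "q' \<in> otm_states M" "\<And>g. e = Some g \<Longrightarrow> g \<in> S" by auto
qed

lemma M_symbols: "Blank \<in> otm_symbols M" "x \<in> \<I> \<Longrightarrow> Letter x \<in> otm_symbols M"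
  and M_states: "otm_init M \<in> otm_states M" "otm_yes M \<in> otm_states M" "otm_no M \<in> otm_states M"
  using M by (auto simp: is_oracle_tm_def)

lemma input_symbols:
  assumes "z \<in> lists \<I>" shows "tm_input Blank Letter z i \<in> insert Blank (Letter ` \<I>)"
proof (cases "0 \<le> i \<and> i < int (length z)")
  case True
  then have "nat i < length z" by linarith
  then have "z ! nat i \<in> \<I>" using assms nth_mem[of "nat i" z] by (auto simp: lists_eq_set)
  then show ?thesis using True by (auto simp: tm_input_def)
qed (auto simp: tm_input_def)

lemma input_in_symbols:
  assumes "z \<in> lists \<I>" shows "tm_input Blank Letter z i \<in> otm_symbols M"
proof -
  from input_symbols[OF assms, of i] show ?thesis
  proof
    assume "tm_input Blank Letter z i \<in> Letter ` \<I>"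
    then obtain x where "x \<in> \<I>" "tm_input Blank Letter z i = Letter x" by blast
    then show ?thesis using M_symbols(2) by simp
  qed (simp add: M_symbols)
qed

lemma accepts_sim:
  assumes z: "z \<in> lists \<I>"
  shows "accepts (ustep p) uacc (Some (Sim (otm_init M), tm_input Blank Letter z, 0, \<one>)) \<longleftrightarrow>
    otm_accepts (word_problem G S) M z"
proof -
  have "accepts (ustep p) uacc (Some (Sim (otm_init M), tm_input Blank Letter z, 0, \<one>)) \<longleftrightarrow>
    accepts (otm_step (word_problem G S) M) (\<lambda>c. otm_state c \<in> otm_accepting M) (otm_start M z)"
  proof (rule accepts_lockstep[where R="\<lambda>u c. u = Some (Sim (otm_state c), otm_tape c, otm_head c, val (otm_query_word c)) \<and>
      otm_query_word c \<in> lists S \<and> otm_state c \<in> otm_states M \<and> (\<forall>i. otm_tape c i \<in> otm_symbols M)"])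
    have "tm_input Blank Letter z i \<in> otm_symbols M" for i
      by (rule input_in_symbols[OF z])
    then show "Some (Sim (otm_init M), tm_input Blank Letter z, 0, \<one>) =
        Some (Sim (otm_state (otm_start M z)), otm_tape (otm_start M z), otm_head (otm_start M z), val (otm_query_word (otm_start M z))) \<and>
      otm_query_word (otm_start M z) \<in> lists S \<and> otm_state (otm_start M z) \<in> otm_states M \<and>
      (\<forall>i. otm_tape (otm_start M z) i \<in> otm_symbols M)"
      using M_states by (simp add: otm_start_def tm_input_def)
  next
    fix u and c :: "('g + 'a, 'g) otm_config"
    assume R: "u = Some (Sim (otm_state c), otm_tape c, otm_head c, val (otm_query_word c)) \<and>
      otm_query_word c \<in> lists S \<and> otm_state c \<in> otm_states M \<and> (\<forall>i. otm_tape c i \<in> otm_symbols M)"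
    show "uacc u \<longleftrightarrow> otm_state c \<in> otm_accepting M" using R by (simp add: uacc_def)
    show "ustep p u = Some (Sim (otm_state (otm_step (word_problem G S) M c)), otm_tape (otm_step (word_problem G S) M c),
        otm_head (otm_step (word_problem G S) M c), val (otm_query_word (otm_step (word_problem G S) M c))) \<and>
      otm_query_word (otm_step (word_problem G S) M c) \<in> lists S \<and> otm_state (otm_step (word_problem G S) M c) \<in> otm_states M \<and>
      (\<forall>i. otm_tape (otm_step (word_problem G S) M c) i \<in> otm_symbols M)"
    proof (cases "otm_state c = otm_query M")
      case True
      then show ?thesis using R M_states by (simp add: otm_step_def word_problem_iff)
    next
      case False
      obtain x' q' mv e where d: "otm_delta M (otm_tape c (otm_head c), otm_state c) = (x', q', mv, e)"
        by (metis prod_cases4)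
      note cl = M_delta[OF d]
      show ?thesis
      proof (cases e)
        case None
        then show ?thesis using R False d cl(1,2) by (simp add: otm_step_def)
      next
        case (Some g)
        then have g: "g \<in> S" using cl(3) R by simp
        then have "val (otm_query_word c @ [g]) = val (otm_query_word c) \<otimes> g"
          using R val_append[of "otm_query_word c" "[g]"] by simp
        then show ?thesis using R False d cl(1,2) Some g by (simp add: otm_step_def)
      qed
    qed
  qed
  then show ?thesis by (simp add: otm_accepts_def accepts_def)
qed

text \<open>Without bounds on time and space, a trial succeeds if and only if the candidate matches
the pattern and the oracle machine accepts it.\<close>

lemma accepts_unbounded:
  assumes z: "z \<in> lists \<I>"
  shows "accepts (ustep p) uacc (ustart z) \<longleftrightarrow> matches p \<one> z \<and> otm_accepts (word_problem G S) M z"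
proof (cases "matches p \<one> z")
  case False
  then have "(umove p)\<^sup>*\<^sup>* (ustart z) None"
    using moves_scan[of z "[]" z p \<one>] by (simp add: ustart_def)
  then have "accepts (ustep p) uacc None \<longleftrightarrow> accepts (ustep p) uacc (ustart z)" by (rule accepts_moves)
  moreover have "\<not> accepts (ustep p) uacc None"
    by (rule accepts_invariant_False[where P="\<lambda>u. u = None"]) (simp_all add: uacc_def)
  ultimately show ?thesis using False by simp
next
  case True
  let ?t = "tm_input Blank Letter z"
  obtain w where 1: "(umove p)\<^sup>*\<^sup>* (ustart z) (Some (Scan, ?t, int (length z), w))"
    using moves_scan[of z "[]" z p \<one>] True by (auto simp: ustart_def)
  have idem: "?t(int (length z) := Blank) = ?t" "?t(-1 := Blank) = ?t" by (simp_all add: fun_upd_idem input_end)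
  have 2: "umove p (Some (Scan, ?t, int (length z), w)) (Some (Rewind, ?t, int (length z) - 1, \<one>))"
    by (simp add: move_def uacc_def idem input_end)
  have 3: "(umove p)\<^sup>*\<^sup>* (Some (Rewind, ?t, int (length z) - 1, \<one>)) (Some (Rewind, ?t, -1, \<one>))"
    using moves_rewind[of z z "[]"] by simp
  have 4: "umove p (Some (Rewind, ?t, -1, \<one>)) (Some (Sim (otm_init M), ?t, 0, \<one>))"
    by (simp add: move_def uacc_def idem input_end)
  have "(umove p)\<^sup>*\<^sup>* (ustart z) (Some (Sim (otm_init M), ?t, 0, \<one>))"
    using 1 2 3 4 by (meson rtranclp.rtrancl_into_rtrancl rtranclp_trans)
  from accepts_moves[OF this] show ?thesis using True accepts_sim[OF z] by simp
qed

text \<open>The walker has to be moved along generators only. This holds because the candidate consists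
of input letters as long as it is scanned, and because the oracle machine queries words over \<open>S\<close>.\<close>

fun uinv :: "('g, 'a) vconfig \<Rightarrow> bool" where
  "uinv None \<longleftrightarrow> True"
| "uinv (Some (c, t, h, w)) \<longleftrightarrow> w \<in> carrier G \<and> (\<forall>i. t i \<in> otm_symbols M) \<and>
     (case c of Scan \<Rightarrow> \<forall>i. t i \<in> insert Blank (Letter ` \<I>) | Rewind \<Rightarrow> True | Sim q \<Rightarrow> q \<in> otm_states M)"

lemma uinv_start: "z \<in> lists \<I> \<Longrightarrow> uinv (ustart z)"
proof -
  assume z: "z \<in> lists \<I>"
  have "tm_input Blank Letter z i \<in> otm_symbols M" for i
    by (rule input_in_symbols[OF z])
  then show ?thesis using input_symbols[OF z] by (simp add: ustart_def)
qed

lemma vm_along: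
  assumes "uinv (Some (c, t, h, w))" "vm c (t h) home i = Some (c', x, mv, Along g)"
  shows "g \<in> S"
proof (cases c)
  case Scan
  then have "t h \<in> insert Blank (Letter ` \<I>)" using assms(1) by simp
  then show ?thesis using assms(2) Scan by (auto split: if_splits)
next
  case Rewind
  then show ?thesis using assms(2) by (auto split: if_splits)
next
  case (Sim q)
  obtain x1 q1 mv1 e where d: "otm_delta M (t h, q) = (x1, q1, mv1, e)" by (metis prod_cases4)
  have q: "q \<in> otm_states M" "t h \<in> otm_symbols M" using assms(1) Sim by simp_all
  have "e = Some g" using assms(2) Sim d by (auto split: if_splits option.splits)
  then show ?thesis using M_delta(3)[OF d q(2,1)] by simp
qed

lemma uinv_step: "uinv u \<Longrightarrow> uinv (ustep p u)"
proof (cases u)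
  case (Some a)
  assume inv: "uinv u"
  obtain c t h w where a: "a = (c, t, h, w)" by (metis prod_cases4)
  show ?thesis
  proof (cases "vm c (t h) (w = \<one>) (p w)")
    case None then show ?thesis using Some a by simp
  next
    case (Some r)
    obtain c' x mv wa where r: "r = (c', x, mv, wa)" by (metis prod_cases4)
    have vm: "vm c (t h) (w = \<one>) (p w) = Some (c', x, mv, wa)" using Some r by simp
    have inv': "uinv (Some (c, t, h, w))" using inv \<open>u = Some a\<close> a by simp
    then have th: "t h \<in> otm_symbols M" and tt: "\<And>i. t i \<in> otm_symbols M" and w: "w \<in> carrier G" by simp_all
    have w': "walked w wa \<in> carrier G" using w vm_along[OF inv'] vm by (cases wa) auto
    have "x \<in> otm_symbols M \<and> (case c' of Scan \<Rightarrow> \<forall>i. (t(h := x)) i \<in> insert Blank (Letter ` \<I>) | Rewind \<Rightarrow> True | Sim q \<Rightarrow> q \<in> otm_states M)"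
    proof (cases c)
      case Scan
      then have "\<And>i. t i \<in> insert Blank (Letter ` \<I>)" using inv' by simp
      moreover have "x = t h" "c' = Scan \<or> c' = Rewind"
        using vm Scan by (auto split: tape_symbol.splits sum.splits if_splits)
      ultimately show ?thesis using th by auto
    next
      case Rewind
      then have "x = t h \<and> (c' = Rewind \<or> c' = Sim (otm_init M))" using vm by (auto split: if_splits)
      then show ?thesis using th M_states by auto
    next
      case (Sim q)
      then have q: "q \<in> otm_states M" using inv' by simp
      obtain x1 q1 mv1 e where d: "otm_delta M (t h, q) = (x1, q1, mv1, e)" by (metis prod_cases4)
      show ?thesis using vm Sim d M_delta(1,2)[OF d th q] th M_states
        by (cases "q = otm_query M") auto
    qed
    then show ?thesis using \<open>u = Some a\<close> a vm w' tt by simp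
  qed
qed simp

lemma uinv_funpow: "z \<in> lists \<I> \<Longrightarrow> uinv ((ustep p ^^ j) (ustart z))"
  by (induction j) (simp_all add: uinv_start uinv_step)

subsection \<open>Enumerating the candidate words\<close>

definition nxt :: "'g + 'a \<Rightarrow> ('g + 'a) option" where
  "nxt x = (let j = Suc (inv_into {..<b} letter x) in if j < b then Some (letter j) else None)"

text \<open>Counting in bijective base \<open>b\<close>, least significant digit first. Unlike ordinary
positional notation it has no digit zero, so that every word is the representation of exactly one number.\<close>

fun incr :: "('g + 'a) list \<Rightarrow> ('g + 'a) list" where
  "incr [] = [letter 0]"
| "incr (x # z) = (case nxt x of Some y \<Rightarrow> y # z | None \<Rightarrow> letter 0 # incr z)"

lemma b_pos: "0 < b"
proof (rule ccontr)
  assume "\<not> 0 < b"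
  then have "letter ` {..<b} = {}" by simp
  then have "S <+> A = {}" using letter_range by simp
  then show False using S_one by auto
qed

lemma letter_in: "j < b \<Longrightarrow> letter j \<in> \<I>"
  using letter_range by blast

lemma nxt_letter: "j < b \<Longrightarrow> nxt (letter j) = (if Suc j < b then Some (letter (Suc j)) else None)"
  using inv_into_f_f[OF letter_inj, of j] by (simp add: nxt_def)

lemma nxt_in: "nxt x = Some y \<Longrightarrow> y \<in> \<I>"
  using letter_in by (auto simp: nxt_def Let_def split: if_splits)

lemma incr_lists: "z \<in> lists \<I> \<Longrightarrow> incr z \<in> lists \<I>"
proof (induction z)
  case Nil then show ?case using letter_in[OF b_pos] by simp
next
  case (Cons x z)
  then show ?case using letter_in[OF b_pos] nxt_in[of x] by (cases "nxt x") simp_all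
qed

lemma length_incr: "length z \<le> length (incr z)" "length (incr z) \<le> Suc (length z)"
proof -
  have "length z \<le> length (incr z) \<and> length (incr z) \<le> Suc (length z)"
    by (induction z) (auto split: option.splits)
  then show "length z \<le> length (incr z)" "length (incr z) \<le> Suc (length z)" by simp_all
qed

lemma incr_reaches:
  assumes "z \<in> lists \<I>" shows "\<exists>k. (incr ^^ k) [] = z"
proof -
  have up: "\<exists>k. (incr ^^ k) [] = letter j # xs" if "\<exists>k. (incr ^^ k) [] = letter 0 # xs" "j < b" for j xs
    using that(2)
  proof (induction j)
    case (Suc j)
    then obtain k where "(incr ^^ k) [] = letter j # xs" by auto
    then have "(incr ^^ Suc k) [] = letter (Suc j) # xs" using Suc.prems nxt_letter[of j] by simp
    then show ?case by blast
  qed (use that(1) in blast)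
  have cons: "\<exists>k'. (incr ^^ k') [] = letter j # (incr ^^ k) []" if "j < b" for j k
    using that
  proof (induction k arbitrary: j)
    case 0
    have "(incr ^^ Suc 0) [] = letter 0 # (incr ^^ 0) []" by simp
    then show ?case using up[of "(incr ^^ 0) []" j] 0 by blast
  next
    case (Suc k)
    obtain k' where "(incr ^^ k') [] = letter (b - 1) # (incr ^^ k) []" using Suc.IH[of "b - 1"] b_pos by auto
    then have "(incr ^^ Suc k') [] = letter 0 # (incr ^^ Suc k) []"
      using nxt_letter[of "b - 1"] b_pos by simp
    then show ?case using up[of "(incr ^^ Suc k) []" j] Suc.prems by blast
  qed
  show ?thesis using assms
  proof (induction z)
    case Nil then show ?case by (intro exI[of _ 0]) simp
  next
    case (Cons x z)
    then obtain k where "(incr ^^ k) [] = z" by auto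
    moreover obtain j where "j < b" "x = letter j" using Cons.hyps letter_range by auto
    ultimately show ?case using cons[of j k] by simp
  qed
qed

end

text \<open>The search on the ball of radius \<open>n\<close> with candidate \<open>z\<close>. In \<open>Run n z c \<sigma> h k w\<close> the
tape has content \<open>\<sigma>\<close> with the head in cell \<open>h\<close>, \<open>k\<close> steps have been made, and the
walker is at \<open>w\<close>.\<close>

datatype ('g, 'i) search = Begin nat "'i list"
  | Run nat "'i list" control "nat \<Rightarrow> 'i tape_symbol" nat nat 'g
  | Found

context enumerator
begin

definition advance :: "nat \<Rightarrow> ('g + 'a) list \<Rightarrow> ('g, 'g + 'a) search" where
  "advance n z = (if length (incr z) \<le> cells n then Begin n (incr z) else Begin (Suc n) [])"

text \<open>A sweep can carry symbols to the right but not to the left. Instead of the head moving to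
the left, the content of the tape moves to the right.\<close>

definition shifted :: "head_move \<Rightarrow> (nat \<Rightarrow> ('g + 'a) tape_symbol) \<Rightarrow> nat \<Rightarrow> ('g + 'a) tape_symbol" where
  "shifted mv \<sigma> = (if mv = Go_Left then (\<lambda>i. case i of 0 \<Rightarrow> Blank | Suc j \<Rightarrow> \<sigma> j) else \<sigma>)"

definition overrun :: "nat \<Rightarrow> head_move \<Rightarrow> (nat \<Rightarrow> ('g + 'a) tape_symbol) \<Rightarrow> nat \<Rightarrow> nat \<Rightarrow> bool" where
  "overrun n mv \<sigma> h k \<longleftrightarrow> Suc k = cells n \<or> (mv = Go_Left \<and> \<sigma> (cells n - 1) \<noteq> Blank) \<or>
     (mv = Go_Right \<and> Suc h = cells n)"

fun hstep :: "('g \<rightharpoonup> 'a) \<Rightarrow> ('g, 'g + 'a) search \<Rightarrow> ('g, 'g + 'a) search" where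
  "hstep p (Begin n z) =
     Run n z Scan (\<lambda>i. if i < length z then Letter (z ! i) else Blank) 0 0 \<one>"
| "hstep p (Run n z c \<sigma> h k w) = (case vm c (\<sigma> h) (w = \<one>) (p w) of None \<Rightarrow> advance n z
     | Some (c', x, mv, wa) \<Rightarrow>
         if walked w wa \<notin> ball n \<or> overrun n mv (\<sigma>(h := x)) h k then advance n z
         else if final c' then Found
         else Run n z c' (shifted mv (\<sigma>(h := x))) (if mv = Go_Right then Suc h else h) (Suc k) (walked w wa))"
| "hstep p Found = Found"

text \<open>The bounded tape shows a window of the two-sided tape, and is blank outside. The offset \<open>d\<close> counts
the moves to the left.\<close>

definition shows_tape :: "nat \<Rightarrow> (nat \<Rightarrow> ('g + 'a) tape_symbol) \<Rightarrow> nat \<Rightarrow> (int \<Rightarrow> ('g + 'a) tape_symbol) \<Rightarrow> int \<Rightarrow> bool" where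
  "shows_tape N \<sigma> h t hu \<longleftrightarrow> h < N \<and> (\<exists>d. hu = int h - d \<and>
     (\<forall>i. t i = (if 0 \<le> i + d \<and> i + d < int N then \<sigma> (nat (i + d)) else Blank)))"

lemma shows_tape_read: "shows_tape N \<sigma> h t hu \<Longrightarrow> t hu = \<sigma> h"
  by (auto simp: shows_tape_def)

lemma shows_tape_step:
  assumes st: "shows_tape N \<sigma> h t hu" and no: "\<not> (mv = Go_Left \<and> (\<sigma>(h := x)) (N - 1) \<noteq> Blank)"
    and nr: "\<not> (mv = Go_Right \<and> Suc h = N)"
  shows "shows_tape N (shifted mv (\<sigma>(h := x))) (if mv = Go_Right then Suc h else h) (t(hu := x)) (hu + head_shift mv)"
proof -
  obtain d where hN: "h < N" and hu: "hu = int h - d"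
    and t: "\<And>i. t i = (if 0 \<le> i + d \<and> i + d < int N then \<sigma> (nat (i + d)) else Blank)"
    using st by (auto simp: shows_tape_def)
  have t': "(t(hu := x)) i = (if 0 \<le> i + d \<and> i + d < int N then (\<sigma>(h := x)) (nat (i + d)) else Blank)" for i
  proof (cases "i = hu")
    case True
    then show ?thesis using hu hN by simp
  next
    case False
    then have "0 \<le> i + d \<Longrightarrow> nat (i + d) \<noteq> h" using hu by auto
    then show ?thesis using False t by auto
  qed
  show ?thesis
  proof (cases mv)
    case Go_Left
    have last: "(\<sigma>(h := x)) (N - 1) = Blank" using no Go_Left by simp
    have "(t(hu := x)) i = (if 0 \<le> i + (d + 1) \<and> i + (d + 1) < int N
        then shifted mv (\<sigma>(h := x)) (nat (i + (d + 1))) else Blank)" for i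
    proof -
      consider "i + d < -1" | "i + d = -1" | "0 \<le> i + d" "i + d < int N - 1" | "i + d = int N - 1" | "i + d \<ge> int N" by linarith
      then show ?thesis
      proof cases
        case 3
        then have "nat (i + (d + 1)) = Suc (nat (i + d))" by linarith
        then show ?thesis unfolding t' shifted_def using 3 Go_Left by simp
      next
        case 4
        then have "nat (i + d) = N - 1" using hN by linarith
        then show ?thesis unfolding t' using 4 last hN by simp
      next
        case 2
        then have "nat (i + (d + 1)) = 0" by linarith
        then show ?thesis unfolding t' shifted_def using 2 Go_Left by simp
      qed (simp_all add: t' del: fun_upd_apply)
    qed
    then show ?thesis unfolding shows_tape_def using hN hu Go_Left by (intro conjI exI[of _ "d + 1"]) auto
  next
    case Stay
    then show ?thesis unfolding shows_tape_def shifted_def using hN hu t'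
      by (intro conjI exI[of _ d]) auto
  next
    case Go_Right
    then show ?thesis unfolding shows_tape_def shifted_def using hN hu t' nr
      by (intro conjI exI[of _ d]) auto
  qed
qed

lemma shows_tape_start:
  assumes "length z \<le> N" "0 < N"
  shows "shows_tape N (\<lambda>i. if i < length z then Letter (z ! i) else Blank) 0 (tm_input Blank Letter z) 0"
  unfolding shows_tape_def
proof (intro conjI exI[of _ 0] allI)
  fix i :: int
  show "tm_input Blank Letter z i = (if 0 \<le> i + 0 \<and> i + 0 < int N
      then if nat (i + 0) < length z then Letter (z ! nat (i + 0)) else Blank else Blank)"
    using assms(1) by (auto simp: tm_input_def)
qed (use assms in simp_all)

lemma cells_pos: "0 < cells n"
  using one_in_ball[of n] finite_ball[of n] card_gt_0_iff by blast

definition follows :: "('g \<rightharpoonup> 'a) \<Rightarrow> nat \<Rightarrow> ('g + 'a) list \<Rightarrow> control \<Rightarrow> (nat \<Rightarrow> ('g + 'a) tape_symbol) \<Rightarrow>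
    nat \<Rightarrow> nat \<Rightarrow> 'g \<Rightarrow> bool" where
  "follows p n z c \<sigma> h k w \<longleftrightarrow> (\<exists>t hu. (ustep p ^^ k) (ustart z) = Some (c, t, hu, w) \<and>
     shows_tape (cells n) \<sigma> h t hu) \<and> w \<in> ball n \<and> \<not> final c"

lemma follows_start:
  assumes "length z \<le> cells n"
  shows "follows p n z Scan (\<lambda>i. if i < length z then Letter (z ! i) else Blank) 0 0 \<one>"
  using shows_tape_start[OF assms cells_pos] by (auto simp: follows_def ustart_def)

lemma follows_step:
  assumes f: "follows p n z c \<sigma> h k w"
    and vm: "vm c (\<sigma> h) (w = \<one>) (p w) = Some (c', x, mv, wa)"
    and ok: "walked w wa \<in> ball n" "\<not> overrun n mv (\<sigma>(h := x)) h k"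
  shows "uacc ((ustep p ^^ Suc k) (ustart z)) \<longleftrightarrow> final c'"
    and "\<not> final c' \<Longrightarrow> follows p n z c' (shifted mv (\<sigma>(h := x))) (if mv = Go_Right then Suc h else h) (Suc k) (walked w wa)"
proof -
  obtain t hu where u: "(ustep p ^^ k) (ustart z) = Some (c, t, hu, w)" and st: "shows_tape (cells n) \<sigma> h t hu"
    using f by (auto simp: follows_def)
  have u': "(ustep p ^^ Suc k) (ustart z) = Some (c', t(hu := x), hu + head_shift mv, walked w wa)"
    using u vm shows_tape_read[OF st] by simp
  show "uacc ((ustep p ^^ Suc k) (ustart z)) \<longleftrightarrow> final c'" unfolding u' by (simp add: uacc_def)
  have st': "shows_tape (cells n) (shifted mv (\<sigma>(h := x))) (if mv = Go_Right then Suc h else h) (t(hu := x)) (hu + head_shift mv)"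
    by (rule shows_tape_step[OF st]) (use ok(2) in \<open>simp_all add: overrun_def\<close>)
  then show "\<not> final c' \<Longrightarrow> follows p n z c' (shifted mv (\<sigma>(h := x))) (if mv = Go_Right then Suc h else h) (Suc k) (walked w wa)"
    unfolding follows_def u' using ok(1) by blast
qed

definition sound :: "('g \<rightharpoonup> 'a) \<Rightarrow> ('g, 'g + 'a) search \<Rightarrow> bool" where
  "sound p x \<longleftrightarrow> (case x of Begin n z \<Rightarrow> z \<in> lists \<I> \<and> length z \<le> cells n
     | Run n z c \<sigma> h k w \<Rightarrow> z \<in> lists \<I> \<and> length z \<le> cells n \<and> k < cells n \<and> follows p n z c \<sigma> h k w
     | Found \<Rightarrow> \<exists>z\<in>lists \<I>. accepts (ustep p) uacc (ustart z))"

lemma sound_advance: "z \<in> lists \<I> \<Longrightarrow> sound p (advance n z)"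
  by (simp add: advance_def sound_def incr_lists)

lemma sound_step: "sound p x \<Longrightarrow> sound p (hstep p x)"
proof (cases x)
  case (Begin n z)
  assume "sound p x"
  then show ?thesis using follows_start[of z n p] cells_pos[of n] Begin by (simp add: sound_def)
next
  case (Run n z c \<sigma> h k w)
  assume "sound p x"
  then have z: "z \<in> lists \<I>" "length z \<le> cells n" "k < cells n" and f: "follows p n z c \<sigma> h k w"
    using Run by (simp_all add: sound_def)
  show ?thesis
  proof (cases "vm c (\<sigma> h) (w = \<one>) (p w)")
    case None
    then show ?thesis using Run sound_advance[OF z(1)] by simp
  next
    case (Some r)
    obtain c' y mv wa where r: "r = (c', y, mv, wa)" by (metis prod_cases4)
    note vm = Some[unfolded r]
    show ?thesis
    proof (cases "walked w wa \<notin> ball n \<or> overrun n mv (\<sigma>(h := y)) h k")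
      case True
      then show ?thesis using Run vm sound_advance[OF z(1)] by (simp del: fun_upd_apply)
    next
      case False
      then have ok: "walked w wa \<in> ball n" "\<not> overrun n mv (\<sigma>(h := y)) h k" by simp_all
      have k: "Suc k < cells n" using ok(2) z(3) by (simp add: overrun_def)
      show ?thesis
      proof (cases "final c'")
        case True
        then have "uacc ((ustep p ^^ Suc k) (ustart z))" using follows_step(1)[OF f vm ok] by blast
        then have "accepts (ustep p) uacc (ustart z)" unfolding accepts_def by blast
        then show ?thesis using Run vm ok True z by (auto simp: sound_def simp del: fun_upd_apply)
      next
        case nf: False
        then show ?thesis using Run vm ok z k follows_step(2)[OF f vm ok nf] by (simp add: sound_def del: fun_upd_apply)
      qed
    qed
  qed
qed simp

lemma sound_funpow: "sound p ((hstep p ^^ j) (Begin 0 []))"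
  by (induction j) (simp_all add: sound_step, simp add: sound_def)

definition leads :: "('g \<rightharpoonup> 'a) \<Rightarrow> ('g, 'g + 'a) search \<Rightarrow> ('g, 'g + 'a) search \<Rightarrow> bool" where
  "leads p x y \<longleftrightarrow> (\<exists>j. (hstep p ^^ j) x = y)"

lemma leads_refl: "leads p x x" unfolding leads_def by (rule exI[of _ 0]) simp

lemma leads_trans: "leads p x y \<Longrightarrow> leads p y z \<Longrightarrow> leads p x z"
proof -
  assume "leads p x y" "leads p y z"
  then obtain i j where "(hstep p ^^ i) x = y" "(hstep p ^^ j) y = z" by (auto simp: leads_def)
  then have "(hstep p ^^ (j + i)) x = z" by (simp add: funpow_add)
  then show ?thesis unfolding leads_def by blast
qed

lemma leads_step: "leads p (hstep p x) y \<Longrightarrow> leads p x y"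
  using leads_trans[of p x "hstep p x" y] unfolding leads_def[of p x "hstep p x"]
  by (metis funpow_0 funpow.simps(2) comp_apply)

text \<open>The clock \<open>k\<close> advances at each step and must stay below the size of the ball.\<close>

lemma run_terminates:
  "k < cells n \<Longrightarrow> leads p (Run n z c \<sigma> h k w) Found \<or> leads p (Run n z c \<sigma> h k w) (advance n z)"
proof (induction "cells n - k" arbitrary: c \<sigma> h k w rule: less_induct)
  case less
  let ?x = "Run n z c \<sigma> h k w"
  show ?case
  proof (cases "vm c (\<sigma> h) (w = \<one>) (p w)")
    case None
    then have "hstep p ?x = advance n z" by simp
    then show ?thesis using leads_step[of p ?x] leads_refl by metis
  next
    case (Some r)
    obtain c' y mv wa where r: "r = (c', y, mv, wa)" by (metis prod_cases4)
    note vm = Some[unfolded r]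
    show ?thesis
    proof (cases "walked w wa \<notin> ball n \<or> overrun n mv (\<sigma>(h := y)) h k")
      case True
      then have "hstep p ?x = advance n z" using vm by (simp del: fun_upd_apply)
      then show ?thesis using leads_step[of p ?x] leads_refl by metis
    next
      case False
      show ?thesis
      proof (cases "final c'")
        case True
        then have "hstep p ?x = Found" using vm False by (simp del: fun_upd_apply)
        then show ?thesis using leads_step[of p ?x] leads_refl by metis
      next
        case nf: False
        have "Suc k < cells n" using False less.prems by (auto simp: overrun_def)
        then have "leads p (hstep p ?x) Found \<or> leads p (hstep p ?x) (advance n z)"
          using less.hyps[of "Suc k"] vm False nf by (simp del: fun_upd_apply)
        then show ?thesis using leads_step[of p ?x] by blast
      qed
    qed
  qed
qed

lemma begin_terminates: "leads p (Begin n z) Found \<or> leads p (Begin n z) (advance n z)"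
  using run_terminates[OF cells_pos] leads_step[of p "Begin n z"] unfolding hstep.simps by blast

lemma leads_enumerate:
  assumes nf: "\<not> leads p (Begin 0 []) Found" and n: "leads p (Begin 0 []) (Begin n [])"
  shows "length ((incr ^^ k) []) \<le> cells n \<Longrightarrow> leads p (Begin 0 []) (Begin n ((incr ^^ k) []))"
proof (induction k)
  case 0 then show ?case using n by simp
next
  case (Suc k)
  let ?z = "(incr ^^ k) []"
  have "length ?z \<le> cells n" using Suc.prems length_incr(1)[of ?z] by simp
  then have 1: "leads p (Begin 0 []) (Begin n ?z)" by (rule Suc.IH)
  then have "\<not> leads p (Begin n ?z) Found" using nf leads_trans by blast
  then have "leads p (Begin n ?z) (advance n ?z)" using begin_terminates by blast
  then have "leads p (Begin 0 []) (advance n ?z)" using 1 leads_trans by blast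
  moreover have "advance n ?z = Begin n ((incr ^^ Suc k) [])" using Suc.prems by (simp add: advance_def)
  ultimately show ?case by simp
qed

text \<open>As all words are enumerated, one that does not fit on the tape is reached eventually, and
then the ball grows.\<close>

lemma leads_level:
  assumes nf: "\<not> leads p (Begin 0 []) Found"
  shows "leads p (Begin 0 []) (Begin n [])"
proof (induction n)
  case 0 then show ?case by (rule leads_refl)
next
  case (Suc n)
  let ?P = "\<lambda>k. cells n < length ((incr ^^ k) [])"
  have "replicate (Suc (cells n)) (letter 0) \<in> lists \<I>" using letter_in[OF b_pos] by (auto simp: in_lists_conv_set)
  then obtain k where "(incr ^^ k) [] = replicate (Suc (cells n)) (letter 0)" using incr_reaches by blast
  then have "?P k" by simp
  then have P: "?P (LEAST k. ?P k)" by (rule LeastI)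
  then have "(LEAST k. ?P k) \<noteq> 0" by (metis funpow_0 list.size(3) not_less0)
  then obtain k' where k': "(LEAST k. ?P k) = Suc k'" by (metis not0_implies_Suc)
  let ?z = "(incr ^^ k') []"
  have "\<not> ?P k'" by (rule not_less_Least) (simp add: k')
  then have 1: "leads p (Begin 0 []) (Begin n ?z)" using leads_enumerate[OF nf Suc] by simp
  then have "\<not> leads p (Begin n ?z) Found" using nf leads_trans by blast
  then have "leads p (Begin n ?z) (advance n ?z)" using begin_terminates by blast
  then have "leads p (Begin 0 []) (advance n ?z)" using 1 leads_trans by blast
  moreover have "advance n ?z = Begin (Suc n) []" using P unfolding k' by (simp add: advance_def)
  ultimately show ?case by simp
qed

lemma vm_tape_bound:
  assumes "h \<le> k" "\<And>i. \<sigma> i \<noteq> Blank \<Longrightarrow> i \<le> l + k"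
  shows "\<And>i. shifted mv (\<sigma>(h := x)) i \<noteq> Blank \<Longrightarrow> i \<le> l + Suc k"
proof -
  have 1: "i \<le> l + k" if "(\<sigma>(h := x)) i \<noteq> Blank" for i
    using that assms by (cases "i = h") auto
  show "i \<le> l + Suc k" if "shifted mv (\<sigma>(h := x)) i \<noteq> Blank" for i
  proof (cases "mv = Go_Left")
    case True
    then show ?thesis using that 1 by (cases i) (auto simp: shifted_def simp del: fun_upd_apply)
  next
    case False
    then have "(\<sigma>(h := x)) i \<noteq> Blank" using that by (simp add: shifted_def del: fun_upd_apply)
    then show ?thesis using 1[of i] by simp
  qed
qed

text \<open>In \<open>i\<close> steps neither the head nor the content of the tape moves by more than \<open>i\<close> cells to the
right, so a run of length \<open>j\<close> fits into any sufficiently large ball.\<close>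

lemma run_follows:
  assumes z: "length z + j + 2 < cells n" and acc: "uacc ((ustep p ^^ j) (ustart z))"
    and some: "\<And>i. i \<le> j \<Longrightarrow> \<exists>c t h w. (ustep p ^^ i) (ustart z) = Some (c, t, h, w) \<and> w \<in> ball n"
  shows "i \<le> j \<Longrightarrow> leads p (Begin n z) Found \<or> (\<exists>c \<sigma> h w. leads p (Begin n z) (Run n z c \<sigma> h i w) \<and>
    follows p n z c \<sigma> h i w \<and> h \<le> i \<and> (\<forall>x. \<sigma> x \<noteq> Blank \<longrightarrow> x \<le> length z + i))"
proof (induction i)
  case 0
  have "leads p (Begin n z) (hstep p (Begin n z))" by (rule leads_step[OF leads_refl])
  then show ?case using follows_start[of z n p] z
    by (intro disjI2 exI conjI) (auto split: if_splits)
next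
  case (Suc i)
  then have "leads p (Begin n z) Found \<or> (\<exists>c \<sigma> h w. leads p (Begin n z) (Run n z c \<sigma> h i w) \<and>
    follows p n z c \<sigma> h i w \<and> h \<le> i \<and> (\<forall>x. \<sigma> x \<noteq> Blank \<longrightarrow> x \<le> length z + i))" by simp
  then show ?case
  proof
    assume "\<exists>c \<sigma> h w. leads p (Begin n z) (Run n z c \<sigma> h i w) \<and>
      follows p n z c \<sigma> h i w \<and> h \<le> i \<and> (\<forall>x. \<sigma> x \<noteq> Blank \<longrightarrow> x \<le> length z + i)"
    then obtain c \<sigma> h w where l: "leads p (Begin n z) (Run n z c \<sigma> h i w)" and f: "follows p n z c \<sigma> h i w"
      and h: "h \<le> i" and \<sigma>: "\<And>x. \<sigma> x \<noteq> Blank \<Longrightarrow> x \<le> length z + i" by blast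
    obtain t hu where u: "(ustep p ^^ i) (ustart z) = Some (c, t, hu, w)" and st: "shows_tape (cells n) \<sigma> h t hu"
      using f by (auto simp: follows_def)
    obtain c1 t1 h1 w1 where u1: "(ustep p ^^ Suc i) (ustart z) = Some (c1, t1, h1, w1)" "w1 \<in> ball n"
      using some[OF Suc.prems] by blast
    then have u1': "ustep p (Some (c, t, hu, w)) = Some (c1, t1, h1, w1)" using u by simp
    obtain c' x mv wa where vm: "vm c (\<sigma> h) (w = \<one>) (p w) = Some (c', x, mv, wa)"
      and eq: "c1 = c'" "w1 = walked w wa"
      using u1' shows_tape_read[OF st] by (auto split: option.splits)
    have \<sigma>': "(\<sigma>(h := x)) (cells n - 1) = Blank"
    proof -
      have "cells n - 1 \<noteq> h" using h Suc.prems z by linarith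
      moreover have "\<sigma> (cells n - 1) = Blank" using \<sigma>[of "cells n - 1"] Suc.prems z by linarith
      ultimately show ?thesis by simp
    qed
    have ok: "walked w wa \<in> ball n" "\<not> overrun n mv (\<sigma>(h := x)) h i"
    proof -
      show "walked w wa \<in> ball n" using u1 eq by simp
      have "Suc i \<noteq> cells n" "Suc h \<noteq> cells n" using h Suc.prems z by linarith+
      then show "\<not> overrun n mv (\<sigma>(h := x)) h i" unfolding overrun_def using \<sigma>' by simp
    qed
    have l1: "leads p (Begin n z) (hstep p (Run n z c \<sigma> h i w))"
      using l leads_step[OF leads_refl] leads_trans by blast
    show ?thesis
    proof (cases "final c'")
      case True
      then have "hstep p (Run n z c \<sigma> h i w) = Found" using vm ok by (simp del: fun_upd_apply)
      then show ?thesis using l1 by simp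
    next
      case False
      let ?r = "Run n z c' (shifted mv (\<sigma>(h := x))) (if mv = Go_Right then Suc h else h) (Suc i) (walked w wa)"
      have "hstep p (Run n z c \<sigma> h i w) = ?r" using vm ok False by (simp del: fun_upd_apply)
      then have "leads p (Begin n z) ?r" using l1 by simp
      moreover have "(if mv = Go_Right then Suc h else h) \<le> Suc i" using h by simp
      moreover have "\<forall>y. shifted mv (\<sigma>(h := x)) y \<noteq> Blank \<longrightarrow> y \<le> length z + Suc i"
        using vm_tape_bound[OF h \<sigma>] by blast
      ultimately show ?thesis using follows_step(2)[OF f vm ok False] by blast
    qed
  qed simp
qed

lemma ball_eventually:
  assumes "w \<in> carrier G" shows "\<exists>n0. \<forall>n\<ge>n0. w \<in> ball n"
  using ex_ball[OF assms] ball_mono by blast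

theorem search_finds_iff:
  assumes inf: "infinite (carrier G)"
  shows "accepts (hstep p) (\<lambda>x. x = Found) (Begin 0 []) \<longleftrightarrow>
    (\<exists>z\<in>lists \<I>. matches p \<one> z \<and> otm_accepts (word_problem G S) M z)"
proof -
  have "accepts (hstep p) (\<lambda>x. x = Found) (Begin 0 []) \<longleftrightarrow> leads p (Begin 0 []) Found"
    by (simp add: accepts_def leads_def)
  also have "\<dots> \<longleftrightarrow> (\<exists>z\<in>lists \<I>. accepts (ustep p) uacc (ustart z))"
  proof
    assume "leads p (Begin 0 []) Found"
    then obtain j where "(hstep p ^^ j) (Begin 0 []) = Found" by (auto simp: leads_def)
    then show "\<exists>z\<in>lists \<I>. accepts (ustep p) uacc (ustart z)" using sound_funpow[of p j] by (simp add: sound_def)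
  next
    assume "\<exists>z\<in>lists \<I>. accepts (ustep p) uacc (ustart z)"
    then obtain z j where z: "z \<in> lists \<I>" and acc: "uacc ((ustep p ^^ j) (ustart z))"
      unfolding accepts_def by blast
    have some: "\<exists>c t h w. (ustep p ^^ i) (ustart z) = Some (c, t, h, w) \<and> w \<in> carrier G" if "i \<le> j" for i
    proof (cases "(ustep p ^^ i) (ustart z)")
      case None
      have "(ustep p ^^ k) None = None" for k by (induction k) simp_all
      then have "(ustep p ^^ ((j - i) + i)) (ustart z) = None" unfolding funpow_add using None by simp
      then show ?thesis using acc that by (simp add: uacc_def)
    next
      case (Some a)
      obtain c t h w where "a = (c, t, h, w)" by (metis prod_cases4)
      then show ?thesis using uinv_funpow[OF z, where p=p and j=i] Some by simp
    qed
    have "\<exists>n0. \<forall>i<j'. \<forall>n\<ge>n0. \<exists>c t h w. (ustep p ^^ i) (ustart z) = Some (c, t, h, w) \<and> w \<in> ball n" if "j' \<le> Suc j" for j'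
      using that
    proof (induction j')
      case (Suc j')
      then obtain n0 where n0: "\<forall>i<j'. \<forall>n\<ge>n0. \<exists>c t h w. (ustep p ^^ i) (ustart z) = Some (c, t, h, w) \<and> w \<in> ball n"
        by auto
      have "j' \<le> j" using Suc.prems by simp
      then obtain c t h w where w: "(ustep p ^^ j') (ustart z) = Some (c, t, h, w)" "w \<in> carrier G" using some by blast
      obtain n1 where "\<forall>n\<ge>n1. w \<in> ball n" using ball_eventually[OF w(2)] by blast
      then show ?case using n0 w(1) by (intro exI[of _ "max n0 n1"]) (auto simp: less_Suc_eq)
    qed simp
    then obtain n0 where n0: "\<And>i n. i \<le> j \<Longrightarrow> n \<ge> n0 \<Longrightarrow>
      \<exists>c t h w. (ustep p ^^ i) (ustart z) = Some (c, t, h, w) \<and> w \<in> ball n" by (metis le_refl less_Suc_eq_le)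
    \<comment> \<open>This ball contains all positions of the walker, and it has more than \<open>n\<close> cells.\<close>
    define n where "n = max n0 (length z + j + 2)"
    have size: "length z + j + 2 < cells n" using ball_unbounded[OF inf, of n] by (simp add: n_def)
    have "leads p (Begin n z) Found \<or> (\<exists>c \<sigma> h w. leads p (Begin n z) (Run n z c \<sigma> h j w) \<and>
      follows p n z c \<sigma> h j w \<and> h \<le> j \<and> (\<forall>x. \<sigma> x \<noteq> Blank \<longrightarrow> x \<le> length z + j))"
      by (rule run_follows[OF size acc _ order_refl]) (use n0 in \<open>simp add: n_def\<close>)
    moreover have "\<not> follows p n z c \<sigma> h j w" for c \<sigma> h w
      using acc by (auto simp: follows_def uacc_def)
    ultimately have fd: "leads p (Begin n z) Found" by blast
    show "leads p (Begin 0 []) Found"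
    proof (rule ccontr)
      assume nf: "\<not> leads p (Begin 0 []) Found"
      obtain k where "(incr ^^ k) [] = z" using incr_reaches[OF z] by blast
      then have "leads p (Begin 0 []) (Begin n z)"
        using leads_enumerate[OF nf leads_level[OF nf], of k n] size by simp
      then show False using fd nf leads_trans by blast
    qed
  qed
  also have "\<dots> \<longleftrightarrow> (\<exists>z\<in>lists \<I>. matches p \<one> z \<and> otm_accepts (word_problem G S) M z)"
    using accepts_unbounded by blast
  finally show ?thesis .
qed

end

section \<open>Running the search on a G-machine\<close>

text \<open>Data stored at an element of the ball: candidate symbol, tape symbol, and the marks for the
head, the clock and the walker.\<close>

datatype 'i cell = Data "'i option" "'i tape_symbol" bool bool bool

text \<open>What happens to the walker in an \<open>Apply\<close> sweep: it stays, returns to the identity, or moves along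
the generator with the given index, first waiting to be found (\<open>Seek\<close>) and then for its neighbour to be
reached (\<open>Going\<close>). It is \<open>Lost\<close> if that neighbour is outside of the ball.\<close>

datatype seek = Keep | Reset | Seek nat | Going nat | Lost

text \<open>\<open>Clean\<close> sets up a trial, \<open>Gather\<close> collects what the next step depends on, \<open>Apply\<close> writes
the symbol and moves the walker, \<open>Shift\<close> moves clock and head, \<open>Incr\<close> replaces the candidate by the
next one, and \<open>Grow\<close> enlarges the ball and erases all data.\<close>

datatype ('g, 'a) phase =
    Clean bool
  | Gather control "('g + 'a) tape_symbol option" "(bool \<times> 'a option) option"
  | Apply control "('g + 'a) tape_symbol" head_move seek
  | Shift control head_move bool "('g + 'a) tape_symbol" bool
  | Incr bool
  | Grow
  | Accept

context enumerator
begin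

definition index :: "'g \<Rightarrow> nat" where
  "index g = (if g \<in> S then (SOME k. k < m \<and> s k = g) else 0)"

fun seek_of :: "'g walk \<Rightarrow> seek" where
  "seek_of Rest = Keep" | "seek_of Home = Reset"
| "seek_of (Along g) = (if g = \<one> then Keep else Seek (index g))"

fun eupd :: "('g, 'a) phase \<Rightarrow> nat \<Rightarrow> 'a option \<Rightarrow> bool \<Rightarrow> ('g + 'a) cell \<Rightarrow> ('g, 'a) phase \<times> ('g + 'a) cell" where
  "eupd (Clean f) k i rt (Data g x mk ck wk) = (if k = 0
     then (Clean False, Data g (case g of None \<Rightarrow> Blank | Some a \<Rightarrow> Letter a) f f rt)
     else (Clean f, Data g x mk ck wk))"
| "eupd (Gather c so oo) k i rt (Data g x mk ck wk) = (if k = 0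
     then (Gather c (if mk then Some x else so) (if wk then Some (rt, i) else oo), Data g x mk ck wk)
     else (Gather c so oo, Data g x mk ck wk))"
| "eupd (Apply c y mv sk) k i rt (Data g x mk ck wk) = (if k = 0
     then (case sk of
         Reset \<Rightarrow> (Apply c y mv sk, Data g (if mk then y else x) mk ck rt)
       | Seek j \<Rightarrow> (if wk then (Apply c y mv (Going j), Data g (if mk then y else x) mk ck False)
           else (Apply c y mv sk, Data g (if mk then y else x) mk ck wk))
       | _ \<Rightarrow> (Apply c y mv sk, Data g (if mk then y else x) mk ck wk))
     else if sk = Going k then (Apply c y mv Keep, Data g x mk ck True)
     else (Apply c y mv sk, Data g x mk ck wk))"
| "eupd (Shift c mv cc cs cm) k i rt (Data g x mk ck wk) = (if k = 0
     then (Shift c mv ck (if mv = Go_Left then x else cs) (if mv = Go_Right then mk else cm),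
       Data g (if mv = Go_Left then cs else x) (if mv = Go_Right then cm else mk) cc wk)
     else (Shift c mv cc cs cm, Data g x mk ck wk))"
| "eupd (Incr cy) k i rt (Data g x mk ck wk) = (if k = 0 \<and> cy
     then (case g of None \<Rightarrow> (Incr False, Data (Some (letter 0)) x mk ck wk)
       | Some a \<Rightarrow> (case nxt a of Some a' \<Rightarrow> (Incr False, Data (Some a') x mk ck wk)
         | None \<Rightarrow> (Incr True, Data (Some (letter 0)) x mk ck wk)))
     else (Incr cy, Data g x mk ck wk))"
| "eupd Grow k i rt (Data g x mk ck wk) = (Grow, if k = 0 then Data None Blank False False False else Data g x mk ck wk)"
| "eupd Accept k i rt d = (Accept, d)"

fun enew :: "('g, 'a) phase \<Rightarrow> nat \<Rightarrow> ('g, 'a) phase \<times> ('g + 'a) cell option" where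
  "enew (Apply c y mv sk) k = (if 0 < k \<and> sk = Going k then Apply c y mv Lost else Apply c y mv sk, None)"
| "enew Grow k = (Grow, Some (Data None Blank False False False))"
| "enew r k = (r, None)"

fun eeps :: "('g, 'a) phase \<Rightarrow> ('g, 'a) phase" where
  "eeps (Clean f) = Gather Scan None None"
| "eeps (Gather c so oo) = (case so of None \<Rightarrow> Incr True | Some x \<Rightarrow> (case oo of None \<Rightarrow> Incr True
     | Some (rt, i) \<Rightarrow> (case vm c x rt i of None \<Rightarrow> Incr True
       | Some (c', y, mv, wa) \<Rightarrow> Apply c' y mv (seek_of wa))))"
| "eeps (Apply c y mv sk) = (if sk = Lost then Incr True else Shift c mv False Blank False)"
| "eeps (Shift c mv cc cs cm) = (if cc \<or> cs \<noteq> Blank \<or> cm then Incr True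
     else if final c then Accept else Gather c None None)"
| "eeps (Incr cy) = (if cy then Grow else Clean True)"
| "eeps Grow = Clean True"
| "eeps Accept = Accept"

sublocale tree_machine G S s m eupd enew eeps "\<lambda>r. r = Accept" "Clean True" "Data None Blank False False False" ..

lemma quiet_phases:
  "quiet (Clean f)" "quiet (Gather c so oo)" "quiet (Shift c mv cc cs cm)" "quiet (Incr cy)"
  "quiet (Apply c y mv Keep)" "quiet (Apply c y mv Reset)" "quiet (Apply c y mv (Seek j))" "quiet (Apply c y mv Lost)"
proof -
  have 1: "(\<And>k i rt g x mk ck wk. 0 < k \<Longrightarrow> eupd r k i rt (Data g x mk ck wk) = (r, Data g x mk ck wk)) \<Longrightarrow>
      (\<And>k. enew r k = (r, None)) \<Longrightarrow> quiet r" for r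
    unfolding quiet_def by (metis cell.exhaust)
  show "quiet (Clean f)" "quiet (Gather c so oo)" "quiet (Shift c mv cc cs cm)" "quiet (Incr cy)"
    "quiet (Apply c y mv Keep)" "quiet (Apply c y mv Reset)" "quiet (Apply c y mv (Seek j))" "quiet (Apply c y mv Lost)"
    by (rule 1; simp)+
qed

definition opt :: "'x list \<Rightarrow> nat \<Rightarrow> 'x option" where
  "opt z i = (if i < length z then Some (z ! i) else None)"

fun guess :: "'i cell \<Rightarrow> 'i option" where "guess (Data g x mk ck wk) = g"

text \<open>Between two trials only the candidate matters; \<open>Clean\<close> overwrites everything else.\<close>

definition holds :: "('g \<rightharpoonup> 'a) \<Rightarrow> nat \<Rightarrow> ('g + 'a) list \<Rightarrow> ('g \<Rightarrow> ('a, ('g + 'a) cell) tree_label) \<Rightarrow> bool" where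
  "holds p n z y \<longleftrightarrow> (\<exists>par E. spanning n par \<and> stores p n par E y \<and> length z \<le> cells n \<and>
     (\<forall>i<cells n. guess (E i) = opt z i))"

abbreviation "pos par n i \<equiv> order n par n \<one> ! i"

definition image_of :: "('g \<Rightarrow> nat option) \<Rightarrow> nat \<Rightarrow> ('g + 'a) list \<Rightarrow> (nat \<Rightarrow> ('g + 'a) tape_symbol) \<Rightarrow>
    nat \<Rightarrow> nat \<Rightarrow> 'g \<Rightarrow> nat \<Rightarrow> ('g + 'a) cell" where
  "image_of par n z \<sigma> h k w i = Data (opt z i) (\<sigma> i) (i = h) (i = k) (pos par n i = w)"

lemma stores_cong: "(\<And>i. i < cells n \<Longrightarrow> E i = E' i) \<Longrightarrow> stores p n par E y \<Longrightarrow> stores p n par E' y"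
  by (simp add: stores_def)

lemma ex_pos: "spanning n par \<Longrightarrow> w \<in> ball n \<Longrightarrow> \<exists>i<cells n. pos par n i = w"
  using set_order[of n par] length_order[of n par] by (metis in_set_conv_nth)

lemma pos_inj: "spanning n par \<Longrightarrow> i < cells n \<Longrightarrow> j < cells n \<Longrightarrow> pos par n i = pos par n j \<longleftrightarrow> i = j"
  using nth_eq_iff_index_eq[OF distinct_order[OF _ one_in_ball]] length_order[of n par] by simp

lemma sweep_clean:
  assumes h: "holds p n z y"
  shows "\<exists>par y'. tmove\<^sup>+\<^sup>+ (y, \<one>, Try 0 (Clean True)) (y', \<one>, Try 0 (Gather Scan None None)) \<and> spanning n par \<and>
    stores p n par (image_of par n z (\<lambda>i. if i < length z then Letter (z ! i) else Blank) 0 0 \<one>) y'"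
proof -
  obtain par E where sp: "spanning n par" and st: "stores p n par E y" and g: "\<And>i. i < cells n \<Longrightarrow> guess (E i) = opt z i"
    using h by (auto simp: holds_def)
  let ?E = "image_of par n z (\<lambda>i. if i < length z then Letter (z ! i) else Blank) 0 0 \<one>"
  have "\<exists>y'. tmove\<^sup>+\<^sup>+ (y, \<one>, Try 0 (Clean ((0::nat) = 0))) (y', \<one>, enter (eeps (Clean (cells n = 0)))) \<and> stores p n par ?E y'"
  proof (rule moves_local_sweep[OF sp st, where \<rho>="\<lambda>i. Clean (i = 0)"])
    fix i assume i: "i < cells n"
    obtain x mk ck wk where E: "E i = Data (opt z i) x mk ck wk" using g[OF i] by (cases "E i") auto
    show "eupd (Clean (i = 0)) 0 (p (pos par n i)) (pos par n i = \<one>) (E i) = (Clean (Suc i = 0), ?E i)"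
      unfolding E by (simp add: image_of_def opt_def)
  qed (rule quiet_phases)
  then show ?thesis using sp by (auto simp: enter_def)
qed

lemma sweep_gather:
  assumes sp: "spanning n par" and st: "stores p n par (image_of par n z \<sigma> h k w) y"
    and h: "h < cells n" and w: "w \<in> ball n"
  shows "\<exists>y'. tmove\<^sup>+\<^sup>+ (y, \<one>, Try 0 (Gather c None None))
      (y', \<one>, enter (eeps (Gather c (Some (\<sigma> h)) (Some (w = \<one>, p w))))) \<and>
    stores p n par (image_of par n z \<sigma> h k w) y'"
proof -
  let ?E = "image_of par n z \<sigma> h k w"
  let ?r = "\<lambda>i. Gather c (if h < i then Some (\<sigma> h) else None) (if \<exists>j<i. pos par n j = w then Some (w = \<one>, p w) else None)"
  have "\<exists>y'. tmove\<^sup>+\<^sup>+ (y, \<one>, Try 0 (?r 0)) (y', \<one>, enter (eeps (?r (cells n)))) \<and> stores p n par ?E y'"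
  proof (rule moves_local_sweep[OF sp st, where \<rho>="?r"])
    fix i assume i: "i < cells n"
    show "eupd (?r i) 0 (p (pos par n i)) (pos par n i = \<one>) (?E i) = (?r (Suc i), ?E i)"
      by (auto simp: image_of_def less_Suc_eq)
  qed (rule quiet_phases)
  moreover have "\<exists>j<cells n. pos par n j = w" by (rule ex_pos[OF sp w])
  ultimately show ?thesis using h by simp
qed

lemma sweep_shift:
  assumes sp: "spanning n par" and st: "stores p n par (image_of par n z \<sigma> h k w) y"
    and h: "h < cells n" and k: "k < cells n"
  shows "\<exists>y'. tmove\<^sup>+\<^sup>+ (y, \<one>, Try 0 (Shift c mv False Blank False))
      (y', \<one>, enter (if overrun n mv \<sigma> h k then Incr True else if final c then Accept else Gather c None None)) \<and>
    stores p n par (image_of par n z (shifted mv \<sigma>) (if mv = Go_Right then Suc h else h) (Suc k) w) y'"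
proof -
  let ?E = "image_of par n z \<sigma> h k w"
  let ?E' = "image_of par n z (shifted mv \<sigma>) (if mv = Go_Right then Suc h else h) (Suc k) w"
  define \<rho> where "\<rho> i = Shift c mv (case i of 0 \<Rightarrow> False | Suc j \<Rightarrow> k = j)
     (if mv = Go_Left then (case i of 0 \<Rightarrow> Blank | Suc j \<Rightarrow> \<sigma> j) else Blank)
     (if mv = Go_Right then (case i of 0 \<Rightarrow> False | Suc j \<Rightarrow> h = j) else False)" for i
  have "\<exists>y'. tmove\<^sup>+\<^sup>+ (y, \<one>, Try 0 (\<rho> 0)) (y', \<one>, enter (eeps (\<rho> (cells n)))) \<and> stores p n par ?E' y'"
  proof (rule moves_local_sweep[OF sp st, where \<rho>="\<rho>"])
    fix i assume i: "i < cells n"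
    show "eupd (\<rho> i) 0 (p (pos par n i)) (pos par n i = \<one>) (?E i) = (\<rho> (Suc i), ?E' i)"
      unfolding \<rho>_def by (cases i) (auto simp: image_of_def shifted_def)
  qed (simp add: \<rho>_def quiet_phases)
  moreover obtain N where N: "cells n = Suc N" using h by (cases "cells n") auto
  moreover have "eeps (\<rho> (Suc N)) = (if overrun n mv \<sigma> h k then Incr True else if final c then Accept else Gather c None None)"
    unfolding \<rho>_def overrun_def N by (cases mv) auto
  moreover have "\<rho> 0 = Shift c mv False Blank False" by (simp add: \<rho>_def)
  ultimately show ?thesis by simp
qed

lemma index_props:
  assumes "g \<in> S" "g \<noteq> \<one>" shows "0 < index g" "index g < m" "s (index g) = g"
proof -
  have "\<exists>k. k < m \<and> s k = g" using assms gens by auto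
  then have "(SOME k. k < m \<and> s k = g) < m \<and> s (SOME k. k < m \<and> s k = g) = g" by (rule someI_ex)
  then show "index g < m" "s (index g) = g" using assms(1) by (simp_all add: index_def)
  then show "0 < index g" using assms(2) s_zero by (metis gr0I)
qed

lemma sweep_apply_local:
  assumes sp: "spanning n par" and st: "stores p n par (image_of par n z \<sigma> h k w) y"
    and sk: "sk = Keep \<and> w' = w \<or> sk = Reset \<and> w' = \<one>"
  shows "\<exists>y'. tmove\<^sup>+\<^sup>+ (y, \<one>, Try 0 (Apply c x mv sk)) (y', \<one>, enter (eeps (Apply c x mv sk))) \<and>
    stores p n par (image_of par n z (\<sigma>(h := x)) h k w') y'"
proof (rule moves_local_sweep[OF sp st, where \<rho>="\<lambda>_. Apply c x mv sk"])
  fix i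
  show "eupd (Apply c x mv sk) 0 (p (pos par n i)) (pos par n i = \<one>) (image_of par n z \<sigma> h k w i) =
    (Apply c x mv sk, image_of par n z (\<sigma>(h := x)) h k w' i)"
    using sk by (auto simp: image_of_def)
next
  show "quiet (Apply c x mv sk)" using sk quiet_phases by auto
qed

text \<open>While the neighbours are processed, a walker that has left its element reacts only to the
neighbour it moves to.\<close>

lemma fold_work_going:
  assumes v: "v \<in> carrier G" and j: "0 < j" "j < m"
    and q: "\<And>y'. quiet (fst (work v j (Apply c x mv (Going j), y')))"
  shows "fold (work v) [1..<m] (Apply c x mv (Going j), y) = work v j (Apply c x mv (Going j), y)"
proof -
  have skip: "fold (work v) ks (Apply c x mv (Going j), y) = (Apply c x mv (Going j), y)"
    if "0 \<notin> set ks" "j \<notin> set ks" for ks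
    using that
  proof (induction ks)
    case (Cons k ks)
    have "touch k (Apply c x mv (Going j)) l = (Apply c x mv (Going j), l)" for l
    proof (cases l)
      case (Node i pr d)
      then show ?thesis using Cons.prems by (cases d) auto
    qed (use Cons.prems in auto)
    then have "work v k (Apply c x mv (Going j), y) = (Apply c x mv (Going j), y)" by (simp add: work_def)
    then show ?case using Cons by simp
  qed simp
  have upt: "[1..<m] = [1..<j] @ j # [Suc j..<m]"
    using j by (metis Suc_leI less_imp_le_nat upt_add_eq_append upt_conv_Cons le_add_diff_inverse One_nat_def)
  obtain r1 y1 where w: "work v j (Apply c x mv (Going j), y) = (r1, y1)" by fastforce
  have "quiet r1" using q[of y] w by simp
  then have "fold (work v) [Suc j..<m] (r1, y1) = (r1, y1)" by (rule fold_work_quiet) simp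
  then show ?thesis unfolding upt using skip[of "[1..<j]"] w by simp
qed

text \<open>The new position of the walker may come before or after the old one in postorder. In the
latter case it is visited later in the same sweep, but by then the control has no pending move.\<close>

lemma sweep_apply_seek:
  assumes sp: "spanning n par" and st: "stores p n par (image_of par n z \<sigma> h k w) y"
    and w: "w \<in> ball n" and j: "0 < j" "j < m"
  shows "\<exists>y'. tmove\<^sup>+\<^sup>+ (y, \<one>, Try 0 (Apply c x mv (Seek j)))
      (y', \<one>, enter (eeps (Apply c x mv (if w \<otimes> s j \<in> ball n then Keep else Lost)))) \<and>
    stores p n par (image_of par n z (\<sigma>(h := x)) h k (w \<otimes> s j)) y'"
proof -
  let ?w = "w \<otimes> s j" and ?o = "order n par n \<one>"
  let ?end = "Apply c x mv (if ?w \<in> ball n then Keep else Lost)"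
  obtain iw where iw: "iw < cells n" "?o ! iw = w" using ex_pos[OF sp w] by blast
  define E where "E i i' = Data (opt z i') (if i' < i then (\<sigma>(h := x)) i' else \<sigma> i') (i' = h) (i' = k)
     (?o ! i' = (if iw < i then ?w else w))" for i i'
  define \<rho> where "\<rho> i = (if iw < i then ?end else Apply c x mv (Seek j))" for i
  have qend: "quiet ?end" using quiet_phases by simp
  have E0: "E 0 = image_of par n z \<sigma> h k w" by (simp add: E_def image_of_def fun_eq_iff)
  have main: "\<exists>y'. tmove\<^sup>+\<^sup>+ (y, \<one>, Try 0 (\<rho> 0)) (y', \<one>, enter (eeps (\<rho> (cells n)))) \<and> stores p n par (E (cells n)) y'"
  proof (rule moves_sweep_invariant[OF sp, where E=E and \<rho>=\<rho>])
    fix i y assume i: "i < cells n" and st: "stores p n par (E i) y"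
    show "\<exists>y'. visit (?o ! i) (\<rho> i, y) = (\<rho> (Suc i), y') \<and> stores p n par (E (Suc i)) y'"
    proof (cases "i = iw")
      case False
      then have ww: "?o ! i \<noteq> w" using pos_inj[OF sp i iw(1)] iw(2) by auto
      have r: "\<rho> (Suc i) = \<rho> i" using False by (auto simp: \<rho>_def)
      have q: "quiet (\<rho> (Suc i))" unfolding \<rho>_def using qend quiet_phases by simp
      have u: "eupd (\<rho> i) 0 (p (?o ! i)) (?o ! i = \<one>) (E i i) = (\<rho> (Suc i), E (Suc i) i)"
        unfolding r using False ww by (auto simp: \<rho>_def E_def)
      obtain y' where y': "visit (?o ! i) (\<rho> i, y) = (\<rho> (Suc i), y')" "stores p n par ((E i)(i := E (Suc i) i)) y'"
        using visit_quiet_stores[OF sp st i u q] by blast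
      have "stores p n par (E (Suc i)) y'"
        by (rule stores_cong[OF _ y'(2)]) (use False in \<open>auto simp: E_def less_Suc_eq\<close>)
      then show ?thesis using y'(1) by blast
    next
      case True
      let ?g = "Apply c x mv (Going j)"
      let ?d1 = "Data (opt z i) ((\<sigma>(h := x)) i) (i = h) (i = k) False"
      let ?y1 = "y(?o ! i := Node (p (?o ! i)) (par (?o ! i)) ?d1)"
      have v: "?o ! i \<in> ball n" "?o ! i = w" using iw True w by simp_all
      have yv: "y (?o ! i) = Node (p (?o ! i)) (par (?o ! i)) (E i i)" using st i by (simp add: stores_def)
      have u: "eupd (\<rho> i) 0 (p (?o ! i)) (par (?o ! i) = None) (E i i) = (?g, ?d1)"
        using True iw by (simp add: \<rho>_def E_def)
      have w0: "work (?o ! i) 0 (\<rho> i, y) = (?g, ?y1)"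
        by (rule work_zero[where y=y, OF ball_closed[OF v(1)] yv u])
      have st1: "stores p n par ((E i)(i := ?d1)) ?y1" by (rule stores_upd[OF sp st i])
      have touched: "fst (work (?o ! i) j (?g, y')) \<in> {Apply c x mv Keep, Apply c x mv Lost}" for y'
      proof (cases "y' (?o ! i \<otimes> s j)")
        case (Raw a) then show ?thesis using j by (simp add: work_def)
      next
        case (Node a b d) then show ?thesis using j by (cases d) (simp add: work_def)
      qed
      have q: "quiet (fst (work (?o ! i) j (?g, y')))" for y'
      proof -
        have "fst (work (?o ! i) j (?g, y')) = Apply c x mv Keep \<or> fst (work (?o ! i) j (?g, y')) = Apply c x mv Lost"
          using touched[of y'] by simp
        then show ?thesis using quiet_phases(5,8) by (elim disjE) (simp_all only:)
      qed
      have fw: "fold (work (?o ! i)) [1..<m] (?g, ?y1) = work (?o ! i) j (?g, ?y1)"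
        by (rule fold_work_going[OF ball_closed[OF v(1)] j q])
      have vis: "visit (?o ! i) (\<rho> i, y) = work w j (?g, ?y1)"
        unfolding visit_split w0 fw unfolding v(2) by (rule refl)
      have rS: "\<rho> (Suc i) = ?end" using True by (simp add: \<rho>_def)
      show ?thesis
      proof (cases "?w \<in> ball n")
        case wb: True
        obtain i' where i': "i' < cells n" "?o ! i' = ?w" using ex_pos[OF sp wb] by blast
        let ?E1 = "(E i)(i := ?d1)"
        obtain g0 x0 mk0 ck0 wk0 where E1: "?E1 i' = Data g0 x0 mk0 ck0 wk0" by (cases "?E1 i'")
        let ?d2 = "Data g0 x0 mk0 ck0 True"
        have y1: "?y1 ?w = Node (p ?w) (par ?w) (?E1 i')" using st1 i' unfolding stores_def by metis
        have "touch j ?g (?y1 ?w) = (Apply c x mv Keep, Node (p ?w) (par ?w) ?d2)"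
          unfolding y1 E1 using j by simp
        then have wk: "work w j (?g, ?y1) = (Apply c x mv Keep, ?y1(?w := Node (p ?w) (par ?w) ?d2))"
          unfolding work_def by (simp del: fun_upd_apply touch.simps)
        have st2: "stores p n par (?E1(i' := ?d2)) (?y1(?w := Node (p ?w) (par ?w) ?d2))"
          using stores_upd[OF sp st1 i'(1), of ?d2] unfolding i'(2) .
        have eq: "(?E1(i' := ?d2)) l = E (Suc i) l" if l: "l < cells n" for l
        proof -
          have "?o ! l = ?w \<longleftrightarrow> l = i'" using pos_inj[OF sp l i'(1)] i'(2) by auto
          moreover have "?o ! l = w \<longleftrightarrow> l = i" using pos_inj[OF sp l i] v(2) by auto
          ultimately show ?thesis using E1 True
            by (auto simp: E_def less_Suc_eq split: if_splits)
        qed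
        have "stores p n par (E (Suc i)) (?y1(?w := Node (p ?w) (par ?w) ?d2))"
          by (rule stores_cong[OF eq st2])
        then show ?thesis unfolding vis wk rS using wb by simp
      next
        case nb: False
        have "?y1 ?w = Raw (p ?w)" using st1 nb unfolding stores_def by blast
        then have "touch j ?g (?y1 ?w) = (Apply c x mv Lost, ?y1 ?w)" using j by (simp del: fun_upd_apply)
        then have wk: "work w j (?g, ?y1) = (Apply c x mv Lost, ?y1)"
          unfolding work_def by (simp del: fun_upd_apply touch.simps)
        have eq: "((E i)(i := ?d1)) l = E (Suc i) l" if l: "l < cells n" for l
        proof -
          have "?o ! l \<noteq> ?w" using order_nth_in_ball[OF sp l] nb by auto
          moreover have "?o ! l = w \<longleftrightarrow> l = i" using pos_inj[OF sp l i] v(2) by auto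
          ultimately show ?thesis using True by (auto simp: E_def less_Suc_eq)
        qed
        have "stores p n par (E (Suc i)) ?y1" by (rule stores_cong[OF eq st1])
        then show ?thesis unfolding vis wk rS using nb by simp
      qed
    qed
  qed (use st E0 in simp)
  have fin: "stores p n par (image_of par n z (\<sigma>(h := x)) h k ?w) y'" if "stores p n par (E (cells n)) y'" for y'
    by (rule stores_cong[OF _ that]) (use iw in \<open>simp add: E_def image_of_def\<close>)
  have "\<rho> (cells n) = ?end" "\<rho> 0 = Apply c x mv (Seek j)" using iw by (simp_all add: \<rho>_def)
  with main fin show ?thesis by force
qed

lemma opt_Nil [simp]: "opt [] i = None" by (simp add: opt_def)

lemma opt_Cons: "opt (x # z) i = (case i of 0 \<Rightarrow> Some x | Suc j \<Rightarrow> opt z j)"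
  by (auto simp: opt_def split: nat.splits)

text \<open>Whether the increment still has a carry when it reaches cell \<open>i\<close>.\<close>

fun carry :: "('g + 'a) list \<Rightarrow> nat \<Rightarrow> bool" where
  "carry z 0 \<longleftrightarrow> True"
| "carry [] (Suc i) \<longleftrightarrow> False"
| "carry (x # z) (Suc i) \<longleftrightarrow> nxt x = None \<and> carry z i"

lemma carry_Suc: "carry z (Suc i) \<longleftrightarrow> carry z i \<and> (\<exists>x. opt z i = Some x \<and> nxt x = None)"
proof (induction z i rule: carry.induct)
  case (1 z)
  then show ?case by (cases z) (auto simp: opt_Cons)
qed (auto simp: opt_Cons)

lemma opt_incr: "opt (incr z) i = (if carry z i
    then (case opt z i of None \<Rightarrow> Some (letter 0) | Some x \<Rightarrow> (case nxt x of None \<Rightarrow> Some (letter 0) | Some y \<Rightarrow> Some y))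
    else opt z i)"
proof (induction z i rule: carry.induct)
  case (1 z)
  then show ?case by (cases z) (auto simp: opt_Cons split: option.splits)
next
  case (3 x z i)
  then show ?case by (cases "nxt x") (auto simp: opt_Cons)
qed (simp add: opt_Cons)

lemma length_incr_carry: "length z \<le> N \<Longrightarrow> N < length (incr z) \<longleftrightarrow> carry z N"
proof (induction z N rule: carry.induct)
  case (1 z)
  then show ?case by simp
next
  case (3 x z i)
  then show ?case by (cases "nxt x") auto
qed simp

lemma sweep_incr:
  assumes h: "holds p n z y"
  shows "\<exists>y'. tmove\<^sup>+\<^sup>+ (y, \<one>, Try 0 (Incr True)) (y', \<one>, Try 0 (if carry z (cells n) then Grow else Clean True)) \<and>
    (\<exists>par E. spanning n par \<and> stores p n par E y' \<and> (\<forall>i<cells n. guess (E i) = opt (incr z) i))"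
proof -
  obtain par E where sp: "spanning n par" and st: "stores p n par E y" and g: "\<And>i. i < cells n \<Longrightarrow> guess (E i) = opt z i"
    using h by (auto simp: holds_def)
  define E' where "E' i = (case E i of Data _ x mk ck wk \<Rightarrow> Data (opt (incr z) i) x mk ck wk)" for i
  have "\<exists>y'. tmove\<^sup>+\<^sup>+ (y, \<one>, Try 0 (Incr (carry z 0))) (y', \<one>, enter (eeps (Incr (carry z (cells n))))) \<and> stores p n par E' y'"
  proof (rule moves_local_sweep[OF sp st, where \<rho>="\<lambda>i. Incr (carry z i)"])
    fix i assume i: "i < cells n"
    obtain x mk ck wk where E: "E i = Data (opt z i) x mk ck wk" using g[OF i] by (cases "E i") auto
    show "eupd (Incr (carry z i)) 0 (p (pos par n i)) (pos par n i = \<one>) (E i) = (Incr (carry z (Suc i)), E' i)"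
      unfolding E'_def E by (auto simp: opt_incr carry_Suc split: option.splits)
  qed (rule quiet_phases)
  then obtain y' where y': "tmove\<^sup>+\<^sup>+ (y, \<one>, Try 0 (Incr True)) (y', \<one>, Try 0 (if carry z (cells n) then Grow else Clean True))"
    "stores p n par E' y'"
    by (auto simp: enter_def split: if_splits)
  moreover have "guess (E' i) = opt (incr z) i" for i unfolding E'_def by (cases "E i") simp
  ultimately show ?thesis using sp by blast
qed

end

context enumerator
begin

abbreviation "blank_data \<equiv> Data None Blank False False False"

text \<open>The ball during a \<open>Grow\<close> sweep, when the data of the elements of \<open>B\<close> have been erased and
the elements of \<open>C\<close> have been reached as neighbours.\<close>

definition grown :: "('g \<rightharpoonup> 'a) \<Rightarrow> nat \<Rightarrow> ('g \<Rightarrow> nat option) \<Rightarrow> 'g set \<Rightarrow> 'g set \<Rightarrow>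
    ('g \<Rightarrow> ('a, ('g + 'a) cell) tree_label) \<Rightarrow> bool" where
  "grown p n par B C y \<longleftrightarrow>
     (\<forall>v\<in>ball n. \<exists>d. y v = Node (p v) (par v) d \<and> (v \<in> B \<longrightarrow> d = blank_data)) \<and>
     (\<forall>v. v \<notin> ball n \<longrightarrow> (if v \<in> C then \<exists>k<m. y v = Node (p v) (Some k) blank_data \<and> v \<otimes> inv (s k) \<in> ball n
        else y v = Raw (p v)))"

lemma eupd_grow: "eupd Grow k i rt d = (Grow, if k = 0 then blank_data else d)"
  by (cases d) simp

lemma work_grow:
  assumes gr: "grown p n par B C y" and v: "v \<in> ball n" and k: "k < m"
  shows "\<exists>y'. work v k (Grow, y) = (Grow, y') \<and> grown p n par (if k = 0 then insert v B else B) (insert (v \<otimes> s k) C) y'"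
proof -
  let ?u = "v \<otimes> s k"
  show ?thesis
  proof (cases "?u \<in> ball n")
    case True
    then obtain d where d: "y ?u = Node (p ?u) (par ?u) d" "?u \<in> B \<longrightarrow> d = blank_data"
      using gr by (auto simp: grown_def)
    let ?y' = "y(?u := Node (p ?u) (par ?u) (if k = 0 then blank_data else d))"
    have "work v k (Grow, y) = (Grow, ?y')" by (simp add: work_def d(1) eupd_grow)
    moreover have "k = 0 \<Longrightarrow> ?u = v" using v s_zero by simp
    then have "grown p n par (if k = 0 then insert v B else B) (insert ?u C) ?y'"
      using gr d(2) True unfolding grown_def by auto
    ultimately show ?thesis by blast
  next
    case False
    then have k0: "k \<noteq> 0" using v s_zero by (metis ball_closed r_one)
    show ?thesis
    proof (cases "?u \<in> C")
      case True
      have "if ?u \<in> C then \<exists>k<m. y ?u = Node (p ?u) (Some k) blank_data \<and> ?u \<otimes> inv (s k) \<in> ball n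
          else y ?u = Raw (p ?u)" using gr False unfolding grown_def by blast
      then obtain k' where k': "y ?u = Node (p ?u) (Some k') blank_data" using True by (simp only: if_True) blast
      have "work v k (Grow, y) = (Grow, y)" using k0 by (simp add: work_def k' eupd_grow fun_upd_idem)
      moreover have "insert ?u C = C" using True by blast
      ultimately show ?thesis using gr k0 by simp
    next
      case nC: False
      have yu: "y ?u = Raw (p ?u)" using gr False nC by (auto simp: grown_def)
      let ?y' = "y(?u := Node (p ?u) (Some k) blank_data)"
      have "work v k (Grow, y) = (Grow, ?y')" by (simp add: work_def yu)
      moreover have "?u \<otimes> inv (s k) \<in> ball n" using v k by simp
      then have "grown p n par B (insert ?u C) ?y'"
        using gr False k unfolding grown_def by auto
      ultimately show ?thesis using k0 by auto
    qed
  qed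
qed

lemma fold_work_grow:
  assumes v: "v \<in> ball n"
  shows "grown p n par B C y \<Longrightarrow> set ks \<subseteq> {..<m} \<Longrightarrow> \<exists>y'. fold (work v) ks (Grow, y) = (Grow, y') \<and>
    grown p n par (if 0 \<in> set ks then insert v B else B) (C \<union> (\<lambda>k. v \<otimes> s k) ` set ks) y'"
proof (induction ks arbitrary: y B C)
  case (Cons k ks)
  then have "k < m" by simp
  from work_grow[OF Cons.prems(1) v this] obtain y1 where y1: "work v k (Grow, y) = (Grow, y1)"
    "grown p n par (if k = 0 then insert v B else B) (insert (v \<otimes> s k) C) y1" by blast
  from Cons.IH[OF y1(2)] Cons.prems(2) obtain y2 where y2: "fold (work v) ks (Grow, y1) = (Grow, y2)"
    "grown p n par (if 0 \<in> set ks then insert v (if k = 0 then insert v B else B) else (if k = 0 then insert v B else B))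
       (insert (v \<otimes> s k) C \<union> (\<lambda>k. v \<otimes> s k) ` set ks) y2" by auto
  have "(if 0 \<in> set ks then insert v (if k = 0 then insert v B else B) else (if k = 0 then insert v B else B)) =
    (if 0 \<in> set (k # ks) then insert v B else B)" by auto
  moreover have "insert (v \<otimes> s k) C \<union> (\<lambda>k. v \<otimes> s k) ` set ks = C \<union> (\<lambda>k. v \<otimes> s k) ` set (k # ks)" by auto
  ultimately show ?case using y1(1) y2 by simp
qed simp

lemma fold_visit_grow:
  "grown p n par B C y \<Longrightarrow> set vs \<subseteq> ball n \<Longrightarrow> \<exists>y'. fold visit vs (Grow, y) = (Grow, y') \<and>
    grown p n par (B \<union> set vs) (C \<union> (\<Union>v\<in>set vs. (\<lambda>k. v \<otimes> s k) ` {..<m})) y'"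
proof (induction vs arbitrary: y B C)
  case (Cons v vs)
  then have v: "v \<in> ball n" by simp
  have ks: "set [0..<m] = {..<m}" "0 \<in> set [0..<m]" using m_pos by auto
  from fold_work_grow[OF v Cons.prems(1), of "[0..<m]"] obtain y1 where y1: "visit v (Grow, y) = (Grow, y1)"
    "grown p n par (insert v B) (C \<union> (\<lambda>k. v \<otimes> s k) ` {..<m}) y1" using ks by (auto simp: visit_def)
  from Cons.IH[OF y1(2)] Cons.prems(2) obtain y2 where y2: "fold visit vs (Grow, y1) = (Grow, y2)"
    "grown p n par (insert v B \<union> set vs) (C \<union> (\<lambda>k. v \<otimes> s k) ` {..<m} \<union> (\<Union>v\<in>set vs. (\<lambda>k. v \<otimes> s k) ` {..<m})) y2" by auto
  have "insert v B \<union> set vs = B \<union> set (v # vs)" by auto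
  moreover have "C \<union> (\<lambda>k. v \<otimes> s k) ` {..<m} \<union> (\<Union>v\<in>set vs. (\<lambda>k. v \<otimes> s k) ` {..<m}) =
    C \<union> (\<Union>v\<in>set (v # vs). (\<lambda>k. v \<otimes> s k) ` {..<m})" by auto
  ultimately show ?case using y1(1) y2 by simp
qed simp

lemma sweep_grow:
  assumes sp: "spanning n par" and st: "stores p n par E y"
  shows "\<exists>par' y'. tmove\<^sup>+\<^sup>+ (y, \<one>, Try 0 Grow) (y', \<one>, Try 0 (Clean True)) \<and> spanning (Suc n) par' \<and>
    stores p (Suc n) par' (\<lambda>_. blank_data) y'"
proof -
  let ?o = "order n par n \<one>"
  have "grown p n par {} {} y"
    unfolding grown_def
  proof (intro conjI ballI allI impI)
    fix v assume "v \<in> ball n"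
    then obtain i where "i < cells n" "?o ! i = v" using ex_pos[OF sp] by blast
    then show "\<exists>d. y v = Node (p v) (par v) d \<and> (v \<in> {} \<longrightarrow> d = blank_data)"
      using st by (auto simp: stores_def)
  qed (use st in \<open>simp add: stores_def\<close>)
  from fold_visit_grow[OF this, of ?o] set_order[OF sp] obtain y' where
    f: "fold visit ?o (Grow, y) = (Grow, y')" and
    gr0: "grown p n par (ball n) (\<Union>v\<in>ball n. (\<lambda>k. v \<otimes> s k) ` {..<m}) y'" by auto
  have "(\<Union>v\<in>ball n. (\<lambda>k. v \<otimes> s k) ` {..<m}) = ball (Suc n)" by auto
  then have gr: "grown p n par (ball n) (ball (Suc n)) y'" using gr0 by (simp only:)
  have run: "tmove\<^sup>+\<^sup>+ (y, \<one>, Try 0 Grow) (y', \<one>, Try 0 (Clean True))"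
    using moves_sweep[OF sp stores_tree[OF sp st] f] by (simp add: enter_def)
  define par' where "par' v = (case y' v of Node _ q _ \<Rightarrow> q | Raw _ \<Rightarrow> None)" for v
  have in_ball: "y' v = Node (p v) (par v) blank_data" if "v \<in> ball n" for v
    using gr that unfolding grown_def by blast
  have new: "\<exists>k<m. y' v = Node (p v) (Some k) blank_data \<and> v \<otimes> inv (s k) \<in> ball n"
    if "v \<in> ball (Suc n)" "v \<notin> ball n" for v
    using gr that unfolding grown_def by (simp del: ball.simps)
  have out: "y' v = Raw (p v)" if "v \<notin> ball (Suc n)" for v
  proof -
    have "v \<notin> ball n" using that ball_Suc_mono by blast
    then show ?thesis using gr that unfolding grown_def by (simp del: ball.simps)
  qed
  have "spanning (Suc n) par'"
    unfolding spanning_def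
  proof (intro conjI ballI impI)
    show "par' \<one> = None" using in_ball[of \<one>] sp by (simp add: par'_def spanning_def)
  next
    fix v assume v: "v \<in> ball (Suc n)" "v \<noteq> \<one>"
    show "\<exists>j<m. par' v = Some j \<and> Suc (len (v \<otimes> inv (s j))) = len v"
    proof (cases "v \<in> ball n")
      case True
      then show ?thesis using in_ball[OF True] sp v(2) by (auto simp: par'_def spanning_def)
    next
      case False
      from new[OF v(1) False] obtain k where k: "k < m" "y' v = Node (p v) (Some k) blank_data" "v \<otimes> inv (s k) \<in> ball n"
        by blast
      let ?u = "v \<otimes> inv (s k)"
      have vc: "v \<in> carrier G" using v(1) by (rule ball_closed)
      have uc: "?u \<in> carrier G" using k(3) by (rule ball_closed)
      have lu: "len ?u \<le> n" using k(3) in_ball_iff[OF uc] by blast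
      have "\<not> len v \<le> n" using False in_ball_iff[OF vc] by blast
      moreover have "?u \<in> ball (len ?u)" using in_ball_iff[OF uc] by blast
      then have "?u \<otimes> s k \<in> ball (Suc (len ?u))" using k(1) by (rule ball_SucI)
      then have "len v \<le> Suc (len ?u)" using in_ball_iff[OF vc] vc k(1) by (simp del: ball.simps)
      ultimately have "Suc (len ?u) = len v" using lu by simp
      then show ?thesis using k by (auto simp: par'_def)
    qed
  qed
  moreover have "stores p (Suc n) par' (\<lambda>_. blank_data) y'"
    unfolding stores_def
  proof (intro conjI allI impI)
    fix i assume "i < cells (Suc n)"
    then have "order (Suc n) par' (Suc n) \<one> ! i \<in> ball (Suc n)"
      using order_nth_in_ball[OF \<open>spanning (Suc n) par'\<close>] by blast
    moreover have "y' v = Node (p v) (par' v) blank_data" if "v \<in> ball (Suc n)" for v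
      using in_ball[of v] new[OF that] by (cases "v \<in> ball n") (auto simp: par'_def)
    ultimately show "y' (order (Suc n) par' (Suc n) \<one> ! i) =
      Node (p (order (Suc n) par' (Suc n) \<one> ! i)) (par' (order (Suc n) par' (Suc n) \<one> ! i)) blank_data" by blast
  qed (rule out)
  ultimately show ?thesis using run by blast
qed

definition simulates :: "('g \<rightharpoonup> 'a) \<Rightarrow> ('g \<Rightarrow> ('a, ('g + 'a) cell) tree_label) \<times> 'g \<times> ('g, 'a) phase tree_state \<Rightarrow>
    ('g, 'g + 'a) search \<Rightarrow> bool" where
  "simulates p st x \<longleftrightarrow> sound p x \<and> (case x of
     Begin n z \<Rightarrow> \<exists>y. st = (y, \<one>, Try 0 (Clean True)) \<and> holds p n z y
   | Run n z c \<sigma> h k w \<Rightarrow> \<exists>par y. st = (y, \<one>, Try 0 (Gather c None None)) \<and> spanning n par \<and>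
       stores p n par (image_of par n z \<sigma> h k w) y \<and> h < cells n
   | Found \<Rightarrow> \<exists>y h. st = (y, h, Stop))"

lemma moves_advance:
  assumes h: "holds p n z y" and z: "z \<in> lists \<I>"
  shows "\<exists>st. tmove\<^sup>+\<^sup>+ (y, \<one>, Try 0 (Incr True)) st \<and> simulates p st (advance n z)"
proof -
  have len: "length z \<le> cells n" using h by (auto simp: holds_def)
  obtain y' par E where run: "tmove\<^sup>+\<^sup>+ (y, \<one>, Try 0 (Incr True)) (y', \<one>, Try 0 (if carry z (cells n) then Grow else Clean True))"
    and sp: "spanning n par" and st: "stores p n par E y'" and g: "\<forall>i<cells n. guess (E i) = opt (incr z) i"
    using sweep_incr[OF h] by blast
  show ?thesis
  proof (cases "carry z (cells n)")
    case False
    then have l: "length (incr z) \<le> cells n" using length_incr_carry[OF len] by simp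
    have "holds p n (incr z) y'" unfolding holds_def using sp st g l by blast
    then have "simulates p (y', \<one>, Try 0 (Clean True)) (advance n z)"
      using l sound_advance[OF z, of p n] by (simp add: simulates_def advance_def)
    moreover have "tmove\<^sup>+\<^sup>+ (y, \<one>, Try 0 (Incr True)) (y', \<one>, Try 0 (Clean True))" using run False by simp
    ultimately show ?thesis by blast
  next
    case True
    then have l: "\<not> length (incr z) \<le> cells n" using length_incr_carry[OF len] by simp
    obtain par' y'' where g: "tmove\<^sup>+\<^sup>+ (y', \<one>, Try 0 Grow) (y'', \<one>, Try 0 (Clean True))" "spanning (Suc n) par'"
      "stores p (Suc n) par' (\<lambda>_. blank_data) y''" using sweep_grow[OF sp st] by blast
    have "holds p (Suc n) [] y''" unfolding holds_def using g(2,3)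
      by (intro exI[of _ par'] exI[of _ "\<lambda>_. blank_data"]) simp
    then have "simulates p (y'', \<one>, Try 0 (Clean True)) (advance n z)"
      using l sound_advance[OF z, of p n] by (simp add: simulates_def advance_def)
    moreover have "tmove\<^sup>+\<^sup>+ (y, \<one>, Try 0 (Incr True)) (y'', \<one>, Try 0 (Clean True))"
    proof (rule tranclp_trans)
      show "tmove\<^sup>+\<^sup>+ (y, \<one>, Try 0 (Incr True)) (y', \<one>, Try 0 Grow)" using run True by simp
    qed (rule g(1))
    ultimately show ?thesis by blast
  qed
qed

lemma sweep_apply:
  assumes sp: "spanning n par" and st: "stores p n par (image_of par n z \<sigma> h k w) y"
    and w: "w \<in> ball n" and wa: "\<And>g. wa = Along g \<Longrightarrow> g \<in> S"
  shows "\<exists>y'. tmove\<^sup>+\<^sup>+ (y, \<one>, Try 0 (Apply c x mv (seek_of wa)))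
      (y', \<one>, Try 0 (if walked w wa \<in> ball n then Shift c mv False Blank False else Incr True)) \<and>
    stores p n par (image_of par n z (\<sigma>(h := x)) h k (walked w wa)) y'"
proof (cases "\<exists>g. wa = Along g \<and> g \<noteq> \<one>")
  case True
  then obtain g where g: "wa = Along g" "g \<noteq> \<one>" by blast
  note ix = index_props[OF wa[OF g(1)] g(2)]
  show ?thesis using sweep_apply_seek[OF sp st w ix(1,2), of c x mv] g ix(3) by (auto simp: enter_def)
next
  case False
  then have sk: "seek_of wa = Keep \<and> walked w wa = w \<or> seek_of wa = Reset \<and> walked w wa = \<one>"
    using w by (cases wa) auto
  then have "walked w wa \<in> ball n" using w by auto
  moreover have "eeps (Apply c x mv (seek_of wa)) = Shift c mv False Blank False" using sk by auto
  ultimately show ?thesis using sweep_apply_local[OF sp st sk, of c x mv] by (simp add: enter_def)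
qed

lemma holds_image:
  "spanning n par \<Longrightarrow> stores p n par (image_of par n z \<sigma> h k w) y \<Longrightarrow> length z \<le> cells n \<Longrightarrow> holds p n z y"
  unfolding holds_def by (intro exI[of _ par] exI[of _ "image_of par n z \<sigma> h k w"]) (simp add: image_of_def)

text \<open>A step of a trial takes the three sweeps \<open>Gather\<close>, \<open>Apply\<close>, \<open>Shift\<close>; each of them
may end the trial.\<close>

lemma simulates_step:
  assumes sim: "simulates p st x" and nf: "x \<noteq> Found"
  shows "\<exists>st'. tmove\<^sup>+\<^sup>+ st st' \<and> simulates p st' (hstep p x)"
proof -
  have so: "sound p x" and so': "sound p (hstep p x)" using sim sound_step by (auto simp: simulates_def)
  show ?thesis
  proof (cases x)
    case (Begin n z)
    then obtain y where y: "st = (y, \<one>, Try 0 (Clean True))" "holds p n z y" using sim by (auto simp: simulates_def)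
    from sweep_clean[OF y(2)] obtain par y' where y': "tmove\<^sup>+\<^sup>+ st (y', \<one>, Try 0 (Gather Scan None None))"
      "spanning n par"
      "stores p n par (image_of par n z (\<lambda>i. if i < length z then Letter (z ! i) else Blank) 0 0 \<one>) y'"
      unfolding y(1) by blast
    have "simulates p (y', \<one>, Try 0 (Gather Scan None None)) (hstep p x)"
      unfolding simulates_def using so' y'(2,3) cells_pos[of n] unfolding Begin hstep.simps search.case by blast
    then show ?thesis using y'(1) by blast
  next
    case (Run n z c \<sigma> h k w)
    obtain par y where st: "st = (y, \<one>, Try 0 (Gather c None None))" and sp: "spanning n par" and
      im: "stores p n par (image_of par n z \<sigma> h k w) y" and h: "h < cells n"
      using sim Run by (auto simp: simulates_def)
    have z: "z \<in> lists \<I>" "length z \<le> cells n" "k < cells n" and f: "follows p n z c \<sigma> h k w"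
      using so Run by (simp_all add: sound_def)
    have w: "w \<in> ball n" using f by (simp add: follows_def)
    obtain y1 where y1: "tmove\<^sup>+\<^sup>+ st (y1, \<one>, enter (eeps (Gather c (Some (\<sigma> h)) (Some (w = \<one>, p w)))))"
      "stores p n par (image_of par n z \<sigma> h k w) y1" using sweep_gather[OF sp im h w] st by blast
    show ?thesis
    proof (cases "vm c (\<sigma> h) (w = \<one>) (p w)")
      case None
      then have a: "tmove\<^sup>+\<^sup>+ st (y1, \<one>, Try 0 (Incr True))" using y1(1) by (simp add: enter_def)
      have e: "hstep p x = advance n z" using Run None by simp
      obtain st' where st': "tmove\<^sup>+\<^sup>+ (y1, \<one>, Try 0 (Incr True)) st'" "simulates p st' (advance n z)"
        using moves_advance[OF holds_image[OF sp y1(2) z(2)] z(1)] by blast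
      show ?thesis unfolding e using tranclp_trans[OF a st'(1)] st'(2) by blast
    next
      case (Some r)
      obtain c' x' mv wa where "r = (c', x', mv, wa)" by (metis prod_cases4)
      with Some have vm: "vm c (\<sigma> h) (w = \<one>) (p w) = Some (c', x', mv, wa)" by simp
      have along: "g \<in> S" if "wa = Along g" for g
      proof -
        obtain t hu where u: "(ustep p ^^ k) (ustart z) = Some (c, t, hu, w)" and sh: "shows_tape (cells n) \<sigma> h t hu"
          using f by (auto simp: follows_def)
        have "uinv (Some (c, t, hu, w))" using uinv_funpow[OF z(1), where p=p and j=k] u by simp
        moreover have "vm c (t hu) (w = \<one>) (p w) = Some (c', x', mv, Along g)"
          using vm shows_tape_read[OF sh] that by simp
        ultimately show ?thesis by (rule vm_along)
      qed
      have 1: "tmove\<^sup>+\<^sup>+ st (y1, \<one>, Try 0 (Apply c' x' mv (seek_of wa)))"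
        using y1(1) vm by (simp add: enter_def)
      obtain y2 where y2: "tmove\<^sup>+\<^sup>+ (y1, \<one>, Try 0 (Apply c' x' mv (seek_of wa)))
          (y2, \<one>, Try 0 (if walked w wa \<in> ball n then Shift c' mv False Blank False else Incr True))"
        "stores p n par (image_of par n z (\<sigma>(h := x')) h k (walked w wa)) y2"
        using sweep_apply[OF sp y1(2) w along] by blast
      note 2 = tranclp_trans[OF 1 y2(1)]
      show ?thesis
      proof (cases "walked w wa \<in> ball n")
        case False
        then have e: "hstep p x = advance n z" using Run vm by simp
        obtain st' where st': "tmove\<^sup>+\<^sup>+ (y2, \<one>, Try 0 (Incr True)) st'" "simulates p st' (advance n z)"
          using moves_advance[OF holds_image[OF sp y2(2) z(2)] z(1)] by blast
        have a: "tmove\<^sup>+\<^sup>+ st (y2, \<one>, Try 0 (Incr True))" using 2 \<open>walked w wa \<notin> ball n\<close> by simp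
        show ?thesis unfolding e using tranclp_trans[OF a st'(1)] st'(2) by blast
      next
        case wb: True
        let ?ov = "overrun n mv (\<sigma>(h := x')) h k"
        let ?h' = "if mv = Go_Right then Suc h else h"
        have 3: "tmove\<^sup>+\<^sup>+ st (y2, \<one>, Try 0 (Shift c' mv False Blank False))" using 2 wb by simp
        obtain y3 where y3: "tmove\<^sup>+\<^sup>+ (y2, \<one>, Try 0 (Shift c' mv False Blank False))
            (y3, \<one>, enter (if ?ov then Incr True else if final c' then Accept else Gather c' None None))"
          "stores p n par (image_of par n z (shifted mv (\<sigma>(h := x'))) ?h' (Suc k) (walked w wa)) y3"
          using sweep_shift[OF sp y2(2) h z(3)] by blast
        note 4 = tranclp_trans[OF 3 y3(1)]
        show ?thesis
        proof (cases ?ov)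
          case True
          then have e: "hstep p x = advance n z" using Run vm by (simp del: fun_upd_apply)
          obtain st' where st': "tmove\<^sup>+\<^sup>+ (y3, \<one>, Try 0 (Incr True)) st'" "simulates p st' (advance n z)"
            using moves_advance[OF holds_image[OF sp y3(2) z(2)] z(1)] by blast
          have a: "tmove\<^sup>+\<^sup>+ st (y3, \<one>, Try 0 (Incr True))" using 4 True by (simp add: enter_def)
          show ?thesis unfolding e using tranclp_trans[OF a st'(1)] st'(2) by blast
        next
          case nov: False
          show ?thesis
          proof (cases "final c'")
            case True
            then have e: "hstep p x = Found" using Run vm wb nov by (simp del: fun_upd_apply)
            have "tmove\<^sup>+\<^sup>+ st (y3, \<one>, Stop)" using 4 nov True by (simp add: enter_def)
            then show ?thesis using so' unfolding e simulates_def by auto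
          next
            case False
            then have e: "hstep p x = Run n z c' (shifted mv (\<sigma>(h := x'))) ?h' (Suc k) (walked w wa)"
              using Run vm wb nov by (simp del: fun_upd_apply)
            have "tmove\<^sup>+\<^sup>+ st (y3, \<one>, Try 0 (Gather c' None None))" using 4 nov False by (simp add: enter_def)
            moreover have "?h' < cells n" using h nov by (auto simp: overrun_def)
            ultimately show ?thesis using so' y3(2) sp unfolding e simulates_def search.case by blast
          qed
        qed
      qed
    qed
  qed (use nf in simp)
qed

lemma spanning_zero: "spanning 0 (\<lambda>_. None)"
  by (simp add: spanning_def)

lemma accepts_search:
  "accepts tstep (\<lambda>(_, _, q). q = Stop) (\<lambda>g. Raw (p g), \<one>, Start) \<longleftrightarrow>
   accepts (hstep p) (\<lambda>x. x = Found) (Begin 0 [])"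
proof -
  let ?y = "(\<lambda>g. Raw (p g))(\<one> := Node (p \<one>) None blank_data)"
  have "tmove (\<lambda>g. Raw (p g), \<one>, Start) (?y, \<one>, Try 0 (Clean True))"
    using tmoveI[of Start "\<lambda>g. Raw (p g)" \<one>] by simp
  from accepts_move[OF this] have "accepts tstep (\<lambda>(_, _, q). q = Stop) (\<lambda>g. Raw (p g), \<one>, Start) \<longleftrightarrow>
    accepts tstep (\<lambda>(_, _, q). q = Stop) (?y, \<one>, Try 0 (Clean True))" by (rule sym)
  also have "\<dots> \<longleftrightarrow> accepts (hstep p) (\<lambda>x. x = Found) (Begin 0 [])"
  proof (rule accepts_simulation[where R="simulates p"])
    have "stores p 0 (\<lambda>_. None) (\<lambda>_. blank_data) ?y" by (simp add: stores_def)
    then have "holds p 0 [] ?y" unfolding holds_def using spanning_zero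
      by (intro exI[of _ "\<lambda>_. None"] exI[of _ "\<lambda>_. blank_data"]) simp
    then show "simulates p (?y, \<one>, Try 0 (Clean True)) (Begin 0 [])"
      by (simp add: simulates_def sound_def)
  next
    fix st x assume "simulates p st x" "x \<noteq> Found"
    then show "\<exists>st'. tmove\<^sup>+\<^sup>+ st st' \<and> simulates p st' (hstep p x)" by (rule simulates_step)
  next
    fix st x assume "simulates p st x" "x = Found"
    then show "accepts tstep (\<lambda>(_, _, q). q = Stop) st" by (auto simp: simulates_def intro!: accepts_now)
  qed
  finally show ?thesis .
qed

end

context enumerator
begin

lemma index_less: "index g < m"
proof (cases "g \<in> S \<and> g \<noteq> \<one>")
  case True then show ?thesis using index_props(2) by blast
next
  case False
  show ?thesis
  proof (cases "g \<in> S")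
    case True
    then have "\<exists>k. k < m \<and> s k = g" using gens by auto
    then have "(SOME k. k < m \<and> s k = g) < m \<and> s (SOME k. k < m \<and> s k = g) = g" by (rule someI_ex)
    then show ?thesis using True by (simp add: index_def)
  next
    case False then show ?thesis using m_pos by (simp add: index_def)
  qed
qed

theorem ex_searching_G_machine:
  "\<exists>N :: ('g, 'a tape_symbol) G_machine. is_G_machine S N \<and> gm_blank N = Blank \<and>
     Letter ` A \<subseteq> gm_symbols N \<and> (\<forall>p\<in>patterns G A. gm_accepts G N (map_option Letter \<circ> p) \<longleftrightarrow>
       accepts (hstep p) (\<lambda>x. x = Found) (Begin 0 []))"
proof -
  let ?\<Gamma> = "otm_symbols M" and ?A = "insert None (Some ` A)" and ?g = "insert None (Some ` \<I>)"
  define C where "C = {Scan, Rewind} \<union> Sim ` otm_states M"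
  define K where "K = {Keep, Reset, Lost} \<union> Seek ` {..<m} \<union> Going ` {..<m}"
  define O' where "O' = insert None (Some ` ((UNIV :: bool set) \<times> ?A))"
  define D where "D = {d. case d of Data g x mk ck wk \<Rightarrow> g \<in> ?g \<and> x \<in> ?\<Gamma>}"
  define R where "R = {r. case r of
      Gather c so oo \<Rightarrow> c \<in> C \<and> so \<in> insert None (Some ` ?\<Gamma>) \<and> oo \<in> O'
    | Apply c y mv sk \<Rightarrow> c \<in> C \<and> y \<in> ?\<Gamma> \<and> sk \<in> K
    | Shift c mv cc cs cm \<Rightarrow> c \<in> C \<and> cs \<in> ?\<Gamma>
    | _ \<Rightarrow> True}"
  have fI: "finite \<I>" using finite_A finite_S by simp
  have "finite ?\<Gamma>" "finite (otm_states M)" using M by (simp_all add: is_oracle_tm_def)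
  then have fin: "finite ?\<Gamma>" "finite C" "finite K" "finite O'" "finite ?g"
    using finite_A fI by (simp_all add: C_def K_def O'_def)
  have moves: "UNIV = {Go_Left, Stay, Go_Right}" using head_move.exhaust by blast
  have fmv: "finite (UNIV :: head_move set)" unfolding moves by simp
  have "D \<subseteq> (\<Union>g\<in>?g. \<Union>x\<in>?\<Gamma>. \<Union>mk. \<Union>ck. range (Data g x mk ck))"
  proof
    fix d assume d: "d \<in> D"
    obtain g x mk ck wk where dd: "d = Data g x mk ck wk" by (cases d)
    have "g \<in> ?g" "x \<in> ?\<Gamma>" using d by (simp_all add: dd D_def)
    then show "d \<in> (\<Union>g\<in>?g. \<Union>x\<in>?\<Gamma>. \<Union>mk. \<Union>ck. range (Data g x mk ck))"
      unfolding dd by (intro UN_I[of g] UN_I[of x] UN_I[of mk] UN_I[of ck] rangeI UNIV_I)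
  qed
  then have finD: "finite D" by (rule finite_subset) (use fin fI in simp)
  define U1 where "U1 = (\<Union>c\<in>C. \<Union>so\<in>insert None (Some ` ?\<Gamma>). Gather c so ` O')"
  define U2 where "U2 = (\<Union>c\<in>C. \<Union>y\<in>?\<Gamma>. \<Union>mv. Apply c y mv ` K)"
  define U3 where "U3 = (\<Union>c\<in>C. \<Union>mv. \<Union>cc. \<Union>cs\<in>?\<Gamma>. range (Shift c mv cc cs))"
  have finU: "finite U1" "finite U2" "finite U3" using fin fmv by (simp_all add: U1_def U2_def U3_def)
  have "R \<subseteq> {Grow, Accept} \<union> range Clean \<union> range Incr \<union> U1 \<union> U2 \<union> U3"
  proof
    fix r assume r: "r \<in> R"
    show "r \<in> {Grow, Accept} \<union> range Clean \<union> range Incr \<union> U1 \<union> U2 \<union> U3"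
    proof (cases r)
      case (Gather c so oo)
      then have "c \<in> C" "so \<in> insert None (Some ` ?\<Gamma>)" "oo \<in> O'" using r by (simp_all add: R_def)
      then have "r \<in> U1" unfolding Gather U1_def by (intro UN_I[of c] UN_I[of so] imageI)
      then show ?thesis by simp
    next
      case (Apply c y mv sk)
      then have "c \<in> C" "y \<in> ?\<Gamma>" "sk \<in> K" using r by (simp_all add: R_def)
      then have "r \<in> U2" unfolding Apply U2_def by (intro UN_I[of c] UN_I[of y] UN_I[of mv] imageI UNIV_I)
      then show ?thesis by simp
    next
      case (Shift c mv cc cs cm)
      then have "c \<in> C" "cs \<in> ?\<Gamma>" using r by (simp_all add: R_def)
      then have "r \<in> U3" unfolding Shift U3_def
        by (intro UN_I[of c] UN_I[of mv] UN_I[of cc] UN_I[of cs] rangeI UNIV_I)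
      then show ?thesis by simp
    qed simp_all
  qed
  then have finR: "finite R" by (rule finite_subset) (use finU in simp)
  have Dg: "Data g x mk ck wk \<in> D \<longleftrightarrow> g \<in> ?g \<and> x \<in> ?\<Gamma>" for g x mk ck wk by (simp add: D_def)
  have KK: "Keep \<in> K" "Reset \<in> K" "Lost \<in> K" "Seek j \<in> K \<longleftrightarrow> j < m" "Going j \<in> K \<longleftrightarrow> j < m" for j
    by (auto simp: K_def)
  have RR: "Clean f \<in> R" "Incr cy \<in> R" "Grow \<in> R" "Accept \<in> R"
    "Gather c so oo \<in> R \<longleftrightarrow> c \<in> C \<and> so \<in> insert None (Some ` ?\<Gamma>) \<and> oo \<in> O'"
    "Apply c y mv sk \<in> R \<longleftrightarrow> c \<in> C \<and> y \<in> ?\<Gamma> \<and> sk \<in> K"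
    "Shift c mv cc cs cm \<in> R \<longleftrightarrow> c \<in> C \<and> cs \<in> ?\<Gamma>" for f cy c so oo y mv sk cc cs cm
    by (simp_all add: R_def)
  have O: "None \<in> O'" "Some (rt, i) \<in> O' \<longleftrightarrow> i \<in> ?A" for rt i by (auto simp: O'_def)
  have \<Gamma>: "Blank \<in> ?\<Gamma>" "\<And>x. x \<in> \<I> \<Longrightarrow> Letter x \<in> ?\<Gamma>" by (rule M_symbols(1), erule M_symbols(2))
  have CC: "Scan \<in> C" "Rewind \<in> C" "Sim q \<in> C \<longleftrightarrow> q \<in> otm_states M" for q by (auto simp: C_def)
  have seek: "seek_of wa \<in> K" for wa by (cases wa) (simp_all add: KK index_less)
  have vmc: "c' \<in> C \<and> y \<in> ?\<Gamma>" if c: "c \<in> C" and x: "x \<in> ?\<Gamma>" and v: "vm c x rt i = Some (c', y, mv, wa)"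
    for c x rt i c' y mv wa
  proof (cases c)
    case Scan
    show ?thesis
    proof (cases x)
      case (Letter u)
      then show ?thesis using v x CC(1) Scan by (cases u) (simp_all split: if_splits)
    qed (use v x CC(2) Scan in \<open>simp_all\<close>)
  next
    case Rewind
    then have "c' = Sim (otm_init M) \<or> c' = Rewind" "y = x" using v by (simp_all split: if_splits)
    then show ?thesis using x CC(2,3) M_states(1) by auto
  next
    case (Sim q)
    then have q: "q \<in> otm_states M" using c CC by simp
    obtain x1 q1 mv1 e where d: "otm_delta M (x, q) = (x1, q1, mv1, e)" by (metis prod_cases4)
    note cl = M_delta(1,2)[OF d x q]
    show ?thesis
    proof (cases "q = otm_query M")
      case True
      then have "y = x" "c' = Sim (if rt then otm_yes M else otm_no M)" using v Sim by simp_all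
      then show ?thesis using x M_states(2,3) CC(3) by simp
    next
      case False
      then have "y = x1" "c' = Sim q1" using v Sim d by simp_all
      then show ?thesis using cl CC(3) by simp
    qed
  qed
  have enter_apply: "Apply c' y mv (seek_of wa) \<in> R" if "c' \<in> C \<and> y \<in> ?\<Gamma>" for c' y mv wa
    using that seek by (simp add: RR)
  have "\<exists>N :: ('g, 'a tape_symbol) G_machine. is_G_machine S N \<and> gm_blank N = Blank \<and>
     Letter ` A \<subseteq> gm_symbols N \<and> (\<forall>p\<in>patterns G A. gm_accepts G N (map_option Letter \<circ> p) \<longleftrightarrow>
       accepts tstep (\<lambda>(_, _, q). q = Stop) (\<lambda>g. Raw (p g), \<one>, Start))"
  proof (rule ex_G_machine[where R=R and D=D])
    show "blank_data \<in> D" using \<Gamma> by (simp add: Dg)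
    show "Clean True \<in> R" by (rule RR)
  next
    fix r k i b d assume r: "r \<in> R" and k: "k < m" and i: "i \<in> ?A" and d: "d \<in> D"
    obtain g x mk ck wk where dd: "d = Data g x mk ck wk" by (cases d)
    have gx: "g \<in> ?g" "x \<in> ?\<Gamma>" using d by (simp_all add: dd Dg)
    show "eupd r k i b d \<in> R \<times> D"
    proof (cases r)
      case (Clean f)
      have "(case g of None \<Rightarrow> Blank | Some a \<Rightarrow> Letter a) \<in> ?\<Gamma>"
      proof (cases g)
        case (Some a)
        then have "a \<in> \<I>" using gx(1) by blast
        then show ?thesis using Some \<Gamma>(2) by simp
      qed (simp add: \<Gamma>(1))
      then show ?thesis using gx unfolding dd Clean by (simp add: RR Dg)
    next
      case (Gather c so oo)
      then have "c \<in> C" "so \<in> insert None (Some ` ?\<Gamma>)" "oo \<in> O'" using r by (simp_all only: RR)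
      moreover have "Some x \<in> insert None (Some ` ?\<Gamma>)" using gx(2) by blast
      ultimately show ?thesis using gx i unfolding dd Gather
        by (cases mk; cases wk) (simp_all add: RR(5) Dg O del: insert_iff)
    next
      case (Apply c y mv sk)
      then have "c \<in> C" "y \<in> ?\<Gamma>" "sk \<in> K" using r by (simp_all add: RR)
      then show ?thesis using gx unfolding dd Apply by (cases sk) (simp_all add: RR Dg KK)
    next
      case (Shift c mv cc cs cm)
      then have "c \<in> C" "cs \<in> ?\<Gamma>" using r by (simp_all add: RR)
      then show ?thesis using gx unfolding dd Shift by (simp add: RR Dg)
    next
      case (Incr cy)
      have l0: "Some (letter 0) \<in> ?g" using letter_in[OF b_pos] by blast
      show ?thesis
      proof (cases "k = 0 \<and> cy")
        case True
        show ?thesis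
        proof (cases g)
          case None
          then show ?thesis using True gx(2) l0 unfolding dd Incr by (simp add: RR Dg del: insert_iff)
        next
          case (Some a)
          show ?thesis
          proof (cases "nxt a")
            case None
            then show ?thesis using True Some gx(2) l0 unfolding dd Incr by (simp add: RR Dg del: insert_iff)
          next
            case (Some a')
            then have "Some a' \<in> ?g" using nxt_in by blast
            then show ?thesis using True \<open>g = Some a\<close> Some gx(2) unfolding dd Incr by (simp add: RR Dg del: insert_iff)
          qed
        qed
      next
        case False
        then have "eupd r k i b d = (Incr cy, d)" unfolding dd Incr by auto
        then show ?thesis using d by (simp add: RR)
      qed
    next
      case Grow
      then show ?thesis using gx \<Gamma> unfolding dd by (simp add: RR Dg)
    next
      case Accept
      then show ?thesis using d by (simp add: RR)
    qed
  next
    fix r k assume r: "r \<in> R" and k: "k < m"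
    show "enew r k \<in> R \<times> insert None (Some ` D)"
      using r \<Gamma> by (cases r) (simp_all add: RR Dg KK)
  next
    fix r assume r: "r \<in> R"
    show "eeps r \<in> R"
    proof (cases r)
      case (Gather c so oo)
      then have g: "c \<in> C" "so \<in> insert None (Some ` ?\<Gamma>)" using r by (simp_all add: RR)
      show ?thesis
      proof (cases so)
        case None
        then show ?thesis unfolding Gather by (simp add: RR)
      next
        case (Some x)
        then have x: "so = Some x" "x \<in> ?\<Gamma>" using g(2) by auto
        show ?thesis
        proof (cases oo)
          case None
          then show ?thesis unfolding Gather using x by (simp add: RR)
        next
          case (Some q)
          obtain rt i where q: "oo = Some (rt, i)" using Some by (cases q) simp
          show ?thesis
          proof (cases "vm c x rt i")
            case None
            then show ?thesis unfolding Gather using x q by (simp add: RR)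
          next
            case (Some v)
            obtain c' y mv wa where v: "vm c x rt i = Some (c', y, mv, wa)" using Some by (cases v) simp
            from vmc[OF g(1) x(2) v] have "Apply c' y mv (seek_of wa) \<in> R" by (rule enter_apply)
            then show ?thesis using x q v unfolding Gather by simp
          qed
        qed
      qed
    qed (use r \<Gamma> CC in \<open>simp_all add: RR O\<close>)
  qed (use finR finD finite_A in simp_all)
  then show ?thesis unfolding accepts_search .
qed

lemma matches_segment:
  "u \<in> lists S \<Longrightarrow> w \<in> carrier G \<Longrightarrow> matches p w (map Inl u @ Inr a # z) \<longleftrightarrow> p (w \<otimes> val u) = Some a \<and> matches p \<one> z"
  by (induction u arbitrary: w) (simp_all add: m_assoc)

lemma matches_encode_listing:
  "fst ` set l \<subseteq> lists S \<Longrightarrow> matches p \<one> (encode_listing l) \<longleftrightarrow> (\<forall>w a. (w, a) \<in> set l \<longrightarrow> p (val w) = Some a)"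
proof (induction l)
  case (Cons x l)
  obtain w a where x: "x = (w, a)" by fastforce
  have "encode_listing (x # l) = map Inl w @ Inr a # encode_listing l" by (simp add: encode_listing_def x)
  moreover have "w \<in> lists S" using Cons.prems x by simp
  ultimately show ?case using matches_segment[of w \<one> p a "encode_listing l"] Cons x by auto
qed (simp add: encode_listing_def)

end

context fg_group
begin

text \<open>The accepted patterns are those that contain a member of \<open>C\<close> at the identity. This suffices because
patterns are forbidden at all positions.\<close>

theorem G_re_of_effectively_closed:
  assumes inf: "infinite (carrier G)" and A: "finite A" and X: "effectively_closed G S A X"
  shows "\<exists>F. G_recursively_enumerable G S A F \<and> X = forbidding_patterns G A F"
proof -
  obtain C where C: "C \<subseteq> pattern_codings S A" and XC: "X = forbidding_codings G A C"
    and re: "oracle_re S (word_problem G S) (S <+> A) {encode_listing l | l. set l \<in> C}"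
    using X unfolding effectively_closed_def oracle_re_codings_def by (elim exE conjE)
  obtain M where M: "is_oracle_tm (S <+> A) S M" and
    acc: "\<forall>w\<in>lists (S <+> A). otm_accepts (word_problem G S) M w \<longleftrightarrow> w \<in> {encode_listing l | l. set l \<in> C}"
    using re unfolding oracle_re_def by (elim exE conjE)
  obtain gl where gl: "set gl = S" using finite_list[OF finite_S] by blast
  define s where "s i = (\<one> # gl) ! i" for i
  have "s ` {..<length (\<one> # gl)} = set (\<one> # gl)"
    unfolding s_def set_conv_nth by auto
  then have gens: "s ` {..<Suc (length gl)} = S" using gl S_one by auto
  have "finite (S <+> A)" using finite_S A by simp
  then obtain letter :: "nat \<Rightarrow> 'g + 'a" and b where letter: "letter ` {..<b} = S <+> A" "inj_on letter {..<b}"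
    using finite_imp_nat_seg_image_inj_on[of "S <+> A"] by (auto simp: lessThan_def)
  interpret enumerator G S s "Suc (length gl)" M A letter b
    by unfold_locales (use gens A M letter in \<open>simp_all add: s_def\<close>)
  obtain N :: "('g, 'a tape_symbol) G_machine" where N: "is_G_machine S N" "gm_blank N = Blank"
      "Letter ` A \<subseteq> gm_symbols N"
    and Nacc: "\<forall>p\<in>patterns G A. gm_accepts G N (map_option Letter \<circ> p) \<longleftrightarrow>
       accepts (hstep p) (\<lambda>x. x = Found) (Begin 0 [])"
    using ex_searching_G_machine by blast
  define F where "F = {p \<in> patterns G A. gm_accepts G N (map_option Letter \<circ> p)}"
  have listing: "fst ` set l \<subseteq> lists S" "encode_listing l \<in> lists (S <+> A)" if "set l \<in> C" for l
  proof -
    have sl: "set l \<subseteq> lists S \<times> A" using that C by (auto simp: pattern_codings_def)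
    then show "fst ` set l \<subseteq> lists S" by auto
    show "encode_listing l \<in> lists (S <+> A)" using sl set_encode_listing[of l S A] by (simp add: lists_eq_set)
  qed
  have F_iff: "p \<in> F \<longleftrightarrow> (\<exists>l. set l \<in> C \<and> (\<forall>w a. (w, a) \<in> set l \<longrightarrow> p (val w) = Some a))"
    if p: "p \<in> patterns G A" for p
  proof -
    have "p \<in> F \<longleftrightarrow> (\<exists>z\<in>lists (S <+> A). matches p \<one> z \<and> otm_accepts (word_problem G S) M z)"
      using Nacc p search_finds_iff[OF inf, of p] by (simp add: F_def)
    also have "\<dots> \<longleftrightarrow> (\<exists>l. set l \<in> C \<and> (\<forall>w a. (w, a) \<in> set l \<longrightarrow> p (val w) = Some a))"
    proof
      assume "\<exists>z\<in>lists (S <+> A). matches p \<one> z \<and> otm_accepts (word_problem G S) M z"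
      then obtain z where z: "z \<in> lists (S <+> A)" "matches p \<one> z" "otm_accepts (word_problem G S) M z" by blast
      then obtain l where l: "z = encode_listing l" "set l \<in> C" using acc by blast
      then show "\<exists>l. set l \<in> C \<and> (\<forall>w a. (w, a) \<in> set l \<longrightarrow> p (val w) = Some a)"
        using z(2) matches_encode_listing[OF listing(1)[OF l(2)]] by blast
    next
      assume "\<exists>l. set l \<in> C \<and> (\<forall>w a. (w, a) \<in> set l \<longrightarrow> p (val w) = Some a)"
      then obtain l where l: "set l \<in> C" "\<forall>w a. (w, a) \<in> set l \<longrightarrow> p (val w) = Some a" by blast
      then have "matches p \<one> (encode_listing l)" using matches_encode_listing[OF listing(1)[OF l(1)]] by blast
      moreover have "otm_accepts (word_problem G S) M (encode_listing l)" using acc listing(2)[OF l(1)] l(1) by blast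
      ultimately show "\<exists>z\<in>lists (S <+> A). matches p \<one> z \<and> otm_accepts (word_problem G S) M z"
        using listing(2)[OF l(1)] by blast
    qed
    finally show ?thesis .
  qed
  have "forbidding_patterns G A F = forbidding_codings G A C"
  proof (rule forbidding_codings_cong)
    fix p assume "p \<in> F"
    then show "\<exists>c\<in>C. \<forall>w a. (w, a) \<in> c \<longrightarrow> p (val w) = Some a" using F_iff[of p] by (auto simp: F_def)
  next
    fix c assume "c \<in> C" then show "c \<subseteq> lists S \<times> A" using C by (auto simp: pattern_codings_def)
  next
    fix c assume c: "c \<in> C" and cons: "\<forall>w w' a a'. (w, a) \<in> c \<longrightarrow> (w', a') \<in> c \<longrightarrow> val w = val w' \<longrightarrow> a = a'"
    have cs: "finite c" "c \<subseteq> lists S \<times> A" using c C by (auto simp: pattern_codings_def)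
    obtain p where p: "p \<in> patterns G A" "\<And>w a. (w, a) \<in> c \<Longrightarrow> p (val w) = Some a"
      "\<And>g a. p g = Some a \<Longrightarrow> \<exists>w. (w, a) \<in> c \<and> val w = g" using ex_pattern_of_coding[OF cs cons] by metis
    obtain l where "set l = c" using finite_list[OF cs(1)] by blast
    then have "p \<in> F" using F_iff[OF p(1)] c p(2) by blast
    then show "\<exists>p\<in>F. \<forall>g a. p g = Some a \<longrightarrow> (\<exists>w. (w, a) \<in> c \<and> val w = g)" using p(3) by blast
  qed
  moreover have "G_recursively_enumerable G S A F"
    unfolding G_recursively_enumerable_def using N by (intro conjI exI[of _ N]) (auto simp: F_def)
  ultimately show ?thesis using XC by blast
qed

end

section \<open>The equivalence\<close>

theorem corollary3p5:
  fixes G :: "('g, 'm) monoid_scheme" and S :: "'g set" and A :: "'a set"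
    and X :: "('g \<Rightarrow> 'a) set"
  assumes "group G"
    and "finite S" and "S \<subseteq> carrier G" and "generate G S = carrier G"
    and "\<And>s. s \<in> S \<Longrightarrow> inv\<^bsub>G\<^esub> s \<in> S" and "\<one>\<^bsub>G\<^esub> \<in> S"
    and "finite A"
    and "subshift G A X"
  shows "effectively_closed G S A X \<longleftrightarrow>
    (\<exists>F. G_recursively_enumerable G S A F \<and> X = forbidding_patterns G A F)"
proof -
  interpret group G by (rule assms(1))
  interpret fg_group G S by unfold_locales (use assms in auto)
  show ?thesis
  proof
    assume X: "effectively_closed G S A X"
    show "\<exists>F. G_recursively_enumerable G S A F \<and> X = forbidding_patterns G A F"
    proof (cases "finite (carrier G)")
      case True
      obtain F where "F \<subseteq> patterns G A" "X = forbidding_patterns G A F"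
        using subshift_of_finite_group[OF True assms(8)] by blast
      then show ?thesis using G_re_of_finite_group[OF True assms(7)] by blast
    next
      case False
      then show ?thesis using G_re_of_effectively_closed X assms(7) by blast
    qed
  next
    assume "\<exists>F. G_recursively_enumerable G S A F \<and> X = forbidding_patterns G A F"
    then show "effectively_closed G S A X" using effectively_closed_of_G_re assms(7) by blast
  qed
qed

end
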